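(* Let $C,\varrho_0\in\mathbb{R}_{>0}$, $H$ a Hilbert space, and let $\Phi:\bigcap_{\eta>0}H_{\eta,0}(\mathbb{R})\otimes(H\oplus H)\to\bigcap_{\eta>0}H_{\eta,0}(\mathbb{R})\otimes H$ be such that for every $\varrho>\varrho_0$ there is $K>0$ with $$|\Phi(0)|_{\varrho,0}\le K\quad\text{and}\quad|\Phi(u)-\Phi(w)|_{\varrho,0}\le C|u-w|_{\varrho,0}$$ for all $u,w\in\bigcap_{\eta>0}H_{\eta,0}(\mathbb{R})\otimes(H\oplus H)$. Let $\alpha,\beta:\mathbb{R}\to\mathbb{R}$ be bijective, Lipschitz continuous, with bounded measurable derivatives a.e., such that $\alpha(s)\ge s$ and $\beta(s)\ge s+\varepsilon_0$ for some $\varepsilon_0>0$ and all $s\in\mathbb{R}$. For $\varrho>\varrho_0$ let $\Phi_\varrho:H_{\varrho,0}(\mathbb{R})\otimes(H\oplus H)\to H_{\varrho,0}(\mathbb{R})\otimes H$ be the continuous extension of $\Phi$. Then there is $\varrho_1>\varrho_0$ such that for every $\varrho\ge\varrho_1$ the equation $$\partial_{0,\varrho}u=\Phi_\varrho\big(u\circ\alpha^{-1},(\partial_{0,\varrho}u)\circ\beta^{-1}\big)$$ admits a unique solution $u\in H_{\varrho,0}(\mathbb{R})\otimes H$ (with $\partial_{0,\varrho}u\in H_{\varrho,0}(\mathbb{R})\otimes H$, so that the right-hand side is defined). Furthermore, the solution operator is causal, i.e. the mapping $u\mapsto\partial_{0,\varrho}^{-1}\Phi_\varrho(u\circ\alpha^{-1},(\partial_{0,\varrho}u)\circ\beta^{-1})$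 is causal on its domain $\{u\in H_{\varrho,0}(\mathbb{R})\otimes H:\partial_{0,\varrho}u\in H_{\varrho,0}(\mathbb{R})\otimes H\}$.
   Context: For $\varrho\in\mathbb{R}$ and a Hilbert space $X$, $H_{\varrho,0}(\mathbb{R})\otimes X$ is the Hilbert space of (classes of) measurable $f:\mathbb{R}\to X$ with $|f|_{\varrho,0}^2=\int_{\mathbb{R}}|f(t)|_X^2e^{-2\varrho t}dt<\infty$; $H\oplus H$ carries the norm $|(a,b)|^2=|a|_H^2+|b|_H^2$. For $\varrho\ne0$, $\partial_{0,\varrho}$ is the (distributional) derivative in $H_{\varrho,0}(\mathbb{R})\otimes H$ with domain $\{f: f'\in H_{\varrho,0}(\mathbb{R})\otimes H\}$, continuously invertible with inverse $\partial_{0,\varrho}^{-1}$. A mapping $W$ with domain in $H_{\varrho,0}(\mathbb{R})\otimes H$ and values in $H_{\varrho,0}(\mathbb{R})\otimes H$ is causal if for all $a\in\mathbb{R}$ and $x,y$ in its domain, $\chi_{\mathbb{R}_{<a}}(x-y)=0$ implies $\chi_{\mathbb{R}_{<a}}(W(x)-W(y))=0$ (multiplication by the indicator of $(-\infty,a)$). *)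

theory Defs
  imports "HOL-Analysis.Analysis"
begin

text \<open>Membership in the weighted space H_{rho,0}(R) (x) X: strongly (Bochner) measurable,
  i.e. Borel measurable and essentially separably valued, with finite weighted L2 norm.\<close>
definition L2w :: "real \<Rightarrow> (real \<Rightarrow> 'a::real_normed_vector) \<Rightarrow> bool" where
  "L2w \<rho> f \<longleftrightarrow> f \<in> borel_measurable lborel
     \<and> (\<exists>S. countable S \<and> (AE t in lborel. f t \<in> closure S))
     \<and> integrable lborel (\<lambda>t. (norm (f t))^2 * exp (-2 * \<rho> * t))"

definition wnorm :: "real \<Rightarrow> (real \<Rightarrow> 'a::real_normed_vector) \<Rightarrow> real" where
  "wnorm \<rho> f = sqrt (LINT t|lborel. (norm (f t))^2 * exp (-2 * \<rho> * t))"

definition test_function :: "(real \<Rightarrow> real) \<Rightarrow> bool" where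
  "test_function \<phi> \<longleftrightarrow>
     (\<exists>D. D 0 = \<phi> \<and> (\<forall>n t. (D n has_real_derivative D (Suc n) t) (at t)))
     \<and> bounded {t. \<phi> t \<noteq> 0}"

definition weak_deriv :: "real \<Rightarrow> (real \<Rightarrow> 'a::real_inner) \<Rightarrow> (real \<Rightarrow> 'a) \<Rightarrow> bool" where
  "weak_deriv \<rho> f g \<longleftrightarrow> L2w \<rho> f \<and> L2w \<rho> g \<and>
     (\<forall>\<phi> h. test_function \<phi> \<longrightarrow>
        (LINT t|lborel. deriv \<phi> t * inner (f t) h) = - (LINT t|lborel. \<phi> t * inner (g t) h))"

text \<open>Domain of partial_{0,rho}, the operator itself and its inverse (values determined a.e.).\<close>
definition dom_d0 :: "real \<Rightarrow> (real \<Rightarrow> 'a::real_inner) set" where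
  "dom_d0 \<rho> = {u. \<exists>v. weak_deriv \<rho> u v}"

definition d0 :: "real \<Rightarrow> (real \<Rightarrow> 'a::real_inner) \<Rightarrow> (real \<Rightarrow> 'a)" where
  "d0 \<rho> u = (SOME v. weak_deriv \<rho> u v)"

definition d0_inv :: "real \<Rightarrow> (real \<Rightarrow> 'a::real_inner) \<Rightarrow> (real \<Rightarrow> 'a)" where
  "d0_inv \<rho> f = (SOME w. weak_deriv \<rho> w f)"

definition cont_ext :: "real \<Rightarrow> ((real \<Rightarrow> 'a::real_normed_vector) \<Rightarrow> (real \<Rightarrow> 'b::real_normed_vector))
     \<Rightarrow> ((real \<Rightarrow> 'a) \<Rightarrow> (real \<Rightarrow> 'b)) \<Rightarrow> bool" where
  "cont_ext \<rho> \<Phi> \<Psi> \<longleftrightarrow> (\<forall>u. L2w \<rho> u \<longrightarrow> L2w \<rho> (\<Psi> u) \<and>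
     (\<forall>us. (\<forall>n. \<forall>\<eta>>0. L2w \<eta> (us n)) \<longrightarrow> (\<lambda>n. wnorm \<rho> (\<lambda>t. us n t - u t)) \<longlonglongrightarrow> 0
        \<longrightarrow> (\<lambda>n. wnorm \<rho> (\<lambda>t. \<Phi> (us n) t - \<Psi> u t)) \<longlonglongrightarrow> 0))"

definition causal :: "(real \<Rightarrow> 'a) set \<Rightarrow> ((real \<Rightarrow> 'a) \<Rightarrow> (real \<Rightarrow> 'b)) \<Rightarrow> bool" where
  "causal Dom W \<longleftrightarrow> (\<forall>a x y. x \<in> Dom \<longrightarrow> y \<in> Dom \<longrightarrow>
      (AE t in lborel. t < a \<longrightarrow> x t = y t) \<longrightarrow> (AE t in lborel. t < a \<longrightarrow> W x t = W y t))"

end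

theory Submission
  imports Defs
begin

text \<open>Writing \<open>v\<close> for the derivative of \<open>u\<close>, the equation reads
  \<open>v = \<Psi> (I v \<circ> \<alpha>\<^sup>-\<^sup>1, v \<circ> \<beta>\<^sup>-\<^sup>1)\<close>, where \<open>I\<close> integrates from minus infinity. In the weighted
  norm \<open>I\<close> is bounded by \<open>1 / \<rho>\<close>, and composition with \<open>\<beta>\<^sup>-\<^sup>1\<close> by a constant times
  \<open>exp (- \<rho> \<epsilon>)\<close> since \<open>\<beta>\<close> delays by at least \<open>\<epsilon>\<close>; so for large \<open>\<rho>\<close> the right-hand side is a
  contraction. Causality of \<open>\<Psi>\<close> follows because the Lipschitz constant of \<open>\<Phi>\<close> does not depend
  on the weight, which may thus be sent to infinity.

  The Hilbert space need not be separable. A Borel function on the real line nevertheless has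
  separable range, so sums and pairs of Borel functions are Borel: otherwise the range
  contains an uncountable uniformly discrete set, and a choice of preimages yields an uncountable
  Borel set of reals all of whose subsets are Borel, which contradicts the perfect set property.
  Vector-valued antiderivatives are obtained weakly, through Riesz representation.\<close>

text \<open>\<open>\<Psi>\<close> is known only through limits of \<open>\<Phi>\<close>, and
  \<open>\<Phi>\<close> is controlled only on functions lying in all weighted spaces. Cutting a
  function off outside a compact interval puts it into all of them, so each property of
  \<open>\<Psi>\<close> is proved for \<open>\<Phi>\<close> on truncations and then carried to the
  limit at the fixed weight. This order matters for causality: the weight can be raised for
  \<open>\<Phi>\<close> alone, as \<open>\<Psi>\<close> belongs to a single \<open>\<rho>\<close>.
  Functions stand in for classes, and \<open>d0\<close> and \<open>d0_inv\<close> choose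
  representatives. The argument therefore runs on the relation \<open>weak_deriv\<close>, which for
  positive \<open>\<rho>\<close> determines each side from the other up to null sets and respects
  agreement before a time \<open>a\<close> in both directions. That \<open>\<Psi>\<close> respects
  equality almost everywhere is a consequence of its Lipschitz estimate. Separability matters
  because a product of nonseparable spaces may have more Borel sets than the product of the Borel
  algebras, so that a difference of two Borel functions could fail to be Borel.\<close>

subsection \<open>Borel functions on the real line have separable range\<close>

text \<open>The Lusin-Souslin form of a Borel set: an injective projection of a closed subset of a
  Polish space. The extra coordinates hold a certificate of membership, unique for each point.
  Closedness allows such sets to be counted, and injectivity carries cardinalities from
  \<open>C\<close> to \<open>S\<close>.\<close>

definition inj_closed_proj :: "real set \<Rightarrow> bool" where
  "inj_closed_proj S \<longleftrightarrow> (\<exists>C::(real \<times> (nat \<Rightarrow> real)) set. closed C \<and> inj_on fst C \<and> fst ` C = S)"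

lemma inj_closed_proj_closed:
  assumes "closed S" shows "inj_closed_proj S"
  unfolding inj_closed_proj_def
proof (intro exI conjI)
  show "closed (S \<times> {\<lambda>_::nat. 0::real})"
    using assms by (intro closed_Times) auto
qed (auto simp: inj_on_def)

lemma continuous_on_snd_coordinate:
  "continuous_on UNIV (\<lambda>p::real \<times> (nat \<Rightarrow> real). snd p i)"
  by (rule continuous_on_product_then_coordinatewise[OF continuous_on_snd[OF continuous_on_id]])

text \<open>An open set becomes closed once the reciprocal of the distance to the complement is
  recorded, since this coordinate escapes to infinity at the boundary. All other coordinates are set
  to 0 to keep the certificate unique.\<close>

lemma inj_closed_proj_open:
  assumes "open U" shows "inj_closed_proj U"
proof (cases "U = UNIV")
  \<comment> \<open>\<open>infdist\<close> to the empty set is 0 by convention, so the reciprocal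
    would not exist on the whole line.\<close>
  case True
  then show ?thesis by (simp add: inj_closed_proj_closed)
next
  case False
  let ?C = "{p::real \<times> (nat \<Rightarrow> real). infdist (fst p) (- U) * snd p 0 = 1 \<and> (\<forall>i. snd p (Suc i) = 0)}"
  have pos: "infdist x (- U) \<noteq> 0 \<longleftrightarrow> x \<in> U" for x
    using in_closed_iff_infdist_zero[of "- U" x] assms False by auto
  show ?thesis
    unfolding inj_closed_proj_def
  proof (intro exI conjI)
    show "closed ?C"
      by (intro closed_Collect_conj closed_Collect_all closed_Collect_eq continuous_intros
          continuous_on_snd_coordinate)
    show "inj_on fst ?C"
    proof (rule inj_onI)
      fix p q assume p: "p \<in> ?C" and q: "q \<in> ?C" and e: "fst p = fst q"
      have "snd p i = snd q i" for i
        using p q e by (cases i) (auto simp: mult_cancel_left, metis mult_cancel_left mult_zero_left zero_neq_one)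
      then show "p = q" using e by (simp add: prod_eq_iff ext)
    qed
    show "fst ` ?C = U"
    proof safe
      fix x and z :: "nat \<Rightarrow> real" assume "infdist (fst (x, z)) (- U) * snd (x, z) 0 = 1"
      then have "infdist x (- U) \<noteq> 0" by auto
      then show "fst (x, z) \<in> U" using pos by simp
    next
      fix x assume "x \<in> U"
      then have "(x, \<lambda>i. if i = 0 then 1 / infdist x (- U) else 0) \<in> ?C"
        using pos[of x] by simp
      then show "x \<in> fst ` ?C" by (rule image_eqI[rotated]) simp
    qed
  qed
qed

lemma continuous_on_reindex:
  "continuous_on UNIV (\<lambda>p::real \<times> (nat \<Rightarrow> real). (fst p, \<lambda>j::nat. snd p (f j)))"
  by (intro continuous_on_Pair continuous_on_fst continuous_on_id continuous_on_coordinatewise_then_product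
      continuous_on_snd_coordinate)

text \<open>The certificates for all \<open>A i\<close> are stored side by side:
  \<open>prod_encode\<close> splits the coordinates into countably many blocks, and block
  \<open>i\<close> certifies membership in \<open>A i\<close>.\<close>

lemma inj_closed_proj_INT:
  assumes "\<And>i::nat. inj_closed_proj (A i)" shows "inj_closed_proj (\<Inter>i. A i)"
proof -
  obtain C :: "nat \<Rightarrow> (real \<times> (nat \<Rightarrow> real)) set"
    where C: "\<And>i. closed (C i)" "\<And>i. inj_on fst (C i)" "\<And>i. fst ` C i = A i"
    using assms(1) unfolding inj_closed_proj_def by metis
  define r where "r i p = (fst p, \<lambda>j::nat. snd p (prod_encode (i, j)))" for i and p :: "real \<times> (nat \<Rightarrow> real)"
  let ?D = "\<Inter>i. r i -` C i"
  show ?thesis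
    unfolding inj_closed_proj_def
  proof (intro exI conjI)
    show "closed ?D"
      unfolding r_def by (intro closed_INT ballI closed_vimage C continuous_on_reindex)
    show "inj_on fst ?D"
    proof (rule inj_onI)
      fix p q assume p: "p \<in> ?D" and q: "q \<in> ?D" and e: "fst p = fst q"
      have "r i p = r i q" for i
        by (rule inj_onD[OF C(2)[of i]]) (use p q e in \<open>auto simp: r_def\<close>)
      then have eq: "snd p (prod_encode (i, j)) = snd q (prod_encode (i, j))" for i j
        by (auto simp: r_def dest: fun_cong)
      have "snd p n = snd q n" for n
        using eq[of "fst (prod_decode n)" "snd (prod_decode n)"] by simp
      then show "p = q" using e by (simp add: prod_eq_iff ext)
    qed
    show "fst ` ?D = (\<Inter>i. A i)"
    proof (intro equalityI subsetI)
      fix x assume "x \<in> fst ` ?D"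
      then obtain p where p: "p \<in> ?D" "x = fst p" by blast
      have "x \<in> A i" for i
      proof -
        have "r i p \<in> C i" "fst (r i p) = x" using p by (auto simp: r_def)
        then show ?thesis using C(3)[of i] by force
      qed
      then show "x \<in> (\<Inter>i. A i)" by blast
    next
      fix x assume "x \<in> (\<Inter>i. A i)"
      then have "\<exists>z. (x, z) \<in> C i" for i using C(3)[of i] by force
      then obtain z where z: "\<And>i. (x, z i) \<in> C i" by metis
      have "(x, \<lambda>n. z (fst (prod_decode n)) (snd (prod_decode n))) \<in> ?D"
        using z by (auto simp: r_def)
      then show "x \<in> fst ` ?D" by force
    qed
  qed
qed

text \<open>Coordinate 0 names the index of the piece containing the point, and the remaining ones
  carry the certificate for that piece. Disjointness makes the index unique, so the projection stays
  injective.\<close>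

lemma inj_closed_proj_disjoint_UN:
  assumes "\<And>i::nat. inj_closed_proj (A i)" and disj: "disjoint_family A"
  shows "inj_closed_proj (\<Union>i. A i)"
proof -
  obtain C :: "nat \<Rightarrow> (real \<times> (nat \<Rightarrow> real)) set"
    where C: "\<And>i. closed (C i)" "\<And>i. inj_on fst (C i)" "\<And>i. fst ` C i = A i"
    using assms(1) unfolding inj_closed_proj_def by metis
  define s where "s p = (fst p, \<lambda>j::nat. snd p (Suc j))" for p :: "real \<times> (nat \<Rightarrow> real)"
  \<comment> \<open>An infinite union of closed sets need not be closed. As the index is a natural
    number, the union is rewritten as an intersection of closed conditions: the index is at distance
    at least 1 from \<open>n\<close>, or the rest lies in \<open>C n\<close>.\<close>
  let ?D = "{p. snd p 0 \<in> \<nat>} \<inter> (\<Inter>n. {p. 1 \<le> \<bar>snd p 0 - real n\<bar>} \<union> s -` C n)"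
  have D: "p \<in> ?D \<longleftrightarrow> (\<exists>n. snd p 0 = real n \<and> s p \<in> C n)" for p
  proof
    assume p: "p \<in> ?D"
    then obtain n where n: "snd p 0 = real n" by (auto elim: Nats_cases)
    with p have "1 \<le> \<bar>snd p 0 - real n\<bar> \<or> s p \<in> C n" by blast
    with n show "\<exists>n. snd p 0 = real n \<and> s p \<in> C n" by auto
  next
    assume "\<exists>n. snd p 0 = real n \<and> s p \<in> C n"
    then obtain n where n: "snd p 0 = real n" "s p \<in> C n" by blast
    have "1 \<le> \<bar>real n - real m\<bar> \<or> s p \<in> C m" for m
      using n(2) by (cases "m = n") auto
    with n(1) show "p \<in> ?D" by auto
  qed
  show ?thesis
    unfolding inj_closed_proj_def
  proof (intro exI conjI)
    have "closed {p::real \<times> (nat \<Rightarrow> real). snd p 0 \<in> \<nat>}"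
    proof -
      have "closed ((\<lambda>p::real \<times> (nat \<Rightarrow> real). snd p 0) -` \<nat>)"
        by (intro closed_vimage closed_Nats continuous_on_snd_coordinate)
      then show ?thesis by (simp add: vimage_def)
    qed
    then show "closed ?D"
      unfolding s_def
      by (intro closed_Int closed_INT ballI closed_Un closed_vimage C continuous_on_reindex
          closed_Collect_le continuous_intros continuous_on_snd_coordinate) auto
    show "inj_on fst ?D"
    proof (rule inj_onI)
      fix p q assume "p \<in> ?D" "q \<in> ?D" and e: "fst p = fst q"
      then obtain n m where n: "snd p 0 = real n" "s p \<in> C n" and m: "snd q 0 = real m" "s q \<in> C m"
        unfolding D by blast
      have "fst p \<in> A n" "fst p \<in> A m"
        using imageI[OF n(2), of fst] imageI[OF m(2), of fst] C(3) e by (auto simp: s_def)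
      then have nm: "n = m" using disj by (auto simp: disjoint_family_on_def)
      have "s p = s q"
        by (rule inj_onD[OF C(2)[of n]]) (use n m nm e in \<open>auto simp: s_def\<close>)
      then have "snd p (Suc i) = snd q (Suc i)" for i
        by (auto simp: s_def dest: fun_cong)
      then have "snd p i = snd q i" for i using n m nm by (cases i) auto
      then show "p = q" using e by (simp add: prod_eq_iff ext)
    qed
    show "fst ` ?D = (\<Union>i. A i)"
    proof (intro equalityI subsetI)
      fix x assume "x \<in> fst ` ?D"
      then obtain p where p: "p \<in> ?D" "x = fst p" by (rule imageE)
      then obtain n where n: "s p \<in> C n" unfolding D by blast
      then have "x \<in> A n" using imageI[OF n, of fst] C(3)[of n] p(2) by (simp add: s_def)
      then show "x \<in> (\<Union>i. A i)" by blast
    next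
      fix x assume "x \<in> (\<Union>i. A i)"
      then obtain n where "x \<in> fst ` C n" using C(3) by blast
      then obtain z where "(x, z) \<in> C n" by force
      then have "(x, case_nat (real n) z) \<in> ?D"
        unfolding D by (intro exI[of _ n]) (simp add: s_def)
      then show "x \<in> fst ` ?D" by (rule image_eqI[rotated]) simp
    qed
  qed
qed

text \<open>The induction treats \<open>S\<close> and \<open>- S\<close> together because the class
  has no evident closure under complements; the complement of a union is then an intersection of
  complements.\<close>

lemma borel_imp_inj_closed_proj:
  fixes S :: "real set"
  assumes "S \<in> sets borel" shows "inj_closed_proj S"
proof -
  have "S \<in> sigma_sets UNIV {S. open S}" using assms by (simp add: borel_def)
  then have "inj_closed_proj S \<and> inj_closed_proj (- S)"
  proof (induction S rule: sigma_sets.induct)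
    case (Basic a)
    then show ?case by (auto intro: inj_closed_proj_open inj_closed_proj_closed)
  next
    case Empty
    then show ?case by (auto intro: inj_closed_proj_closed)
  next
    case (Compl a)
    then show ?case by (simp add: Compl_eq_Diff_UNIV[symmetric])
  next
    case (Union a)
    have "inj_closed_proj (disjointed a n)" for n
    proof -
      \<comment> \<open>Unions have to be made disjoint first. The factor \<open>a n\<close> is
        repeated for all \<open>i \<ge> n\<close> to give a family indexed by all naturals.\<close>
      have "inj_closed_proj (\<Inter>i. if i < n then - a i else a n)"
        by (rule inj_closed_proj_INT) (use Union in auto)
      also have "(\<Inter>i. if i < n then - a i else a n) = disjointed a n"
      proof (intro set_eqI)
        fix x show "x \<in> (\<Inter>i. if i < n then - a i else a n) \<longleftrightarrow> x \<in> disjointed a n"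
          by (auto simp: disjointed_def Ball_def split: if_splits)
      qed
      finally show ?thesis .
    qed
    then have "inj_closed_proj (\<Union>n. disjointed a n)"
      by (rule inj_closed_proj_disjoint_UN) (rule disjoint_family_disjointed)
    moreover have "inj_closed_proj (\<Inter>n. - a n)"
      by (rule inj_closed_proj_INT) (use Union in auto)
    ultimately show ?case by (simp add: UN_disjointed_eq)
  qed
  then show ?thesis by simp
qed

section \<open>Perfect set property and the counting of Borel sets\<close>

lemma uncountable_closed_imp_continuum:
  fixes C :: "'a::{complete_space,second_countable_topology} set"
  assumes "closed C" "uncountable C"
  shows "(UNIV::real set) \<lesssim> C"
proof -
  obtain B :: "'a set set" where B: "countable B" "topological_basis B"
    using ex_countable_basis by blast
  \<comment> \<open>Cantor-Bendixson: removing all basic open sets that meet \<open>C\<close> in a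
    countable set loses only countably many points, and the rest \<open>K\<close> is closed without
    isolated points.\<close>
  define N where "N = \<Union>{b \<in> B. countable (C \<inter> b)}"
  define K where "K = C - N"
  have "open N"
    unfolding N_def using B(2) by (auto intro!: open_Union dest: topological_basis_open)
  have cN: "countable (C \<inter> N)"
  proof -
    have "C \<inter> N = (\<Union>b\<in>{b \<in> B. countable (C \<inter> b)}. C \<inter> b)" by (auto simp: N_def)
    also have "countable \<dots>" using B(1) by (intro countable_UN) auto
    finally show ?thesis .
  qed
  have "closed K" unfolding K_def using assms(1) \<open>open N\<close> by (rule closed_Diff)
  have unc: "uncountable (K \<inter> T)" if "x \<in> K" "x \<in> T" "open T" for x T
  proof
    assume c: "countable (K \<inter> T)"
    obtain b where b: "b \<in> B" "x \<in> b" "b \<subseteq> T"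
      using topological_basisE[OF B(2) \<open>open T\<close> \<open>x \<in> T\<close>] by metis
    have "C \<inter> b \<subseteq> (K \<inter> T) \<union> (C \<inter> N)" using b by (auto simp: K_def)
    then have "countable (C \<inter> b)" using c cN by (meson countable_Un countable_subset)
    then have "x \<in> N" using b by (auto simp: N_def)
    then show False using that by (simp add: K_def)
  qed
  have "K \<noteq> {}"
  proof
    assume "K = {}"
    then have "C \<subseteq> C \<inter> N" by (auto simp: K_def)
    then show False using cN assms(2) by (meson countable_subset)
  qed
  have der: "euclidean derived_set_of K = K"
  proof (intro equalityI subsetI)
    fix x assume "x \<in> euclidean derived_set_of K"
    then show "x \<in> K"
      using \<open>closed K\<close> by (metis closed_closedin closedin_contains_derived_set subset_iff)
  next
    fix x assume x: "x \<in> K"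
    show "x \<in> euclidean derived_set_of K"
      unfolding in_derived_set_of
    proof (intro conjI allI impI)
      fix T assume T: "x \<in> T \<and> openin euclidean T"
      then have "uncountable (K \<inter> T)" using unc[OF x] by simp
      then have "\<not> K \<inter> T \<subseteq> {x}" by (meson countable_subset countable_insert countable_empty)
      then show "\<exists>y. y \<noteq> x \<and> y \<in> K \<and> y \<in> T" by blast
    qed auto
  qed
  have "(UNIV::real set) \<lesssim> K"
    by (rule lepoll_perfect_set[of euclidean])
       (use der \<open>K \<noteq> {}\<close> completely_metrizable_space_euclidean in auto)
  moreover have "K \<lesssim> C" by (rule subset_imp_lepoll) (auto simp: K_def)
  ultimately show ?thesis by (rule lepoll_trans)
qed

text \<open>A closed set is recovered from the basic open sets disjoint from it, hence coded by a
  set of indices.\<close>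

lemma closed_sets_lepoll_nat_sets:
  "{C::'a::second_countable_topology set. closed C} \<lesssim> (UNIV::nat set set)"
proof -
  obtain B :: "'a set set" where B: "countable B" "topological_basis B"
    using ex_countable_basis by blast
  obtain e :: "nat \<Rightarrow> 'a set" where e: "B \<subseteq> range e"
    by (metis B(1) countable_subset_image order_refl subset_UNIV empty_subsetI range_from_nat_into)
  let ?c = "\<lambda>C. {n. e n \<inter> C = {}}"
  have sub: "C \<subseteq> D" if "closed D" "?c C = ?c D" for C D :: "'a set"
  proof
    fix x assume x: "x \<in> C"
    show "x \<in> D"
    proof (rule ccontr)
      assume "x \<notin> D"
      then obtain b where b: "b \<in> B" "x \<in> b" "b \<subseteq> - D"
        using topological_basisE[OF B(2), of "- D" x] \<open>closed D\<close> by (metis ComplI open_Compl)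
      then obtain n where "e n = b" using e by blast
      then show False using b x that(2) by blast
    qed
  qed
  have "inj_on ?c {C. closed C}"
    by (rule inj_onI) (use sub in \<open>simp, metis subset_antisym\<close>)
  then show ?thesis unfolding lepoll_def by blast
qed

text \<open>Cantor's theorem by counting. If all subsets of \<open>D\<close> were Borel, each would
  be the projection of a closed set, so \<open>Pow D\<close> would inject into the closed sets,
  these into the sets of naturals, and those into \<open>D\<close>, which has at least the size of
  the continuum.\<close>

lemma uncountable_borel_has_nonborel_subset:
  fixes D :: "real set"
  assumes "D \<in> sets borel" "uncountable D"
  obtains E where "E \<subseteq> D" "E \<notin> sets borel"
proof (rule ccontr)
  assume "\<not> thesis"
  with that have all: "E \<in> sets borel" if "E \<subseteq> D" for E using \<open>E \<subseteq> D\<close> by blast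
  obtain C :: "(real \<times> (nat \<Rightarrow> real)) set" where C: "closed C" "inj_on fst C" "fst ` C = D"
    using borel_imp_inj_closed_proj[OF assms(1)] unfolding inj_closed_proj_def by blast
  have "uncountable C" using C(3) assms(2) by auto
  then have "(UNIV::real set) \<lesssim> C" using C(1) by (intro uncountable_closed_imp_continuum)
  moreover have "C \<lesssim> D" using C by (auto simp: lepoll_def)
  ultimately have "(UNIV::real set) \<lesssim> D" by (rule lepoll_trans)
  then have natD: "(UNIV::nat set set) \<lesssim> D"
    using nat_sets_eqpoll_reals eqpoll_imp_lepoll lepoll_trans by blast
  have "\<forall>E\<in>Pow D. \<exists>C::(real \<times> (nat \<Rightarrow> real)) set. closed C \<and> fst ` C = E"
  proof
    fix E assume "E \<in> Pow D"
    then have "inj_closed_proj E" by (intro borel_imp_inj_closed_proj all) simp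
    then show "\<exists>C::(real \<times> (nat \<Rightarrow> real)) set. closed C \<and> fst ` C = E"
      unfolding inj_closed_proj_def by (elim exE conjE) (intro exI conjI)
  qed
  then obtain c :: "real set \<Rightarrow> (real \<times> (nat \<Rightarrow> real)) set"
    where c: "\<And>E. E \<in> Pow D \<Longrightarrow> closed (c E) \<and> fst ` c E = E" by metis
  have "inj_on c (Pow D)" by (rule inj_onI) (metis c)
  moreover have "c ` Pow D \<subseteq> {C. closed C}"
  proof (rule image_subsetI)
    fix E assume "E \<in> Pow D"
    from c[OF this] show "c E \<in> {C. closed C}" by simp
  qed
  ultimately have "Pow D \<lesssim> {C::(real \<times> (nat \<Rightarrow> real)) set. closed C}"
    unfolding lepoll_def by (intro exI conjI)
  then have "Pow D \<lesssim> D"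
    by (rule lepoll_trans[OF lepoll_trans[OF _ closed_sets_lepoll_nat_sets] natD])
  then show False
    using lesspoll_Pow_self[of D] by (auto simp: lesspoll_def dest: lepoll_antisym)
qed

text \<open>By Zorn's lemma; maximality turns the separated set into an \<open>e\<close>-net of
  \<open>A\<close>. The alternative \<open>x = y\<close> matters only for
  \<open>e \<le> 0\<close>.\<close>

lemma maximal_separated_subset:
  fixes A :: "'a::metric_space set"
  obtains Y where "Y \<subseteq> A" "\<And>x y. x \<in> Y \<Longrightarrow> y \<in> Y \<Longrightarrow> dist x y < e \<Longrightarrow> x = y"
    "\<And>x. x \<in> A \<Longrightarrow> \<exists>y\<in>Y. dist x y < e \<or> x = y"
proof -
  let ?S = "{Y. Y \<subseteq> A \<and> (\<forall>x\<in>Y. \<forall>y\<in>Y. dist x y < e \<longrightarrow> x = y)}"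
  have "\<exists>M\<in>?S. \<forall>X\<in>?S. M \<subseteq> X \<longrightarrow> X = M"
  proof (rule subset_Zorn')
    fix c assume c: "subset.chain ?S c"
    then have cS: "c \<subseteq> ?S" and tot: "\<And>X Y. X \<in> c \<Longrightarrow> Y \<in> c \<Longrightarrow> X \<subseteq> Y \<or> Y \<subseteq> X"
      by (auto simp: subset_chain_def)
    show "\<Union>c \<in> ?S"
    proof (safe)
      fix x X assume "X \<in> c" "x \<in> X" then show "x \<in> A" using cS by auto
    next
      fix x y X Y assume "X \<in> c" "x \<in> X" "Y \<in> c" "y \<in> Y" "dist x y < e"
      then obtain Z where "Z \<in> c" "x \<in> Z" "y \<in> Z" using tot by blast
      then show "x = y" using cS \<open>dist x y < e\<close> by auto
    qed
  qed
  then obtain Y where Y: "Y \<in> ?S" and max': "\<forall>X\<in>?S. Y \<subseteq> X \<longrightarrow> X = Y"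
    by (rule bexE)
  have max: "X = Y" if "X \<in> ?S" "Y \<subseteq> X" for X using bspec[OF max' that(1)] that(2) by (rule mp)
  show thesis
  proof (rule that)
    show "Y \<subseteq> A" "\<And>x y. x \<in> Y \<Longrightarrow> y \<in> Y \<Longrightarrow> dist x y < e \<Longrightarrow> x = y" using Y by auto
    fix x assume x: "x \<in> A"
    show "\<exists>y\<in>Y. dist x y < e \<or> x = y"
    proof (rule ccontr)
      assume n: "\<not> ?thesis"
      then have "insert x Y \<in> ?S" using x Y by (auto simp: dist_commute)
      then have "insert x Y = Y" by (rule max) auto
      then show False using n by blast
    qed
  qed
qed

lemma borel_measurable_real_separable_range:
  fixes f :: "real \<Rightarrow> 'a::metric_space"
  assumes f: "f \<in> borel_measurable borel"
  obtains S where "countable S" "range f \<subseteq> closure S"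
proof -
  have sep_countable: "countable Y"
    if "0 < e" "Y \<subseteq> range f" and sep: "\<And>x y. x \<in> Y \<Longrightarrow> y \<in> Y \<Longrightarrow> dist x y < e \<Longrightarrow> x = y" for Y e
  proof (rule ccontr)
    assume unc: "uncountable Y"
    \<comment> \<open>Subsets of a uniformly discrete set are closed, so arbitrary choices inside
      \<open>Y\<close> have Borel preimages.\<close>
    have sub: "f -` Z \<in> sets borel" if "Z \<subseteq> Y" for Z
    proof -
      have "closed Z"
        by (rule discrete_imp_closed[OF \<open>0 < e\<close>]) (use sep \<open>Z \<subseteq> Y\<close> in \<open>auto simp: dist_commute\<close>)
      then show ?thesis using measurable_sets[OF f, of Z] by simp
    qed
    \<comment> \<open>The fixed points of \<open>r\<close> are exactly the chosen preimages
      \<open>inv f y\<close> with \<open>y\<close> in \<open>Y\<close>; elsewhere the value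
      \<open>x + 1\<close> excludes fixed points. This exhibits the selection \<open>D\<close> as a
      Borel set although \<open>inv f\<close> is an arbitrary choice.\<close>
    define r where "r x = (if f x \<in> Y then inv f (f x) else x + 1)" for x
    have r: "r \<in> borel_measurable borel"
    proof (rule measurableI)
      fix B :: "real set" assume B: "B \<in> sets borel"
      have "r -` B = f -` {y \<in> Y. inv f y \<in> B} \<union> ((\<lambda>x. x + 1) -` B - f -` Y)"
        by (auto simp: r_def split: if_splits)
      also have "\<dots> \<in> sets borel"
      proof (intro sets.Un sets.Diff sub)
        have "(\<lambda>x::real. x + 1) \<in> borel_measurable borel" by measurable
        from measurable_sets[OF this B] show "(\<lambda>x. x + 1) -` B \<in> sets borel" by simp
      qed auto
      finally show "r -` B \<inter> space borel \<in> sets borel" by simp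
    qed simp
    define D where "D = {x. r x = x}"
    have inv: "f (inv f y) = y" if "y \<in> Y" for y
      using that \<open>Y \<subseteq> range f\<close> by (auto simp: f_inv_into_f)
    have D: "x \<in> D \<longleftrightarrow> f x \<in> Y \<and> inv f (f x) = x" for x by (simp add: D_def r_def)
    have "D \<in> sets borel"
      using r borel_measurable_eq[of r borel "\<lambda>x. x"] by (simp add: D_def pred_def)
    moreover have "uncountable D"
    proof
      assume "countable D"
      moreover have "Y \<subseteq> f ` D"
      proof
        fix y assume "y \<in> Y"
        then have "inv f y \<in> D" "y = f (inv f y)" using inv by (auto simp: D)
        then show "y \<in> f ` D" by blast
      qed
      ultimately show False using unc by (meson countable_image countable_subset)
    qed
    ultimately obtain E where E: "E \<subseteq> D" "E \<notin> sets borel"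
      by (rule uncountable_borel_has_nonborel_subset)
    \<comment> \<open>\<open>f\<close> is injective on \<open>D\<close>, so a subset
      \<open>E\<close> is cut out of \<open>D\<close> by the preimage of its image, which is Borel,
      against the choice of \<open>E\<close>.\<close>
    have "E = D \<inter> f -` (f ` E)"
    proof (intro equalityI subsetI)
      fix x assume "x \<in> D \<inter> f -` (f ` E)"
      then obtain z where "x \<in> D" "z \<in> E" "f x = f z" by auto
      then show "x \<in> E" using E(1) D by (metis subsetD)
    qed (use E(1) in auto)
    also have "\<dots> \<in> sets borel"
      by (intro sets.Int \<open>D \<in> sets borel\<close> sub) (use E(1) D in auto)
    finally show False using E(2) by simp
  qed
  have "\<exists>Y. countable Y \<and> (\<forall>x\<in>range f. \<exists>y\<in>Y. dist x y < inverse (Suc n))" for n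
  proof -
    obtain Y where Y: "Y \<subseteq> range f" "\<And>x y. x \<in> Y \<Longrightarrow> y \<in> Y \<Longrightarrow> dist x y < inverse (Suc n) \<Longrightarrow> x = y"
      "\<And>x. x \<in> range f \<Longrightarrow> \<exists>y\<in>Y. dist x y < inverse (Suc n) \<or> x = y"
      using maximal_separated_subset[of "range f" "inverse (Suc n)"] by metis
    have "countable Y" by (rule sep_countable[OF _ Y(1,2)]) auto
    moreover have "\<forall>x\<in>range f. \<exists>y\<in>Y. dist x y < inverse (Suc n)"
      using Y(3) by (metis dist_self inverse_positive_iff_positive of_nat_0_less_iff zero_less_Suc)
    ultimately show ?thesis by blast
  qed
  then obtain Y where Y: "\<And>n. countable (Y n)" "\<And>n x. \<exists>y\<in>Y n. dist (f x) y < inverse (Suc n)"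
    by (metis rangeI)
  show thesis
  proof (rule that)
    show "countable (\<Union>n. Y n)" using Y(1) by blast
    show "range f \<subseteq> closure (\<Union>n. Y n)"
    proof safe
      fix x
      show "f x \<in> closure (\<Union>n. Y n)"
        unfolding closure_approachable
      proof (intro allI impI)
        fix e :: real assume "0 < e"
        then obtain n where n: "inverse (Suc n) < e" using reals_Archimedean by blast
        obtain y where "y \<in> Y n" "dist (f x) y < inverse (Suc n)" using Y(2) by blast
        then show "\<exists>y\<in>\<Union>n. Y n. dist y (f x) < e"
          using n by (intro bexI[of _ y]) (auto simp: dist_commute)
      qed
    qed
  qed
qed

text \<open>One separable factor suffices: over the range of \<open>f\<close>, an open
  \<open>U\<close> is covered by countably many open boxes inside \<open>U\<close>, each a ball
  around a point of \<open>S\<close> times the largest open set \<open>V s n\<close> that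
  fits.\<close>

lemma borel_measurable_Pair_separable:
  fixes f :: "'m \<Rightarrow> 'a::metric_space" and g :: "'m \<Rightarrow> 'b::metric_space"
  assumes f: "f \<in> borel_measurable M" and g: "g \<in> borel_measurable M"
    and S: "countable S" "range f \<subseteq> closure S"
  shows "(\<lambda>x. (f x, g x)) \<in> borel_measurable M"
proof (rule borel_measurableI)
  fix U :: "('a \<times> 'b) set" assume U: "open U"
  define V where "V s n = \<Union>{V. open V \<and> ball s (inverse (Suc n)) \<times> V \<subseteq> U}" for s and n :: nat
  have V: "open (V s n)" for s n unfolding V_def by auto
  have "(\<lambda>x. (f x, g x)) -` U \<inter> space M =
      (\<Union>s\<in>S. \<Union>n. (f -` ball s (inverse (Suc n)) \<inter> space M) \<inter> (g -` V s n \<inter> space M))"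
  proof (intro equalityI subsetI)
    fix x assume x: "x \<in> (\<lambda>x. (f x, g x)) -` U \<inter> space M"
    then obtain A B where AB: "open A" "open B" "f x \<in> A" "g x \<in> B" "A \<times> B \<subseteq> U"
      using U by (auto elim!: open_prod_elim)
    then obtain e where e: "0 < e" "ball (f x) e \<subseteq> A" by (meson openE)
    obtain n where n: "inverse (Suc n) < e / 2" using e reals_Archimedean[of "e/2"] by auto
    obtain s where s: "s \<in> S" "dist s (f x) < inverse (Suc n)"
    proof -
      have "f x \<in> closure S" using S(2) by auto
      moreover have "0 < inverse (real (Suc n))" by simp
      ultimately show thesis using that unfolding closure_approachable by blast
    qed
    have "ball s (inverse (Suc n)) \<subseteq> ball (f x) e"
    proof
      fix z assume "z \<in> ball s (inverse (Suc n))"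
      then show "z \<in> ball (f x) e"
        using s(2) n dist_triangle[of "f x" z s] by (simp add: dist_commute)
    qed
    then have "ball s (inverse (Suc n)) \<times> B \<subseteq> U" using AB(5) e(2) by blast
    then have "g x \<in> V s n" using AB by (auto simp: V_def)
    then show "x \<in> (\<Union>s\<in>S. \<Union>n. (f -` ball s (inverse (Suc n)) \<inter> space M) \<inter> (g -` V s n \<inter> space M))"
      using s x by auto
  next
    fix x assume "x \<in> (\<Union>s\<in>S. \<Union>n. (f -` ball s (inverse (Suc n)) \<inter> space M) \<inter> (g -` V s n \<inter> space M))"
    then show "x \<in> (\<lambda>x. (f x, g x)) -` U \<inter> space M" by (fastforce simp: V_def)
  qed
  also have "\<dots> \<in> sets M"
    using f g S(1) V
    by (intro sets.countable_UN'' sets.countable_UN' sets.Int measurable_sets) auto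
  finally show "(\<lambda>x. (f x, g x)) -` U \<inter> space M \<in> sets M" .
qed

lemma borel_measurable_Pair_real:
  fixes f :: "real \<Rightarrow> 'a::metric_space" and g :: "real \<Rightarrow> 'b::metric_space"
  assumes f: "f \<in> borel_measurable borel" and g: "g \<in> borel_measurable borel"
  shows "(\<lambda>x. (f x, g x)) \<in> borel_measurable borel"
  using borel_measurable_real_separable_range[OF f] borel_measurable_Pair_separable[OF f g] by metis

subsection \<open>Weighted square-integrable functions\<close>

lemma borel_measurable_diff_real:
  fixes f g :: "real \<Rightarrow> 'a::real_normed_vector"
  assumes "f \<in> borel_measurable borel" "g \<in> borel_measurable borel"
  shows "(\<lambda>x. f x - g x) \<in> borel_measurable borel"
proof -
  have "(\<lambda>p::'a \<times> 'a. fst p - snd p) \<in> borel_measurable borel"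
    by (intro borel_measurable_continuous_onI continuous_intros)
  from measurable_compose[OF borel_measurable_Pair_real[OF assms] this] show ?thesis by simp
qed

text \<open>The separability clause of \<open>L2w\<close> follows from measurability, by the
  separable range of Borel functions on the line.\<close>

lemma L2w_iff:
  "L2w \<rho> f \<longleftrightarrow> f \<in> borel_measurable borel \<and> integrable lborel (\<lambda>t. (norm (f t))^2 * exp (-2 * \<rho> * t))"
proof -
  have "\<exists>S. countable S \<and> (AE t in lborel. f t \<in> closure S)" if "f \<in> borel_measurable borel"
  proof -
    obtain S where "countable S" "range f \<subseteq> closure S"
      using borel_measurable_real_separable_range[OF \<open>f \<in> borel_measurable borel\<close>] by metis
    then show ?thesis by (intro exI[of _ S]) auto
  qed
  then show ?thesis by (auto simp: L2w_def)
qed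

lemma L2w_measurable: "L2w \<rho> f \<Longrightarrow> f \<in> borel_measurable borel"
  and L2w_integrable: "L2w \<rho> f \<Longrightarrow> integrable lborel (\<lambda>t. (norm (f t))^2 * exp (-2 * \<rho> * t))"
  by (simp_all add: L2w_iff)

lemma L2w_bound:
  assumes f: "f \<in> borel_measurable borel" and "integrable lborel b"
    and le: "AE t in lborel. (norm (f t))^2 * exp (-2 * \<rho> * t) \<le> b t"
  shows "L2w \<rho> f"
  unfolding L2w_iff
proof
  show "integrable lborel (\<lambda>t. (norm (f t))^2 * exp (-2 * \<rho> * t))"
  proof (rule Bochner_Integration.integrable_bound[OF \<open>integrable lborel b\<close>])
    show "(\<lambda>t. (norm (f t))^2 * exp (-2 * \<rho> * t)) \<in> borel_measurable lborel"
      using f by measurable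
    show "AE t in lborel. norm ((norm (f t))^2 * exp (-2 * \<rho> * t)) \<le> norm (b t)"
      using le by eventually_elim (simp add: abs_mult)
  qed
qed fact

lemma L2w_mono:
  assumes "f \<in> borel_measurable borel" "L2w \<rho> g" and le: "AE t in lborel. norm (f t) \<le> norm (g t)"
  shows "L2w \<rho> f" "wnorm \<rho> f \<le> wnorm \<rho> g"
proof -
  have le': "AE t in lborel. (norm (f t))^2 * exp (-2 * \<rho> * t) \<le> (norm (g t))^2 * exp (-2 * \<rho> * t)"
    using le by eventually_elim (auto intro!: mult_right_mono power_mono)
  show *: "L2w \<rho> f" by (rule L2w_bound[OF assms(1) L2w_integrable[OF assms(2)] le'])
  show "wnorm \<rho> f \<le> wnorm \<rho> g"
    unfolding wnorm_def
    by (intro real_sqrt_le_mono integral_mono_AE L2w_integrable * assms le')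
qed

lemma wnorm_nonneg: "0 \<le> wnorm \<rho> f"
  by (simp add: wnorm_def)

lemma wnorm_power2: "(wnorm \<rho> f)^2 = (LINT t|lborel. (norm (f t))^2 * exp (-2 * \<rho> * t))"
  by (simp add: wnorm_def)

text \<open>Young's inequality with a free weight \<open>s\<close>; optimising \<open>s\<close>
  afterwards gives the triangle inequality for \<open>wnorm\<close>.\<close>

lemma norm_add_power2_le:
  fixes a b :: "'a::real_normed_vector"
  assumes "s > 0"
  shows "(norm (a + b))^2 \<le> (1 + s) * (norm a)^2 + (1 + 1 / s) * (norm b)^2"
proof -
  have "(norm (a + b))^2 \<le> (norm a + norm b)^2"
    by (intro power_mono norm_triangle_ineq) auto
  also have "\<dots> = (1 + s) * (norm a)^2 + (1 + 1 / s) * (norm b)^2 - (s * norm a - norm b)^2 / s"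
    using assms by (simp add: field_simps power2_eq_square)
  also have "\<dots> \<le> (1 + s) * (norm a)^2 + (1 + 1 / s) * (norm b)^2"
    using assms by simp
  finally show ?thesis .
qed

lemma
  assumes f: "L2w \<rho> f" and g: "L2w \<rho> g"
  shows L2w_diff: "L2w \<rho> (\<lambda>t. f t - g t)"
    and wnorm_diff_le: "wnorm \<rho> (\<lambda>t. f t - g t) \<le> wnorm \<rho> f + wnorm \<rho> g"
proof -
  let ?w = "\<lambda>t. exp (-2 * \<rho> * t)"
  have meas: "(\<lambda>t. f t - g t) \<in> borel_measurable borel"
    using f g by (intro borel_measurable_diff_real L2w_measurable)
  have pt: "(norm (f t - g t))^2 * ?w t \<le> (1 + s) * ((norm (f t))^2 * ?w t) + (1 + 1 / s) * ((norm (g t))^2 * ?w t)"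
    if "s > 0" for s t
    using mult_right_mono[OF norm_add_power2_le[OF that, of "f t" "- g t"], of "?w t"]
    by (simp add: algebra_simps)
  have int: "integrable lborel (\<lambda>t. (1 + s) * ((norm (f t))^2 * ?w t) + (1 + 1 / s) * ((norm (g t))^2 * ?w t))" for s
    using L2w_integrable[OF f] L2w_integrable[OF g]
    by (intro Bochner_Integration.integrable_add integrable_mult_right)
  show L: "L2w \<rho> (\<lambda>t. f t - g t)"
    by (rule L2w_bound[OF meas int[of 1]]) (use pt[of 1] in simp)
  define A B where "A = wnorm \<rho> f" and "B = wnorm \<rho> g"
  have AB: "0 \<le> A" "0 \<le> B" by (simp_all add: A_def B_def wnorm_nonneg)
  have sq: "(wnorm \<rho> (\<lambda>t. f t - g t))^2 \<le> (1 + s) * A^2 + (1 + 1 / s) * B^2" if "s > 0" for s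
  proof -
    have "(wnorm \<rho> (\<lambda>t. f t - g t))^2 \<le>
        (LINT t|lborel. (1 + s) * ((norm (f t))^2 * ?w t) + (1 + 1 / s) * ((norm (g t))^2 * ?w t))"
      unfolding wnorm_power2 by (intro integral_mono L2w_integrable L int pt that)
    also have "\<dots> = (1 + s) * A^2 + (1 + 1 / s) * B^2"
      unfolding A_def B_def wnorm_power2
      using L2w_integrable[OF f] L2w_integrable[OF g] by (subst Bochner_Integration.integral_add) auto
    finally show ?thesis .
  qed
  have le: "wnorm \<rho> (\<lambda>t. f t - g t) \<le> (A + e) + (B + e)" if "e > 0" for e
  proof (rule power2_le_imp_le)
    \<comment> \<open>The minimising weight would be \<open>B / A\<close>; adding \<open>e\<close>
      to both keeps it defined and positive when \<open>A\<close> or \<open>B\<close>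
      vanishes.\<close>
    let ?s = "(B + e) / (A + e)"
    have s: "?s > 0" using AB that by auto
    have "(wnorm \<rho> (\<lambda>t. f t - g t))^2 \<le> (1 + ?s) * A^2 + (1 + 1 / ?s) * B^2"
      by (rule sq[OF s])
    also have "\<dots> \<le> (1 + ?s) * (A + e)^2 + (1 + 1 / ?s) * (B + e)^2"
      using AB that s by (intro add_mono mult_left_mono power_mono) auto
    also have "\<dots> = ((A + e) + (B + e))^2"
      using AB that by (simp add: field_simps power2_eq_square add_nonneg_eq_0_iff)
    finally show "(wnorm \<rho> (\<lambda>t. f t - g t))^2 \<le> ((A + e) + (B + e))^2" .
  qed (use AB that in auto)
  show "wnorm \<rho> (\<lambda>t. f t - g t) \<le> A + B"
  proof (rule field_le_epsilon)
    fix e :: real assume "0 < e"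
    then show "wnorm \<rho> (\<lambda>t. f t - g t) \<le> A + B + e" using le[of "e/2"] by simp
  qed
qed

lemma wnorm_minus_commute: "wnorm \<rho> (\<lambda>t. f t - g t) = wnorm \<rho> (\<lambda>t. g t - f t)"
  by (simp add: wnorm_def norm_minus_commute)

lemma wnorm_triangle:
  assumes "L2w \<rho> f" "L2w \<rho> g" "L2w \<rho> h"
  shows "wnorm \<rho> (\<lambda>t. f t - h t) \<le> wnorm \<rho> (\<lambda>t. f t - g t) + wnorm \<rho> (\<lambda>t. g t - h t)"
  using wnorm_diff_le[OF L2w_diff[OF assms(1,2)] L2w_diff[OF assms(3,2)]]
  by (simp add: wnorm_minus_commute[of \<rho> g h])

lemma wnorm_cong_AE:
  assumes "f \<in> borel_measurable borel" "g \<in> borel_measurable borel" "AE t in lborel. norm (f t) = norm (g t)"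
  shows "wnorm \<rho> f = wnorm \<rho> g"
  unfolding wnorm_def using assms by (intro arg_cong[where f = sqrt] integral_cong_AE) auto

lemma wnorm_eq_0_iff:
  assumes "L2w \<rho> f"
  shows "wnorm \<rho> f = 0 \<longleftrightarrow> (AE t in lborel. f t = 0)"
proof -
  have "wnorm \<rho> f = 0 \<longleftrightarrow> (LINT t|lborel. (norm (f t))^2 * exp (-2 * \<rho> * t)) = 0"
    by (simp add: wnorm_def)
  also have "\<dots> \<longleftrightarrow> (AE t in lborel. (norm (f t))^2 * exp (-2 * \<rho> * t) = 0)"
    by (rule integral_nonneg_eq_0_iff_AE) (use L2w_integrable[OF assms] in auto)
  also have "\<dots> \<longleftrightarrow> (AE t in lborel. f t = 0)" by simp
  finally show ?thesis .
qed

lemma wnorm_diff_eq_0_iff: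
  assumes "L2w \<rho> f" "L2w \<rho> g"
  shows "wnorm \<rho> (\<lambda>t. f t - g t) = 0 \<longleftrightarrow> (AE t in lborel. f t = g t)"
  using wnorm_eq_0_iff[OF L2w_diff[OF assms]] by simp

lemma
  assumes f: "L2w \<rho> f" and g: "L2w \<rho> g"
  shows L2w_Pair: "L2w \<rho> (\<lambda>t. (f t, g t))"
    and wnorm_Pair_le: "wnorm \<rho> (\<lambda>t. (f t, g t)) \<le> wnorm \<rho> f + wnorm \<rho> g"
proof -
  let ?w = "\<lambda>t. exp (-2 * \<rho> * t)"
  have eq: "(norm (f t, g t))^2 * ?w t = (norm (f t))^2 * ?w t + (norm (g t))^2 * ?w t" for t
    by (simp add: norm_Pair algebra_simps)
  show L: "L2w \<rho> (\<lambda>t. (f t, g t))"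
    unfolding L2w_iff eq
    using f g by (auto intro!: borel_measurable_Pair_real simp: L2w_iff)
  have "(wnorm \<rho> (\<lambda>t. (f t, g t)))^2 = (wnorm \<rho> f)^2 + (wnorm \<rho> g)^2"
    unfolding wnorm_power2 eq
    by (intro Bochner_Integration.integral_add L2w_integrable f g)
  also have "\<dots> \<le> (wnorm \<rho> f + wnorm \<rho> g)^2"
    by (simp add: power2_sum wnorm_nonneg)
  finally show "wnorm \<rho> (\<lambda>t. (f t, g t)) \<le> wnorm \<rho> f + wnorm \<rho> g"
    by (rule power2_le_imp_le) (simp add: wnorm_nonneg)
qed

section \<open>Truncation to compact intervals and limits in the weighted norm\<close>

definition trunc :: "nat \<Rightarrow> (real \<Rightarrow> 'a::real_normed_vector) \<Rightarrow> real \<Rightarrow> 'a" where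
  "trunc n f t = (if \<bar>t\<bar> \<le> real n then f t else 0)"

lemma trunc_measurable:
  assumes "f \<in> borel_measurable borel" shows "trunc n f \<in> borel_measurable borel"
  unfolding trunc_def using assms by measurable

text \<open>On a bounded interval all exponential weights are comparable, here with ratio at most
  \<open>?c\<close>. Truncations therefore lie in every weighted space, which makes them admissible
  arguments of \<open>\<Phi>\<close>.\<close>

lemma L2w_trunc:
  assumes f: "L2w \<rho> f" shows "L2w \<eta> (trunc n f)"
proof (rule L2w_bound)
  show "trunc n f \<in> borel_measurable borel" by (rule trunc_measurable[OF L2w_measurable[OF f]])
  let ?c = "exp (2 * \<bar>\<rho> - \<eta>\<bar> * real n)"
  show "integrable lborel (\<lambda>t. ?c * ((norm (f t))^2 * exp (-2 * \<rho> * t)))"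
    by (intro integrable_mult_right L2w_integrable f)
  have "(norm (trunc n f t))^2 * exp (-2 * \<eta> * t) \<le> ?c * ((norm (f t))^2 * exp (-2 * \<rho> * t))" for t
  proof (cases "\<bar>t\<bar> \<le> real n")
    case True
    have "(\<rho> - \<eta>) * t \<le> \<bar>\<rho> - \<eta>\<bar> * \<bar>t\<bar>" by (metis abs_ge_self abs_mult)
    also have "\<dots> \<le> \<bar>\<rho> - \<eta>\<bar> * real n" using True by (intro mult_left_mono) auto
    finally have "exp (-2 * \<eta> * t) \<le> ?c * exp (-2 * \<rho> * t)"
      unfolding exp_add[symmetric] by (simp add: algebra_simps)
    then show ?thesis
      using True mult_left_mono[of "exp (-2 * \<eta> * t)" "?c * exp (-2 * \<rho> * t)" "(norm (f t))^2"]
      by (simp add: trunc_def mult.left_commute)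
  qed (simp add: trunc_def)
  then show "AE t in lborel. (norm (trunc n f t))^2 * exp (-2 * \<eta> * t) \<le> ?c * ((norm (f t))^2 * exp (-2 * \<rho> * t))"
    by simp
qed

lemma wnorm_trunc_tendsto:
  assumes f: "L2w \<rho> f" shows "(\<lambda>n. wnorm \<rho> (\<lambda>t. trunc n f t - f t)) \<longlonglongrightarrow> 0"
proof -
  note [measurable] = L2w_measurable[OF f]
  have "(\<lambda>n. LINT t|lborel. (norm (trunc n f t - f t))^2 * exp (-2 * \<rho> * t)) \<longlonglongrightarrow> (LINT t::real|lborel. (0::real))"
  proof (rule integral_dominated_convergence)
    show "integrable lborel (\<lambda>t. (norm (f t))^2 * exp (-2 * \<rho> * t))" by (rule L2w_integrable[OF f])
    have *: "(norm (trunc n f t - f t))^2 = (if \<bar>t\<bar> \<le> real n then 0 else (norm (f t))^2)" for n t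
      by (simp add: trunc_def)
    show "(\<lambda>t. (norm (trunc n f t - f t))^2 * exp (-2 * \<rho> * t)) \<in> borel_measurable lborel" for n
      unfolding * by measurable
    show "AE t in lborel. norm ((norm (trunc n f t - f t))^2 * exp (-2 * \<rho> * t)) \<le> (norm (f t))^2 * exp (-2 * \<rho> * t)" for n
      unfolding * by (simp add: abs_mult)
    have "(\<lambda>n. (norm (trunc n f t - f t))^2 * exp (-2 * \<rho> * t)) \<longlonglongrightarrow> 0" for t
    proof (rule tendsto_eventually)
      show "\<forall>\<^sub>F n in sequentially. (norm (trunc n f t - f t))^2 * exp (-2 * \<rho> * t) = 0"
        using eventually_ge_at_top[of "nat \<lceil>\<bar>t\<bar>\<rceil>"]
        by eventually_elim (simp add: trunc_def nat_le_iff ceiling_le_iff)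
    qed
    then show "AE t in lborel. (\<lambda>n. (norm (trunc n f t - f t))^2 * exp (-2 * \<rho> * t)) \<longlonglongrightarrow> 0" by simp
  qed auto
  from tendsto_real_sqrt[OF this] show ?thesis unfolding wnorm_def by simp
qed

lemma wnorm_trunc_diff_le:
  assumes "L2w \<rho> f" "L2w \<rho> g"
  shows "wnorm \<rho> (\<lambda>t. trunc n f t - trunc n g t) \<le> wnorm \<rho> (\<lambda>t. f t - g t)"
  by (rule L2w_mono(2)[OF borel_measurable_diff_real[OF trunc_measurable trunc_measurable]])
     (use assms in \<open>auto intro: L2w_diff L2w_measurable simp: trunc_def\<close>)

text \<open>Before \<open>a\<close> the two sequences cancel: there \<open>f - g\<close> equals
  \<open>(gs n - g) - (fs n - f)\<close>, whose norm tends to 0.\<close>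

lemma limits_agree_before:
  assumes f: "\<And>n. L2w \<rho> (fs n)" "L2w \<rho> f" "(\<lambda>n. wnorm \<rho> (\<lambda>t. fs n t - f t)) \<longlonglongrightarrow> 0"
    and g: "\<And>n. L2w \<rho> (gs n)" "L2w \<rho> g" "(\<lambda>n. wnorm \<rho> (\<lambda>t. gs n t - g t)) \<longlonglongrightarrow> 0"
    and eq: "\<And>n. AE t in lborel. t < a \<longrightarrow> fs n t = gs n t"
  shows "AE t in lborel. t < a \<longrightarrow> f t = g t"
proof -
  define h where "h t = (if t < a then f t - g t else 0)" for t
  have hm: "h \<in> borel_measurable borel"
    unfolding h_def using borel_measurable_diff_real[OF L2w_measurable[OF f(2)] L2w_measurable[OF g(2)]]
    by (intro measurable_If) auto
  have hL: "L2w \<rho> h"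
    by (rule L2w_mono(1)[OF hm L2w_diff[OF f(2) g(2)]]) (simp add: h_def)
  have le: "wnorm \<rho> h \<le> wnorm \<rho> (\<lambda>t. gs n t - g t) + wnorm \<rho> (\<lambda>t. fs n t - f t)" for n
  proof -
    have "wnorm \<rho> h \<le> wnorm \<rho> (\<lambda>t. (gs n t - g t) - (fs n t - f t))"
      by (rule L2w_mono(2)[OF hm L2w_diff[OF L2w_diff[OF g(1,2)] L2w_diff[OF f(1,2)]]])
         (use eq[of n] in eventually_elim, auto simp: h_def)
    also have "\<dots> \<le> wnorm \<rho> (\<lambda>t. gs n t - g t) + wnorm \<rho> (\<lambda>t. fs n t - f t)"
      by (intro wnorm_diff_le L2w_diff f g)
    finally show ?thesis .
  qed
  have "wnorm \<rho> h \<le> 0 + 0"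
    by (rule LIMSEQ_le_const[OF tendsto_add[OF g(3) f(3)]]) (use le in auto)
  then have "wnorm \<rho> h = 0" using wnorm_nonneg[of \<rho> h] by simp
  then have "AE t in lborel. h t = 0" using wnorm_eq_0_iff[OF hL] by simp
  then show ?thesis by eventually_elim (auto simp: h_def)
qed

lemma nn_integral_wnorm:
  assumes "L2w \<rho> f"
  shows "(\<integral>\<^sup>+t. ennreal ((norm (f t))^2 * exp (-2 * \<rho> * t)) \<partial>lborel) = ennreal ((wnorm \<rho> f)^2)"
  unfolding wnorm_power2 by (rule nn_integral_eq_integral[OF L2w_integrable[OF assms]]) simp

lemma
  assumes f: "f \<in> borel_measurable borel" and "0 \<le> B"
    and le: "(\<integral>\<^sup>+t. ennreal ((norm (f t))^2 * exp (-2 * \<rho> * t)) \<partial>lborel) \<le> ennreal (B^2)"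
  shows L2w_nn_integral_bound: "L2w \<rho> f" and wnorm_nn_integral_bound: "wnorm \<rho> f \<le> B"
proof -
  have "(\<lambda>t. (norm (f t))^2 * exp (-2 * \<rho> * t)) \<in> borel_measurable lborel"
    using f by measurable
  moreover have "(\<integral>\<^sup>+t. ennreal ((norm (f t))^2 * exp (-2 * \<rho> * t)) \<partial>lborel) < \<infinity>"
    using le by (simp add: le_less_trans)
  ultimately show L: "L2w \<rho> f"
    unfolding L2w_iff using f by (intro conjI integrableI_nonneg) auto
  have "(wnorm \<rho> f)^2 \<le> B^2" using le unfolding nn_integral_wnorm[OF L] by simp
  then show "wnorm \<rho> f \<le> B" using \<open>0 \<le> B\<close> by (rule power2_le_imp_le)
qed

section \<open>Completeness of the weighted space along geometric sequences\<close>

lemma geometric_increments_bound: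
  fixes d :: "nat \<Rightarrow> real"
  assumes "d n \<le> 0" "\<And>m. n \<le> m \<Longrightarrow> d (Suc m) \<le> d m + c * q ^ m" "0 \<le> c" "0 \<le> q" "q < 1" "n \<le> m"
  shows "d m \<le> c / (1 - q) * q ^ n"
proof -
  have "d m \<le> c / (1 - q) * (q ^ n - q ^ m)" using \<open>n \<le> m\<close>
  proof (induction m rule: dec_induct)
    case (step m)
    have "d (Suc m) \<le> c / (1 - q) * (q ^ n - q ^ m) + c * q ^ m"
      using assms(2)[of m] step by simp
    also have "\<dots> = c / (1 - q) * (q ^ n - q ^ Suc m)"
      using \<open>q < 1\<close> by (simp add: field_simps)
    finally show ?case .
  qed (use assms in simp)
  also have "\<dots> \<le> c / (1 - q) * q ^ n" using assms by (intro mult_left_mono) auto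
  finally show ?thesis .
qed

text \<open>The Riesz-Fischer argument for geometric increments: pointwise convergence almost
  everywhere comes first, then Fatou's lemma gives convergence in norm.\<close>

lemma L2w_geometric_limit:
  fixes v :: "nat \<Rightarrow> real \<Rightarrow> 'a::{real_normed_vector, complete_space}"
  assumes v: "\<And>n. L2w \<rho> (v n)" and "0 \<le> c" "0 < q" "q < 1"
    and le: "\<And>n. wnorm \<rho> (\<lambda>t. v (Suc n) t - v n t) \<le> c * q ^ n"
  obtains w where "L2w \<rho> w" "(\<lambda>n. wnorm \<rho> (\<lambda>t. v n t - w t)) \<longlonglongrightarrow> 0"
proof -
  note [measurable] = L2w_measurable[OF v]
  let ?w = "\<lambda>t. exp (-2 * \<rho> * t)"
  have diffm: "(\<lambda>t. v m t - v n t) \<in> borel_measurable borel" for m n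
    by (rule borel_measurable_diff_real[OF L2w_measurable[OF v] L2w_measurable[OF v]])
  note [measurable] = diffm
  \<comment> \<open>The squared increments integrate to at most \<open>c^2 * q ^ (2 * n)\<close>, so
    half of this decay can be spent on the factor \<open>(1 / q) ^ n\<close> with the series still
    summable. Where the sum is finite, the pointwise increments are then of order
    \<open>sqrt q ^ n\<close>.\<close>
  define g where "g n t = ennreal ((1 / q) ^ n * ((norm (v (Suc n) t - v n t))^2 * ?w t))" for n t
  have [measurable]: "g n \<in> borel_measurable borel" for n
    unfolding g_def by measurable
  have "(\<integral>\<^sup>+t. (\<Sum>n. g n t) \<partial>lborel) = (\<Sum>n. \<integral>\<^sup>+t. g n t \<partial>lborel)"
    by (rule nn_integral_suminf) simp
  also have "\<dots> \<le> (\<Sum>n. ennreal (c^2 * q ^ n))"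
  proof (rule suminf_le)
    fix n
    have "(\<integral>\<^sup>+t. g n t \<partial>lborel) = ennreal ((1 / q) ^ n) * (\<integral>\<^sup>+t. ennreal ((norm (v (Suc n) t - v n t))^2 * ?w t) \<partial>lborel)"
      unfolding g_def using \<open>0 < q\<close> by (subst nn_integral_cmult[symmetric]) (auto simp: ennreal_mult)
    also have "\<dots> = ennreal ((1 / q) ^ n * (wnorm \<rho> (\<lambda>t. v (Suc n) t - v n t))^2)"
      using \<open>0 < q\<close> by (subst nn_integral_wnorm) (auto intro: L2w_diff v simp: ennreal_mult)
    also have "\<dots> \<le> ennreal ((1 / q) ^ n * (c * q ^ n)^2)"
      using \<open>0 < q\<close> by (intro ennreal_leI mult_left_mono power_mono le wnorm_nonneg) auto
    also have "(1 / q) ^ n * (c * q ^ n)^2 = c^2 * q ^ n"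
      using \<open>0 < q\<close> by (simp add: power2_eq_square power_one_over field_simps)
    finally show "(\<integral>\<^sup>+t. g n t \<partial>lborel) \<le> ennreal (c^2 * q ^ n)" .
  qed auto
  also have "\<dots> = ennreal (\<Sum>n. c^2 * q ^ n)"
    using \<open>0 < q\<close> \<open>q < 1\<close> by (intro suminf_ennreal2) (auto intro!: summable_mult summable_geometric)
  also have "\<dots> < \<infinity>" by simp
  finally have fin: "AE t in lborel. (\<Sum>n. g n t) \<noteq> \<infinity>"
    by (intro nn_integral_noteq_infinite) auto
  define G where "G = {t. (\<Sum>n. g n t) \<noteq> \<infinity>}"
  have [measurable]: "G \<in> sets borel" unfolding G_def by measurable
  have conv: "convergent (\<lambda>n. v n t)" if t: "t \<in> G" for t
  proof -
    define B where "B = enn2real (\<Sum>n. g n t) / ?w t"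
    define s where "s = sqrt q"
    have s: "0 < s" "s < 1" using \<open>0 < q\<close> \<open>q < 1\<close> by (auto simp: s_def)
    have B: "norm (v (Suc n) t - v n t) \<le> sqrt B * s ^ n" for n
    proof -
      have "g n t \<le> (\<Sum>n. g n t)" using sum_le_suminf[of "\<lambda>n. g n t" "{n}"] by simp
      also have "\<dots> = ennreal (B * ?w t)" using t by (simp add: G_def B_def less_top)
      finally have "(1 / q) ^ n * ((norm (v (Suc n) t - v n t))^2 * ?w t) \<le> B * ?w t"
        unfolding g_def by (subst (asm) ennreal_le_iff) (auto simp: B_def)
      then have "(norm (v (Suc n) t - v n t))^2 \<le> B * q ^ n"
        using \<open>0 < q\<close> by (simp add: field_simps power_one_over)
      then have "sqrt ((norm (v (Suc n) t - v n t))^2) \<le> sqrt (B * q ^ n)" by (rule real_sqrt_le_mono)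
      then show ?thesis by (simp add: s_def real_sqrt_mult real_sqrt_power)
    qed
    have bd: "norm (v m t - v n t) \<le> sqrt B / (1 - s) * s ^ n" if "n \<le> m" for m n
    proof (rule geometric_increments_bound[where d = "\<lambda>m. norm (v m t - v n t)"])
      fix m
      have "norm (v (Suc m) t - v n t) \<le> norm (v m t - v n t) + norm (v (Suc m) t - v m t)"
        using norm_triangle_ineq[of "v m t - v n t" "v (Suc m) t - v m t"] by simp
      then show "norm (v (Suc m) t - v n t) \<le> norm (v m t - v n t) + sqrt B * s ^ m"
        using B[of m] by simp
    qed (use s that in \<open>auto simp: B_def\<close>)
    have "(\<lambda>n. sqrt B / (1 - s) * s ^ n) \<longlonglongrightarrow> sqrt B / (1 - s) * 0"
      using s by (intro tendsto_intros LIMSEQ_power_zero) auto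
    then have lim0: "(\<lambda>n. sqrt B / (1 - s) * s ^ n) \<longlonglongrightarrow> 0" by simp
    have "Cauchy (\<lambda>n. v n t)"
      unfolding Cauchy_altdef2
    proof (intro allI impI)
      fix e :: real assume "0 < e"
      then obtain N where "sqrt B / (1 - s) * s ^ N < e"
        using order_tendstoD(2)[OF lim0] by (auto simp: eventually_sequentially)
      then show "\<exists>N. \<forall>n\<ge>N. dist (v n t) (v N t) < e"
        using bd[of N] by (intro exI[of _ N]) (fastforce simp: dist_norm)
    qed
    then show ?thesis by (simp add: Cauchy_convergent)
  qed
  \<comment> \<open>The value 0 on the exceptional null set lets \<open>w\<close> be an everywhere
    pointwise limit of measurable functions.\<close>
  define w where "w t = (if t \<in> G then lim (\<lambda>n. v n t) else 0)" for t
  have wlim: "(\<lambda>n. v n t) \<longlonglongrightarrow> w t" if "t \<in> G" for t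
    using conv[OF that] that by (simp add: w_def convergent_LIMSEQ_iff)
  have wm: "w \<in> borel_measurable borel"
  proof (rule borel_measurable_LIMSEQ_metric[where f = "\<lambda>n t. if t \<in> G then v n t else 0"])
    show "(\<lambda>n. if t \<in> G then v n t else 0) \<longlonglongrightarrow> w t" for t
      using wlim[of t] by (cases "t \<in> G") (auto simp: w_def)
  qed measurable
  have bd: "wnorm \<rho> (\<lambda>t. v m t - v n t) \<le> c / (1 - q) * q ^ n" if "n \<le> m" for m n
  proof (rule geometric_increments_bound[where d = "\<lambda>m. wnorm \<rho> (\<lambda>t. v m t - v n t)"])
    fix m
    show "wnorm \<rho> (\<lambda>t. v (Suc m) t - v n t) \<le> wnorm \<rho> (\<lambda>t. v m t - v n t) + c * q ^ m"
      using wnorm_triangle[OF v[of "Suc m"] v[of m] v[of n]] le[of m] by simp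
  qed (use that assms in \<open>auto simp: wnorm_def\<close>)
  have bdw: "L2w \<rho> (\<lambda>t. v n t - w t) \<and> wnorm \<rho> (\<lambda>t. v n t - w t) \<le> c / (1 - q) * q ^ n" for n
  proof -
    have m: "(\<lambda>t. v n t - w t) \<in> borel_measurable borel"
      by (intro borel_measurable_diff_real wm) measurable
    have nn: "0 \<le> c / (1 - q) * q ^ n" using assms by auto
    have "(\<integral>\<^sup>+t. ennreal ((norm (v n t - w t))^2 * ?w t) \<partial>lborel)
        = (\<integral>\<^sup>+t. liminf (\<lambda>m. ennreal ((norm (v m t - v n t))^2 * ?w t)) \<partial>lborel)"
    proof (rule nn_integral_cong_AE)
      show "AE t in lborel. ennreal ((norm (v n t - w t))^2 * ?w t)
          = liminf (\<lambda>m. ennreal ((norm (v m t - v n t))^2 * ?w t))"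
        using fin
      proof eventually_elim
        case (elim t)
        then have "(\<lambda>m. ennreal ((norm (v m t - v n t))^2 * ?w t)) \<longlonglongrightarrow> ennreal ((norm (w t - v n t))^2 * ?w t)"
          by (intro tendsto_intros wlim tendsto_ennrealI) (simp add: G_def)
        then show ?case
          unfolding norm_minus_commute[of "v n t" "w t"] by (intro lim_imp_Liminf[symmetric]) auto
      qed
    qed
    also have "\<dots> \<le> liminf (\<lambda>m. \<integral>\<^sup>+t. ennreal ((norm (v m t - v n t))^2 * ?w t) \<partial>lborel)"
      by (rule nn_integral_liminf) measurable
    also have "\<dots> = liminf (\<lambda>m. ennreal ((wnorm \<rho> (\<lambda>t. v m t - v n t))^2))"
      by (subst nn_integral_wnorm) (auto intro: L2w_diff v)
    also have "\<dots> \<le> limsup (\<lambda>m. ennreal ((wnorm \<rho> (\<lambda>t. v m t - v n t))^2))"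
      by (rule Liminf_le_Limsup) simp
    also have "\<dots> \<le> ennreal ((c / (1 - q) * q ^ n)^2)"
    proof (rule Limsup_bounded)
      show "\<forall>\<^sub>F m in sequentially. ennreal ((wnorm \<rho> (\<lambda>t. v m t - v n t))^2) \<le> ennreal ((c / (1 - q) * q ^ n)^2)"
        using eventually_ge_at_top[of n]
        by eventually_elim (intro ennreal_leI power_mono bd wnorm_nonneg)
    qed
    finally show ?thesis
      using L2w_nn_integral_bound[OF m nn] wnorm_nn_integral_bound[OF m nn] by blast
  qed
  show thesis
  proof (rule that)
    show "L2w \<rho> w" using L2w_diff[OF v[of 0] conjunct1[OF bdw[of 0]]] by simp
    have "(\<lambda>n. c / (1 - q) * q ^ n) \<longlonglongrightarrow> c / (1 - q) * 0"
      using assms by (intro tendsto_intros LIMSEQ_power_zero) auto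
    then have lim: "(\<lambda>n. c / (1 - q) * q ^ n) \<longlonglongrightarrow> 0" by simp
    have ev: "\<forall>\<^sub>F n in sequentially. wnorm \<rho> (\<lambda>t. v n t - w t) \<le> c / (1 - q) * q ^ n"
      using bdw by simp
    show "(\<lambda>n. wnorm \<rho> (\<lambda>t. v n t - w t)) \<longlonglongrightarrow> 0"
      by (rule tendsto_sandwich[OF _ ev tendsto_const lim]) (simp add: wnorm_nonneg)
  qed
qed

subsection \<open>Test functions and weak derivatives\<close>

text \<open>Smoothness is split into finite orders so that sums, products and affine substitutions
  can be treated by induction without naming higher derivatives. The single chain \<open>D\<close>
  demanded by \<open>test_function\<close> is recovered from all orders together.\<close>

fun times_diff :: "nat \<Rightarrow> (real \<Rightarrow> real) \<Rightarrow> bool" where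
  "times_diff 0 f \<longleftrightarrow> True"
| "times_diff (Suc n) f \<longleftrightarrow> (\<exists>f'. (\<forall>t. (f has_real_derivative f' t) (at t)) \<and> times_diff n f')"

lemma times_diff_Suc_imp: "times_diff (Suc n) f \<Longrightarrow> times_diff n f"
proof (induction n arbitrary: f)
  case (Suc n)
  then obtain f' where "\<forall>t. (f has_real_derivative f' t) (at t)" "times_diff (Suc n) f'" by auto
  then show ?case using Suc.IH[of f'] by auto
qed simp

lemma times_diff_add: "times_diff n f \<Longrightarrow> times_diff n g \<Longrightarrow> times_diff n (\<lambda>t. f t + g t)"
proof (induction n arbitrary: f g)
  case (Suc n)
  then obtain f' g' where "\<forall>t. (f has_real_derivative f' t) (at t)" "times_diff n f'"
    "\<forall>t. (g has_real_derivative g' t) (at t)" "times_diff n g'" by auto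
  then show ?case using Suc.IH[of f' g'] by (auto intro!: exI[of _ "\<lambda>t. f' t + g' t"] DERIV_add)
qed simp

lemma times_diff_mult: "times_diff n f \<Longrightarrow> times_diff n g \<Longrightarrow> times_diff n (\<lambda>t. f t * g t)"
proof (induction n arbitrary: f g)
  case (Suc n)
  then obtain f' g' where d: "\<forall>t. (f has_real_derivative f' t) (at t)" "times_diff n f'"
    "\<forall>t. (g has_real_derivative g' t) (at t)" "times_diff n g'" by auto
  have "times_diff n (\<lambda>t. f' t * g t + g' t * f t)"
    by (intro times_diff_add Suc.IH[OF d(2) times_diff_Suc_imp[OF Suc.prems(2)]]
        Suc.IH[OF d(4) times_diff_Suc_imp[OF Suc.prems(1)]])
  then show ?case using d by (auto intro!: exI[of _ "\<lambda>t. f' t * g t + g' t * f t"] DERIV_mult)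
qed simp

lemma times_diff_const: "times_diff n (\<lambda>t. c)"
proof (induction n arbitrary: c)
  case (Suc n)
  then show ?case by (auto intro!: exI[of _ "\<lambda>t. 0"])
qed simp

lemma times_diff_affine: "times_diff n f \<Longrightarrow> times_diff n (\<lambda>t. f (a * t + b))"
proof (induction n arbitrary: f)
  case (Suc n)
  then obtain f' where d: "\<And>t. (f has_real_derivative f' t) (at t)" "times_diff n f'" by auto
  have "((\<lambda>t. f (a * t + b)) has_real_derivative f' (a * t + b) * a) (at t)" for t
    by (rule DERIV_chain2[OF d(1)]) (auto intro!: derivative_eq_intros)
  moreover have "times_diff n (\<lambda>t. f' (a * t + b) * a)"
    by (intro times_diff_mult times_diff_const Suc.IH d)
  ultimately show ?case
    unfolding times_diff.simps by (intro exI[of _ "\<lambda>t. f' (a * t + b) * a"] conjI allI)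
qed simp

text \<open>Derivatives are unique, so the witnesses of all orders coincide with
  \<open>deriv g\<close>, which is again differentiable to every order; iterating
  \<open>deriv\<close> yields the chain.\<close>

lemma times_diff_deriv_chain:
  assumes "\<And>n. times_diff n f"
  shows "\<exists>D. D 0 = f \<and> (\<forall>n t. (D n has_real_derivative D (Suc n) t) (at t))"
proof -
  have step: "(\<forall>t. (g has_real_derivative deriv g t) (at t)) \<and> (\<forall>n. times_diff n (deriv g))"
    if "\<forall>n. times_diff n g" for g
  proof -
    have *: "times_diff (Suc n) g" for n using that by blast
    have "(\<forall>t. (g has_real_derivative deriv g t) (at t)) \<and> times_diff n (deriv g)" for n
    proof -
      obtain g' where g': "\<forall>t. (g has_real_derivative g' t) (at t)" "times_diff n g'"
        using * by auto
      then have "g' = deriv g" using DERIV_imp_deriv[of g] by (metis ext)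
      then show ?thesis using g' by simp
    qed
    then show ?thesis by blast
  qed
  have all: "\<forall>n. times_diff n ((deriv ^^ k) f)" for k
    by (induction k) (use assms step in auto)
  show ?thesis
    by (rule exI[of _ "\<lambda>k. (deriv ^^ k) f"]) (use step[OF all] in auto)
qed

section \<open>A smooth function vanishing to infinite order at 0, and smooth cutoffs built from
  it\<close>

definition flat :: "real poly \<Rightarrow> real \<Rightarrow> real" where
  "flat p x = (if x > 0 then poly p (1 / x) * exp (- 1 / x) else 0)"

lemma poly_mult_exp_minus_tendsto_0: "((\<lambda>y. poly p y * exp (- y)) \<longlongrightarrow> (0::real)) at_top"
proof -
  have "((\<lambda>y. \<Sum>i\<le>degree p. coeff p i * (y ^ i / exp y)) \<longlongrightarrow> (\<Sum>i\<le>degree p. coeff p i * 0)) at_top"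
    by (intro tendsto_intros tendsto_power_div_exp_0)
  then show ?thesis
    by (simp add: poly_altdef sum_distrib_right exp_minus divide_inverse mult.assoc)
qed

text \<open>The polynomial parameter closes the family under differentiation: with
  \<open>y = 1 / x\<close>, the derivative of \<open>p(y) exp(-y)\<close> in \<open>x\<close> is
  \<open>y^2 (p(y) - p'(y)) exp(-y)\<close>, and \<open>[:0, 0, 1:]\<close> is \<open>y^2\<close>.
  At 0 the right difference quotient is again a polynomial in \<open>1 / h\<close> times
  \<open>exp (- 1 / h)\<close>, which tends to 0.\<close>

lemma flat_has_derivative:
  "(flat p has_real_derivative flat ([:0, 0, 1:] * (p - pderiv p)) x) (at x)"
proof (cases "x = 0")
  case False
  show ?thesis
  proof (cases "x > 0")
    case True
    have "((\<lambda>x. poly p (1 / x) * exp (- 1 / x)) has_real_derivative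
        flat ([:0, 0, 1:] * (p - pderiv p)) x) (at x)"
      using True by (auto intro!: derivative_eq_intros simp: flat_def field_simps power2_eq_square)
    moreover have "\<forall>\<^sub>F y in nhds x. flat p y = poly p (1 / y) * exp (- 1 / y)"
      using eventually_nhds_in_open[of "{0<..}" x] True by (auto simp: flat_def elim!: eventually_mono)
    ultimately show ?thesis by (subst DERIV_cong_ev) auto
  next
    case neg: False
    with False have "x < 0" by simp
    then have "\<forall>\<^sub>F y in nhds x. flat p y = 0"
      using eventually_nhds_in_open[of "{..<0}" x] by (auto simp: flat_def elim!: eventually_mono)
    then show ?thesis using \<open>x < 0\<close>
      by (subst DERIV_cong_ev[of x x _ "\<lambda>_. 0"]) (auto simp: flat_def)
  qed
next
  case True
  have "((\<lambda>h. flat p h / h) \<longlongrightarrow> 0) (at_right 0)"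
  proof -
    have "((\<lambda>h. poly ([:0, 1:] * p) (inverse h) * exp (- inverse h)) \<longlongrightarrow> 0) (at_right 0)"
      by (rule filterlim_compose[OF poly_mult_exp_minus_tendsto_0 filterlim_inverse_at_top_right])
    moreover have "\<forall>\<^sub>F h in at_right 0. poly ([:0, 1:] * p) (inverse h) * exp (- inverse h) = flat p h / h"
      using eventually_at_right_less[of "0::real"]
      by eventually_elim (simp add: flat_def field_simps)
    ultimately show ?thesis by (rule Lim_transform_eventually)
  qed
  moreover have "((\<lambda>h. flat p h / h) \<longlongrightarrow> 0) (at_left 0)"
  proof (rule tendsto_eventually)
    show "\<forall>\<^sub>F h in at_left 0. flat p h / h = 0"
      unfolding eventually_at_filter by (simp add: flat_def)
  qed
  ultimately have "((\<lambda>h. flat p h / h) \<longlongrightarrow> 0) (at 0)"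
    by (simp add: filterlim_split_at_real)
  then show ?thesis using True by (simp add: DERIV_def flat_def)
qed

lemma times_diff_flat: "times_diff n (flat p)"
proof (induction n arbitrary: p)
  case (Suc n)
  then show ?case using flat_has_derivative by auto
qed simp

text \<open>As \<open>k\<close> grows this increases to the indicator function of the open interval from \<open>c\<close> to \<open>d\<close>.\<close>
definition bump :: "nat \<Rightarrow> real \<Rightarrow> real \<Rightarrow> real \<Rightarrow> real" where
  "bump k c d x = flat 1 (real (Suc k) * (x - c)) * flat 1 (real (Suc k) * (d - x))"

lemma flat_1_bounds: "0 \<le> flat 1 x" "flat 1 x \<le> 1"
  by (auto simp: flat_def)

lemma bump_eq_0: "x \<le> c \<or> d \<le> x \<Longrightarrow> bump k c d x = 0"
  by (auto simp: bump_def flat_def zero_less_mult_iff not_less)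

lemma bump_le: "\<bar>bump k c d x\<bar> \<le> indicator {c<..<d} x"
proof (cases "x \<in> {c<..<d}")
  case True
  then show ?thesis
    using flat_1_bounds[of "real (Suc k) * (x - c)"] flat_1_bounds[of "real (Suc k) * (d - x)"]
    by (auto simp: bump_def abs_mult mult_le_one)
next
  case False
  then show ?thesis using bump_eq_0[of x c d k] by auto
qed

lemma bump_tendsto: "(\<lambda>k. bump k c d x) \<longlonglongrightarrow> indicator {c<..<d} x"
proof (cases "x \<in> {c<..<d}")
  case True
  have *: "(\<lambda>k. flat 1 (real (Suc k) * y)) \<longlonglongrightarrow> 1" if "y > 0" for y
  proof -
    have "(\<lambda>k. exp (- (inverse (real (Suc k)) * (1 / y)))) \<longlonglongrightarrow> exp (- (0 * (1 / y)))"
      by (intro tendsto_intros LIMSEQ_inverse_real_of_nat)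
    moreover have "flat 1 (real (Suc k) * y) = exp (- (inverse (real (Suc k)) * (1 / y)))" for k
    proof -
      have "0 < real (Suc k) * y" using that by simp
      then show ?thesis using that by (simp add: flat_def field_simps del: of_nat_Suc)
    qed
    ultimately show ?thesis by simp
  qed
  have "(\<lambda>k. bump k c d x) \<longlonglongrightarrow> 1 * 1"
    unfolding bump_def using True by (intro tendsto_mult *) auto
  then show ?thesis using True by simp
next
  case False
  then show ?thesis using bump_eq_0[of x c d] by (auto simp: not_less)
qed

lemma test_function_bump: "test_function (bump k c d)"
proof -
  have *: "times_diff n (\<lambda>x. flat 1 (real (Suc k) * x + - real (Suc k) * c) * flat 1 (- real (Suc k) * x + real (Suc k) * d))" for n
    by (intro times_diff_mult times_diff_affine times_diff_flat)
  have "bump k c d = (\<lambda>x. flat 1 (real (Suc k) * x + - real (Suc k) * c) * flat 1 (- real (Suc k) * x + real (Suc k) * d))"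
    by (simp add: bump_def fun_eq_iff algebra_simps)
  then have "\<exists>D. D 0 = bump k c d \<and> (\<forall>n t. (D n has_real_derivative D (Suc n) t) (at t))"
    using times_diff_deriv_chain[OF *] by simp
  moreover have "{t. bump k c d t \<noteq> 0} \<subseteq> {c..d}" using bump_eq_0[of _ c d k] by (auto simp: not_le) (meson less_imp_le not_le)+
  then have "bounded {t. bump k c d t \<noteq> 0}" by (rule bounded_subset[rotated]) simp
  ultimately show ?thesis by (simp add: test_function_def)
qed

section \<open>The fundamental lemma of the calculus of variations, before a given time\<close>

lemma AE_eq_0_of_interval_integrals:
  fixes f :: "real \<Rightarrow> real"
  assumes f: "\<And>c d. c < d \<Longrightarrow> integrable lborel (\<lambda>t. indicator {c<..<d} t * f t)"
    and fm: "f \<in> borel_measurable borel"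
    and 0: "\<And>c d. c < d \<Longrightarrow> d \<le> a \<Longrightarrow> (LINT t|lborel. indicator {c<..<d} t * f t) = 0"
  shows "AE t in lborel. t < a \<longrightarrow> f t = 0"
proof -
  note [measurable] = fm
  \<comment> \<open>\<open>f\<close> may fail to be integrable near minus infinity, so the claim is
    proved on bounded windows reaching back to \<open>- real n\<close>.\<close>
  have N: "AE t in lborel. - real n < t \<and> t < a \<longrightarrow> f t = 0" if n: "- real n < a" for n :: nat
  proof -
    define h where "h t = indicator {- real n<..<a} t * f t" for t
    have [measurable]: "h \<in> borel_measurable borel" unfolding h_def by measurable
    have hi: "integrable lborel h" unfolding h_def by (rule f[OF n])
    \<comment> \<open>\<open>ennreal\<close> sends negative numbers to 0, so the densities of
      \<open>P\<close> and \<open>Q\<close> are the positive and the negative part of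
      \<open>h\<close>. The measures agree on half-lines, hence everywhere, and the two parts
      coincide only where \<open>h\<close> is 0.\<close>
    define P Q where "P = density lborel (\<lambda>t. ennreal (h t))" and "Q = density lborel (\<lambda>t. ennreal (- h t))"
    have eP: "emeasure P {x<..} = (\<integral>\<^sup>+t. ennreal (h t * indicator {x<..} t) \<partial>lborel)" for x
      unfolding P_def by (subst emeasure_density) (auto intro!: nn_integral_cong simp: indicator_def)
    have eQ: "emeasure Q {x<..} = (\<integral>\<^sup>+t. ennreal (- (h t * indicator {x<..} t)) \<partial>lborel)" for x
      unfolding Q_def by (subst emeasure_density) (auto intro!: nn_integral_cong simp: indicator_def)
    have hx: "integrable lborel (\<lambda>t. h t * indicator {x<..} t)" for x
      by (rule Bochner_Integration.integrable_bound[OF hi]) (auto simp: indicator_def)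
    have fin: "(\<integral>\<^sup>+t. ennreal (g t) \<partial>lborel) < \<infinity>" if "integrable lborel g" for g :: "real \<Rightarrow> real"
    proof -
      have "(\<integral>\<^sup>+t. ennreal (g t) \<partial>lborel) \<le> (\<integral>\<^sup>+t. ennreal (norm (g t)) \<partial>lborel)"
        by (intro nn_integral_mono ennreal_leI) simp
      also have "\<dots> < \<infinity>" using that by (simp add: integrable_iff_bounded)
      finally show ?thesis .
    qed
    have "P = Q"
    proof (rule measure_eqI_lessThan)
      fix x
      show "emeasure P {x<..} < \<infinity>" unfolding eP by (rule fin[OF hx])
      have "(LINT t|lborel. h t * indicator {x<..} t) = 0"
      proof (cases "max x (- real n) < a")
        case True
        have "(LINT t|lborel. h t * indicator {x<..} t) = (LINT t|lborel. indicator {max x (- real n)<..<a} t * f t)"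
          by (rule Bochner_Integration.integral_cong) (auto simp: h_def indicator_def)
        then show ?thesis using 0[OF True] by simp
      next
        case False
        have "(LINT t|lborel. h t * indicator {x<..} t) = (LINT (t::real)|lborel. 0)"
          by (rule Bochner_Integration.integral_cong) (use False n in \<open>auto simp: h_def indicator_def\<close>)
        then show ?thesis by simp
      qed
      then have "enn2real (emeasure P {x<..}) = enn2real (emeasure Q {x<..})"
        unfolding real_lebesgue_integral_def[OF hx] eP eQ by simp
      moreover have "emeasure Q {x<..} < \<infinity>" unfolding eQ using hx by (intro fin) auto
      moreover note \<open>emeasure P {x<..} < \<infinity>\<close>
      ultimately show "emeasure P {x<..} = emeasure Q {x<..}"
        by (metis ennreal_enn2real infinity_ennreal_def)
    qed (auto simp: P_def Q_def)
    then have "AE t in lborel. ennreal (h t) = ennreal (- h t)"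
      unfolding P_def Q_def using fin[OF hi]
      by (subst (asm) finite_density_unique) auto
    then show ?thesis
      by eventually_elim (auto simp: h_def indicator_def ennreal_eq_0_iff split: if_splits,
          metis ennreal_eq_0_iff ennreal_neg linorder_le_cases neg_0_le_iff_le neg_le_0_iff_le order_antisym)
  qed
  have "AE t in lborel. \<forall>n. - real n < t \<and> t < a \<longrightarrow> f t = 0"
    unfolding AE_all_countable
  proof
    fix n
    show "AE t in lborel. - real n < t \<and> t < a \<longrightarrow> f t = 0"
      using N[of n] by (cases "- real n < a") auto
  qed
  then show ?thesis
  proof eventually_elim
    case (elim t)
    obtain n :: nat where "- t < real n" using reals_Archimedean2 by blast
    then show ?case using elim by (auto simp: neg_less_iff_less minus_less_iff)
  qed
qed

text \<open>The smooth approximations of an interval left of \<open>a\<close> vanish from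
  \<open>a\<close> on, so testing with such functions already determines \<open>f\<close> before
  \<open>a\<close>; dominated convergence leads from \<open>bump\<close> to indicators.\<close>

lemma AE_eq_0_of_test_functions:
  fixes f :: "real \<Rightarrow> real"
  assumes f: "\<And>c d. c < d \<Longrightarrow> integrable lborel (\<lambda>t. indicator {c<..<d} t * f t)"
    and fm: "f \<in> borel_measurable borel"
    and 0: "\<And>\<phi>. test_function \<phi> \<Longrightarrow> (\<And>t. a \<le> t \<Longrightarrow> \<phi> t = 0) \<Longrightarrow> (LINT t|lborel. \<phi> t * f t) = 0"
  shows "AE t in lborel. t < a \<longrightarrow> f t = 0"
proof (rule AE_eq_0_of_interval_integrals[OF f fm])
  fix c d :: real assume cd: "c < d" "d \<le> a"
  have bm: "bump k c d \<in> borel_measurable borel" for k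
    using test_function_bump[of k c d] unfolding test_function_def
    by (intro borel_measurable_continuous_onI continuous_at_imp_continuous_on) (metis DERIV_isCont)
  note [measurable] = bm fm
  have "(\<lambda>k. LINT t|lborel. bump k c d t * f t) \<longlonglongrightarrow> (LINT t|lborel. indicator {c<..<d} t * f t)"
  proof (rule integral_dominated_convergence)
    show "integrable lborel (\<lambda>t. \<bar>indicator {c<..<d} t * f t\<bar>)" using f[OF cd(1)] by simp
    show "AE t in lborel. (\<lambda>k. bump k c d t * f t) \<longlonglongrightarrow> indicator {c<..<d} t * f t"
      by (intro always_eventually allI tendsto_intros bump_tendsto)
    show "AE t in lborel. norm (bump k c d t * f t) \<le> \<bar>indicator {c<..<d} t * f t\<bar>" for k
      using bump_le[of k c d] by (intro always_eventually allI) (auto simp: abs_mult intro!: mult_right_mono)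
  qed auto
  moreover have "(LINT t|lborel. bump k c d t * f t) = 0" for k
    by (rule 0[OF test_function_bump]) (use cd in \<open>auto intro: bump_eq_0\<close>)
  ultimately show "(LINT t|lborel. indicator {c<..<d} t * f t) = 0"
    by (simp add: LIMSEQ_const_iff)
qed auto

text \<open>The exceptional null set depends on \<open>h\<close>. Separability of the range reduces
  the test to countably many vectors, whose closure contains \<open>f t\<close> itself.\<close>

lemma AE_eq_0_of_inner:
  fixes f :: "real \<Rightarrow> 'a::real_inner"
  assumes fm: "f \<in> borel_measurable borel" and 0: "\<And>h. AE t in lborel. t < a \<longrightarrow> inner (f t) h = 0"
  shows "AE t in lborel. t < a \<longrightarrow> f t = 0"
proof -
  obtain S where S: "countable S" "range f \<subseteq> closure S"
    using borel_measurable_real_separable_range[OF fm] by metis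
  have "AE t in lborel. \<forall>s\<in>S. t < a \<longrightarrow> inner (f t) s = 0"
    using 0 S(1) by (intro AE_ball_countable') auto
  then show ?thesis
  proof eventually_elim
    case (elim t)
    show ?case
    proof
      assume "t < a"
      with elim have "S \<subseteq> {y. inner (f t) y = 0}" by auto
      moreover have "closed {y. inner (f t) y = 0}"
        by (intro closed_Collect_eq continuous_intros)
      ultimately have "closure S \<subseteq> {y. inner (f t) y = 0}" by (rule closure_minimal)
      moreover have "f t \<in> closure S" using S(2) by blast
      ultimately have "f t \<in> {y. inner (f t) y = 0}" by blast
      then show "f t = 0" by simp
    qed
  qed
qed

section \<open>Pairing with test functions, and locality of the weak derivative\<close>

lemma test_function_has_deriv:
  assumes "test_function \<phi>" shows "(\<phi> has_real_derivative deriv \<phi> t) (at t)"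
  using assms unfolding test_function_def by (metis DERIV_imp_deriv)

lemma test_function_continuous:
  assumes "test_function \<phi>" shows "continuous_on UNIV \<phi>" "continuous_on UNIV (deriv \<phi>)"
proof -
  obtain D where D: "D 0 = \<phi>" "\<And>n t. (D n has_real_derivative D (Suc n) t) (at t)"
    using assms unfolding test_function_def by blast
  have "continuous_on UNIV (D n)" for n
    using D(2) by (intro continuous_at_imp_continuous_on) (auto intro: DERIV_isCont)
  moreover have "deriv \<phi> = D (Suc 0)" using D by (metis DERIV_imp_deriv ext)
  ultimately show "continuous_on UNIV \<phi>" "continuous_on UNIV (deriv \<phi>)" using D(1) by metis+
qed

lemma test_function_support:
  assumes "test_function \<phi>"
  obtains B where "0 < B" "\<And>t. B < \<bar>t\<bar> \<Longrightarrow> \<phi> t = 0" "\<And>t. B < \<bar>t\<bar> \<Longrightarrow> deriv \<phi> t = 0"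
proof -
  obtain B where B: "0 < B" "\<And>t. \<phi> t \<noteq> 0 \<Longrightarrow> \<bar>t\<bar> \<le> B"
    using assms unfolding test_function_def bounded_pos by auto
  have 0: "\<phi> t = 0" if "B < \<bar>t\<bar>" for t using B(2)[of t] that by force
  have "deriv \<phi> t = 0" if "B < \<bar>t\<bar>" for t
  proof (rule DERIV_imp_deriv)
    have "open {t::real. B < \<bar>t\<bar>}" by (intro open_Collect_less continuous_intros)
    then have "\<forall>\<^sub>F s in nhds t. \<phi> s = 0"
      using eventually_nhds_in_open[of "{t. B < \<bar>t\<bar>}" t] that 0 by (auto elim!: eventually_mono)
    then show "(\<phi> has_real_derivative 0) (at t)"
      by (subst DERIV_cong_ev[of t t _ "\<lambda>_. 0"]) auto
  qed
  then show thesis using that B(1) 0 by blast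
qed

lemma integrable_continuous_compact_support:
  fixes f :: "real \<Rightarrow> real"
  assumes "continuous_on UNIV f" "\<And>t. B < \<bar>t\<bar> \<Longrightarrow> f t = 0"
  shows "integrable lborel f"
proof -
  have "integrable lborel (\<lambda>t. indicator {-B..B} t *\<^sub>R f t)"
    by (rule borel_integrable_compact) (auto intro: continuous_on_subset[OF assms(1)])
  moreover have "indicator {-B..B} t *\<^sub>R f t = f t" for t
    using assms(2)[of t] by (cases "B < \<bar>t\<bar>") (auto simp: indicator_def)
  ultimately show ?thesis by (simp only:)
qed

text \<open>The weight is divided into \<open>exp (- (\<rho> * t))\<close> on \<open>f\<close> and
  \<open>exp (\<rho> * t)\<close> on \<open>\<psi>\<close>. Young's inequality with a free
  \<open>\<delta>\<close> stands in for the Cauchy-Schwarz inequality: it yields integrability at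
  once, and \<open>\<delta>\<close> can later be tuned to balance the two terms.\<close>

lemma
  fixes f :: "real \<Rightarrow> 'a::real_inner"
  assumes f: "L2w \<rho> f" and \<psi>m: "\<psi> \<in> borel_measurable borel"
    and \<psi>: "integrable lborel (\<lambda>t. (\<psi> t)^2 * exp (2 * \<rho> * t))"
  shows L2w_integrable_mult_inner: "integrable lborel (\<lambda>t. \<psi> t * inner (f t) h)"
    and L2w_abs_integral_mult_inner_le: "0 < \<delta> \<Longrightarrow> \<bar>LINT t|lborel. \<psi> t * inner (f t) h\<bar>
      \<le> \<delta> * (wnorm \<rho> f)^2 + (norm h)^2 / \<delta> * (LINT t|lborel. (\<psi> t)^2 * exp (2 * \<rho> * t))"
proof -
  note [measurable] = L2w_measurable[OF f] \<psi>m
  let ?b = "\<lambda>\<delta> t. \<delta> * ((norm (f t))^2 * exp (-2 * \<rho> * t)) + (norm h)^2 / \<delta> * ((\<psi> t)^2 * exp (2 * \<rho> * t))"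
  have [measurable]: "(\<lambda>t. inner (f t) h) \<in> borel_measurable borel"
    by (rule measurable_compose[OF L2w_measurable[OF f]])
       (intro borel_measurable_continuous_onI continuous_intros)
  have b: "integrable lborel (?b \<delta>)" for \<delta>
    by (intro Bochner_Integration.integrable_add integrable_mult_right L2w_integrable[OF f] \<psi>)
  have le: "\<bar>\<psi> t * inner (f t) h\<bar> \<le> ?b \<delta> t" if "0 < \<delta>" for \<delta> t
  proof -
    define x y where "x = norm (f t) * exp (- (\<rho> * t))" and "y = norm h * (\<bar>\<psi> t\<bar> * exp (\<rho> * t))"
    have xy: "x * y = norm (f t) * norm h * \<bar>\<psi> t\<bar>"
      by (simp add: x_def y_def exp_minus)
    have "\<bar>\<psi> t * inner (f t) h\<bar> \<le> \<bar>\<psi> t\<bar> * (norm (f t) * norm h)"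
      unfolding abs_mult by (intro mult_left_mono Cauchy_Schwarz_ineq2) auto
    also have "\<dots> = x * y" by (simp add: xy)
    also have "\<dots> \<le> 2 * (x * y)" by (simp add: x_def y_def)
    also have "2 * (x * y) = \<delta> * x^2 + y^2 / \<delta> - (\<delta> * x - y)^2 / \<delta>"
      using that by (simp add: field_simps power2_eq_square)
    also have "\<dots> \<le> \<delta> * x^2 + y^2 / \<delta>" using that by simp
    also have "\<dots> = ?b \<delta> t"
    proof -
      have "exp (- (\<rho> * t))^2 = exp (-2 * \<rho> * t)" "exp (\<rho> * t)^2 = exp (2 * \<rho> * t)"
        by (simp_all add: exp_double[symmetric] mult.assoc)
      then show ?thesis by (simp add: x_def y_def power_mult_distrib)
    qed
    finally show ?thesis .
  qed
  show int: "integrable lborel (\<lambda>t. \<psi> t * inner (f t) h)"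
    by (rule Bochner_Integration.integrable_bound[OF b[of 1]])
       (use le[of 1] in \<open>auto intro: order_trans[OF _ abs_ge_self]\<close>)
  assume \<delta>: "0 < \<delta>"
  have "\<bar>LINT t|lborel. \<psi> t * inner (f t) h\<bar> \<le> (LINT t|lborel. \<bar>\<psi> t * inner (f t) h\<bar>)"
    by (rule integral_abs_bound)
  also have "\<dots> \<le> (LINT t|lborel. ?b \<delta> t)"
    by (intro integral_mono b le[OF \<delta>] integrable_abs int)
  also have "\<dots> = \<delta> * (wnorm \<rho> f)^2 + (norm h)^2 / \<delta> * (LINT t|lborel. (\<psi> t)^2 * exp (2 * \<rho> * t))"
    unfolding wnorm_power2
    by (subst Bochner_Integration.integral_add)
       (use L2w_integrable[OF f] \<psi> in \<open>auto intro!: integrable_mult_right\<close>)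
  finally show "\<bar>LINT t|lborel. \<psi> t * inner (f t) h\<bar>
      \<le> \<delta> * (wnorm \<rho> f)^2 + (norm h)^2 / \<delta> * (LINT t|lborel. (\<psi> t)^2 * exp (2 * \<rho> * t))" .
qed

lemma L2w_inner_integrable_interval:
  assumes "L2w \<rho> f"
  shows "integrable lborel (\<lambda>t. indicator {c<..<d} t * inner (f t) h)"
proof (rule L2w_integrable_mult_inner[OF assms])
  have "integrable lborel (\<lambda>t. indicator {c..d} t *\<^sub>R exp (2 * \<rho> * t))"
    by (intro borel_integrable_compact continuous_intros) auto
  then show "integrable lborel (\<lambda>t. (indicator {c<..<d} t)^2 * exp (2 * \<rho> * t))"
    by (rule Bochner_Integration.integrable_bound) (auto simp: indicator_def)
qed simp

lemma L2w_inner_measurable: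
  assumes "L2w \<rho> f" shows "(\<lambda>t. inner (f t) h) \<in> borel_measurable borel"
  by (rule measurable_compose[OF L2w_measurable[OF assms]])
     (intro borel_measurable_continuous_onI continuous_intros)

lemma L2w_integrable_test_function:
  assumes f: "L2w \<rho> f" and \<phi>: "test_function \<phi>"
  shows "integrable lborel (\<lambda>t. \<phi> t * inner (f t) h)"
    and "integrable lborel (\<lambda>t. deriv \<phi> t * inner (f t) h)"
    and "integrable lborel (\<lambda>t. (\<phi> t)^2 * exp (2 * \<rho> * t))"
proof -
  obtain B where B: "\<And>t. B < \<bar>t\<bar> \<Longrightarrow> \<phi> t = 0" "\<And>t. B < \<bar>t\<bar> \<Longrightarrow> deriv \<phi> t = 0"
    using test_function_support[OF \<phi>] by metis
  note c = test_function_continuous[OF \<phi>]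
  show *: "integrable lborel (\<lambda>t. (\<phi> t)^2 * exp (2 * \<rho> * t))"
    using B by (intro integrable_continuous_compact_support[of _ B] continuous_intros c) auto
  show "integrable lborel (\<lambda>t. \<phi> t * inner (f t) h)"
    by (intro L2w_integrable_mult_inner[OF f] borel_measurable_continuous_onI c *)
  have "integrable lborel (\<lambda>t. (deriv \<phi> t)^2 * exp (2 * \<rho> * t))"
    using B by (intro integrable_continuous_compact_support[of _ B] continuous_intros c) auto
  then show "integrable lborel (\<lambda>t. deriv \<phi> t * inner (f t) h)"
    by (intro L2w_integrable_mult_inner[OF f] borel_measurable_continuous_onI c)
qed

lemma weak_deriv_diff:
  assumes "weak_deriv \<rho> u v" "weak_deriv \<rho> u' v'"
  shows "weak_deriv \<rho> (\<lambda>t. u t - u' t) (\<lambda>t. v t - v' t)"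
proof -
  have L: "L2w \<rho> u" "L2w \<rho> v" "L2w \<rho> u'" "L2w \<rho> v'" using assms by (auto simp: weak_deriv_def)
  have "(LINT t|lborel. deriv \<phi> t * inner (u t - u' t) h) = - (LINT t|lborel. \<phi> t * inner (v t - v' t) h)"
    if \<phi>: "test_function \<phi>" for \<phi> h
  proof -
    have "(LINT t|lborel. deriv \<phi> t * inner (u t) h) = - (LINT t|lborel. \<phi> t * inner (v t) h)"
      "(LINT t|lborel. deriv \<phi> t * inner (u' t) h) = - (LINT t|lborel. \<phi> t * inner (v' t) h)"
      using assms \<phi> by (auto simp: weak_deriv_def)
    then show ?thesis
      using L2w_integrable_test_function[OF L(1) \<phi>] L2w_integrable_test_function[OF L(2) \<phi>]
        L2w_integrable_test_function[OF L(3) \<phi>] L2w_integrable_test_function[OF L(4) \<phi>]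
      by (simp add: inner_diff_left right_diff_distrib)
  qed
  then show ?thesis using L by (auto simp: weak_deriv_def intro: L2w_diff)
qed

text \<open>Locality of differentiation: a test function vanishing from \<open>a\<close> on has a
  derivative vanishing beyond \<open>a\<close>, so it does not see \<open>w\<close> there; the point
  \<open>a\<close> itself is null.\<close>

lemma weak_deriv_eq_0_before:
  assumes wd: "weak_deriv \<rho> w g" and w: "AE t in lborel. t < a \<longrightarrow> w t = 0"
  shows "AE t in lborel. t < a \<longrightarrow> g t = 0"
proof -
  have L: "L2w \<rho> w" "L2w \<rho> g" using wd by (auto simp: weak_deriv_def)
  show ?thesis
  proof (rule AE_eq_0_of_inner[OF L2w_measurable[OF L(2)]],
      rule AE_eq_0_of_test_functions[OF L2w_inner_integrable_interval[OF L(2)] L2w_inner_measurable[OF L(2)]])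
    fix h \<phi> assume \<phi>: "test_function \<phi>" and 0: "\<And>t. a \<le> t \<Longrightarrow> \<phi> t = 0"
    have d0: "deriv \<phi> t = 0" if "a < t" for t
    proof (rule DERIV_imp_deriv)
      have "\<forall>\<^sub>F s in nhds t. \<phi> s = 0"
        using eventually_nhds_in_open[of "{a<..}" t] that 0 by (auto elim!: eventually_mono)
      then show "(\<phi> has_real_derivative 0) (at t)"
        by (subst DERIV_cong_ev[of t t _ "\<lambda>_. 0"]) auto
    qed
    have "(LINT t|lborel. deriv \<phi> t * inner (w t) h) = (LINT (t::real)|lborel. 0)"
    proof (rule integral_cong_AE)
      show "AE t in lborel. deriv \<phi> t * inner (w t) h = 0"
        using w AE_lborel_singleton[of a]
      proof eventually_elim
        case (elim t)
        then show ?case using d0[of t] by (cases "t < a") auto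
      qed
      show "(\<lambda>t. deriv \<phi> t * inner (w t) h) \<in> borel_measurable lborel"
        using L2w_integrable_test_function(2)[OF L(1) \<phi>] by (rule borel_measurable_integrable)
    qed simp
    then show "(LINT t|lborel. \<phi> t * inner (g t) h) = 0"
      using wd \<phi> by (simp add: weak_deriv_def)
  qed
qed

lemma antiderivative_continuous_real:
  fixes f :: "real \<Rightarrow> real"
  assumes f: "continuous_on UNIV f"
  obtains F where "\<And>t. (F has_real_derivative f t) (at t)"
proof (rule that)
  fix t :: real
  let ?a = "min 0 t - 1" and ?b = "max 0 t + 1"
  have "((\<lambda>u. LBINT y=ereal 0..ereal u. f y) has_vector_derivative f t) (at t within {?a..?b})"
    by (rule interval_integral_FTC2) (auto intro: continuous_on_subset[OF f])
  then show "((\<lambda>u. LBINT y=ereal 0..ereal u. f y) has_real_derivative f t) (at t)"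
    by (subst (asm) at_within_Icc_at) (auto simp: has_real_derivative_iff_has_vector_derivative)
qed

text \<open>For a test function \<open>\<eta>\<close> with antiderivative \<open>H\<close>, the difference of \<open>H\<close> and its translate by
  \<open>R\<close> is again a test function; the weighted norm makes the contribution of the translate
  vanish as \<open>R\<close> tends to infinity.\<close>
lemma weak_antideriv_eq_0_before:
  assumes wd: "weak_deriv \<rho> w g" and "0 < \<rho>" and g: "AE t in lborel. t < a \<longrightarrow> g t = 0"
  shows "AE t in lborel. t < a \<longrightarrow> w t = 0"
proof -
  have L: "L2w \<rho> w" "L2w \<rho> g" using wd by (auto simp: weak_deriv_def)
  show ?thesis
  proof (rule AE_eq_0_of_inner[OF L2w_measurable[OF L(1)]],
      rule AE_eq_0_of_test_functions[OF L2w_inner_integrable_interval[OF L(1)] L2w_inner_measurable[OF L(1)]])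
    fix h \<eta> assume \<eta>: "test_function \<eta>" and 0: "\<And>t. a \<le> t \<Longrightarrow> \<eta> t = 0"
    obtain B where B: "0 < B" "\<And>t. B < \<bar>t\<bar> \<Longrightarrow> \<eta> t = 0"
      using test_function_support[OF \<eta>] by metis
    obtain D where D: "D 0 = \<eta>" "\<And>n t. (D n has_real_derivative D (Suc n) t) (at t)"
      using \<eta> unfolding test_function_def by blast
    obtain H where H: "\<And>t. (H has_real_derivative \<eta> t) (at t)"
      using antiderivative_continuous_real[OF test_function_continuous(1)[OF \<eta>]] by blast
    have Hconst: "H s = H t" if "s \<le> t" "\<And>x. s < x \<Longrightarrow> x < t \<Longrightarrow> \<eta> x = 0" for s t
    proof (cases "s < t")
      case True
      show ?thesis
        by (rule DERIV_isconst_end[OF True, symmetric])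
           (use H that(2) in \<open>auto intro!: continuous_at_imp_continuous_on DERIV_isCont, metis\<close>)
    qed (use that in simp)
    let ?N = "LINT t|lborel. (\<eta> t)^2 * exp (2 * \<rho> * t)"
    have bd: "\<bar>LINT t|lborel. \<eta> t * inner (w t) h\<bar> \<le> exp (- \<rho> * R) * ((wnorm \<rho> w)^2 + (norm h)^2 * ?N)"
      if R: "0 < R" for R
    proof -
      \<comment> \<open>\<open>H\<close> is constant from \<open>a\<close> on, so \<open>H t\<close>
        and \<open>H (t + R)\<close> agree there and \<open>\<phi>\<close> meets \<open>g\<close>
        only where \<open>g\<close> is 0. The translate is to the left, where the dual weight
        \<open>exp (2 * \<rho> * t)\<close> is small.\<close>
      define \<phi> where "\<phi> = (\<lambda>t. H t - H (t + R))"
      define E where "E n = (case n of 0 \<Rightarrow> \<phi> | Suc n \<Rightarrow> (\<lambda>t. D n t - D n (t + R)))" for n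
      have shift: "((\<lambda>t. F (t + R)) has_real_derivative F' (t + R)) (at t)"
        if "\<And>t. (F has_real_derivative F' t) (at t)" for F F' t
        using that[of "t + R"] by (simp add: DERIV_shift)
      have E: "(E n has_real_derivative E (Suc n) t) (at t)" for n t
        by (cases n) (auto simp: E_def \<phi>_def D(1) intro!: DERIV_diff H D(2) shift)
      have out: "\<phi> t = 0" if "B + R < \<bar>t\<bar>" for t
        unfolding \<phi>_def by (subst Hconst[of t "t + R"]) (use R B that in \<open>auto simp: abs_if split: if_splits\<close>)
      have "{t. \<phi> t \<noteq> 0} \<subseteq> {- (B + R)..B + R}"
      proof
        fix t assume "t \<in> {t. \<phi> t \<noteq> 0}"
        then have "\<not> B + R < \<bar>t\<bar>" using out[of t] by blast
        then show "t \<in> {- (B + R)..B + R}" by auto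
      qed
      then have \<phi>: "test_function \<phi>"
        unfolding test_function_def
        by (intro conjI exI[of _ E] allI E) (auto simp: E_def intro: bounded_subset[OF bounded_closed_interval])
      have \<phi>0: "\<phi> t = 0" if "a \<le> t" for t
        unfolding \<phi>_def by (subst Hconst[of t "t + R"]) (use R 0 that in auto)
      have d\<phi>: "deriv \<phi> t = \<eta> t - \<eta> (t + R)" for t
        using E[of 0 t] by (intro DERIV_imp_deriv) (simp add: E_def D(1))
      have \<eta>c: "continuous_on UNIV (\<lambda>t. \<eta> (t + R))"
        by (rule continuous_on_compose2[OF test_function_continuous(1)[OF \<eta>]]) (auto intro!: continuous_intros)
      have 1: "integrable lborel (\<lambda>t. (\<eta> (t + R))^2 * exp (2 * \<rho> * t))"
        using R B by (intro integrable_continuous_compact_support[of _ "B + R"] continuous_intros \<eta>c)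
           (auto simp: abs_if split: if_splits)
      have "(LINT t|lborel. (\<eta> (t + R))^2 * exp (2 * \<rho> * (t + R))) = ?N"
        using lborel_integral_real_affine[of 1 "\<lambda>t. (\<eta> t)^2 * exp (2 * \<rho> * t)" R]
        by (simp add: add.commute)
      moreover have "(\<eta> (t + R))^2 * exp (2 * \<rho> * (t + R)) = exp (2 * \<rho> * R) * ((\<eta> (t + R))^2 * exp (2 * \<rho> * t))" for t
        by (simp add: distrib_left exp_add)
      ultimately have "exp (2 * \<rho> * R) * (LINT t|lborel. (\<eta> (t + R))^2 * exp (2 * \<rho> * t)) = ?N"
        by (simp only: integral_mult_right_zero)
      then have N: "(LINT t|lborel. (\<eta> (t + R))^2 * exp (2 * \<rho> * t)) = exp (- (2 * \<rho> * R)) * ?N"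
        by (simp add: exp_minus field_simps)
      note i = L2w_integrable_mult_inner[OF L(1) borel_measurable_continuous_onI[OF \<eta>c] 1, of h]
      have "(LINT t|lborel. deriv \<phi> t * inner (w t) h) = - (LINT t|lborel. \<phi> t * inner (g t) h)"
        using wd \<phi> by (simp add: weak_deriv_def)
      also have "(LINT t|lborel. \<phi> t * inner (g t) h) = (LINT (t::real)|lborel. 0)"
      proof (rule integral_cong_AE)
        show "AE t in lborel. \<phi> t * inner (g t) h = 0"
          using g
        proof eventually_elim
          case (elim t)
          then show ?case using \<phi>0[of t] by (cases "t < a") auto
        qed
        show "(\<lambda>t. \<phi> t * inner (g t) h) \<in> borel_measurable lborel"
          using L2w_integrable_test_function(1)[OF L(2) \<phi>] by (rule borel_measurable_integrable)
      qed simp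
      finally have "(LINT t|lborel. \<eta> t * inner (w t) h) = (LINT t|lborel. \<eta> (t + R) * inner (w t) h)"
        unfolding d\<phi> using L2w_integrable_test_function(1)[OF L(1) \<eta>, of h] i
        by (simp add: left_diff_distrib)
      \<comment> \<open>With \<open>\<delta> = exp (- \<rho> * R)\<close> both terms decay at the
        same rate: the translated integral brings \<open>exp (- (2 * \<rho> * R))\<close>, and
        division by \<open>\<delta>\<close> consumes half of this exponent.\<close>
      also have "\<bar>\<dots>\<bar> \<le> exp (- \<rho> * R) * (wnorm \<rho> w)^2 + (norm h)^2 / exp (- \<rho> * R) * (exp (- (2 * \<rho> * R)) * ?N)"
        using L2w_abs_integral_mult_inner_le[OF L(1) borel_measurable_continuous_onI[OF \<eta>c] 1, of "exp (- \<rho> * R)" h]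
        unfolding N by simp
      also have "exp (- (2 * \<rho> * R)) = exp (- \<rho> * R) * exp (- \<rho> * R)"
        unfolding exp_add[symmetric] by simp
      finally show ?thesis by (simp add: field_simps)
    qed
    have "(\<lambda>n. exp (- \<rho> * real (Suc n)) * ((wnorm \<rho> w)^2 + (norm h)^2 * ?N)) \<longlonglongrightarrow> 0 * ((wnorm \<rho> w)^2 + (norm h)^2 * ?N)"
    proof (intro tendsto_mult tendsto_const)
      have "(\<lambda>n. exp (- \<rho>) ^ Suc n) \<longlonglongrightarrow> 0"
        using \<open>0 < \<rho>\<close> by (intro LIMSEQ_Suc LIMSEQ_power_zero) auto
      then show "(\<lambda>n. exp (- \<rho> * real (Suc n))) \<longlonglongrightarrow> 0"
        by (simp only: exp_of_nat2_mult)
    qed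
    then have "\<bar>LINT t|lborel. \<eta> t * inner (w t) h\<bar> \<le> 0 * ((wnorm \<rho> w)^2 + (norm h)^2 * ?N)"
      by (rule LIMSEQ_le_const) (use bd in auto)
    then show "(LINT t|lborel. \<eta> t * inner (w t) h) = 0" by simp
  qed
qed

subsection \<open>Weak antiderivatives\<close>

text \<open>A variational proof: \<open>J\<close> is bounded below, the parallelogram law makes a
  minimising sequence Cauchy, and at the minimiser the first variation of \<open>J\<close> in
  direction \<open>h\<close> vanishes.\<close>

lemma riesz_representation:
  fixes l :: "'a::{real_inner, complete_space} \<Rightarrow> real"
  assumes l: "bounded_linear l"
  obtains z where "\<And>h. l h = inner z h"
proof -
  interpret bounded_linear l by fact
  define J where "J x = (norm x)^2 - 2 * l x" for x
  obtain M where M: "\<And>x. \<bar>l x\<bar> \<le> norm x * M" using bounded by auto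
  have Jge: "- (M^2) \<le> J x" for x
  proof -
    have "0 \<le> (norm x - M)^2" by simp
    also have "\<dots> = (norm x)^2 - 2 * (norm x * M) + M^2" by (simp add: power2_eq_square algebra_simps)
    also have "\<dots> \<le> J x + M^2" using M[of x] by (simp add: J_def abs_le_iff)
    finally show ?thesis by simp
  qed
  then have bdd: "bdd_below (range J)" by (auto intro!: bdd_belowI)
  define i where "i = Inf (range J)"
  have i: "i \<le> J x" for x unfolding i_def by (rule cInf_lower) (use bdd in auto)
  have "\<exists>x. J x < i + inverse (real (Suc n))" for n
    using cInf_lessD[of "range J" "i + inverse (real (Suc n))"] by (auto simp: i_def)
  then obtain x where x: "\<And>n. J (x n) < i + inverse (real (Suc n))" by metis
  have par: "(norm (a - b))^2 \<le> 2 * (J a + J b - 2 * i)" for a b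
  proof -
    have "J a + J b = 2 * J ((1/2) *\<^sub>R (a + b)) + (norm (a - b))^2 / 2"
      unfolding J_def scale add power2_norm_eq_inner
      by (simp add: inner_add inner_diff inner_commute field_simps)
    then show ?thesis using i[of "(1/2) *\<^sub>R (a + b)"] by simp
  qed
  have "Cauchy x"
  proof (rule metric_CauchyI)
    fix e :: real assume e: "0 < e"
    then obtain N where N: "inverse (real (Suc N)) < e^2 / 4" using reals_Archimedean[of "e^2/4"] by auto
    show "\<exists>N. \<forall>m\<ge>N. \<forall>n\<ge>N. dist (x m) (x n) < e"
    proof (intro exI[of _ N] allI impI)
      fix m n assume mn: "N \<le> m" "N \<le> n"
      have *: "inverse (real (Suc k)) \<le> inverse (real (Suc N))" if "N \<le> k" for k
        using that by (intro le_imp_inverse_le) auto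
      have "J (x m) < i + e^2 / 4" "J (x n) < i + e^2 / 4"
        using x[of m] x[of n] N *[OF mn(1)] *[OF mn(2)] by linarith+
      then have "(norm (x m - x n))^2 < e^2" using par[of "x m" "x n"] by simp
      then show "dist (x m) (x n) < e" using e by (simp add: dist_norm power2_less_imp_less)
    qed
  qed
  then obtain z where z: "x \<longlonglongrightarrow> z" using Cauchy_convergent convergent_def by blast
  have "(\<lambda>n. J (x n)) \<longlonglongrightarrow> J z"
    unfolding J_def by (intro tendsto_intros z tendsto)
  moreover have "(\<lambda>n. i + inverse (real (Suc n))) \<longlonglongrightarrow> i + 0"
    by (intro tendsto_intros LIMSEQ_inverse_real_of_nat)
  ultimately have "J z \<le> i + 0"
    by (rule LIMSEQ_le) (use x less_imp_le in blast)
  then have Jz: "J z \<le> i" by simp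
  show thesis
  proof (rule that)
    fix h
    define b where "b = inner z h - l h"
    define A where "A = (norm h)^2"
    have A: "0 \<le> A" by (simp add: A_def)
    have ineq: "0 \<le> s^2 * A + 2 * s * b" for s
    proof -
      have "J (z + s *\<^sub>R h) = J z + (s^2 * A + 2 * s * b)"
        unfolding J_def A_def b_def add scale power2_norm_eq_inner
        by (simp add: inner_add inner_commute algebra_simps power2_eq_square)
      then show ?thesis using i[of "z + s *\<^sub>R h"] Jz by simp
    qed
    \<comment> \<open>A move against the slope \<open>b\<close>; the \<open>+ 1\<close> keeps the
      step finite when \<open>h\<close> is 0. The value obtained is negative unless
      \<open>b = 0\<close>.\<close>
    have "0 \<le> (- b / (A + 1))^2 * A + 2 * (- b / (A + 1)) * b" by (rule ineq)
    also have "\<dots> = - (b^2 * (A + 2)) / (A + 1)^2"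
      using A by (simp add: field_simps power2_eq_square add_nonneg_eq_0_iff)
    finally have "b^2 * (A + 2) \<le> 0" using A by (simp add: field_simps zero_le_divide_iff)
    then have "b = 0" using A by (simp add: mult_le_0_iff)
    then show "l h = inner z h" by (simp add: b_def)
  qed
qed

section \<open>Exponential integrals and integration from minus infinity\<close>

lemma nn_integral_exp_atLeast:
  fixes k :: real assumes "0 < k"
  shows "(\<integral>\<^sup>+t. ennreal (exp (- k * t)) * indicator {s..} t \<partial>lborel) = ennreal (exp (- k * s) / k)"
proof -
  have "((\<lambda>x. exp (- (k * x))) \<longlongrightarrow> 0) at_top"
  proof (rule filterlim_compose[OF exp_at_bot])
    show "LIM x at_top. - (k * x) :> at_bot"
      using filterlim_tendsto_pos_mult_at_top[OF tendsto_const \<open>0 < k\<close> filterlim_ident]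
      by (simp add: filterlim_uminus_at_top)
  qed
  then have "((\<lambda>x. - exp (- (k * x)) / k) \<longlongrightarrow> - 0 / k) at_top" by (intro tendsto_intros) (use assms in auto)
  then have "(\<integral>\<^sup>+t. ennreal (exp (- (k * t))) * indicator {s..} t \<partial>lborel) = 0 - (- exp (- (k * s)) / k)"
    by (intro nn_integral_FTC_atLeast) (use assms in \<open>auto intro!: derivative_eq_intros\<close>)
  then show ?thesis by simp
qed

lemma nn_integral_exp_atMost:
  fixes k :: real assumes "0 < k"
  shows "(\<integral>\<^sup>+s. ennreal (exp (k * s)) * indicator {..t} s \<partial>lborel) = ennreal (exp (k * t) / k)"
proof -
  have "(\<integral>\<^sup>+s. ennreal (exp (k * s)) * indicator {..t} s \<partial>lborel)
      = (\<integral>\<^sup>+s. ennreal (exp (k * (- s))) * indicator {..t} (- s) \<partial>lborel)"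
    by (subst nn_integral_real_affine[where c = "-1" and t = 0]) auto
  also have "\<dots> = (\<integral>\<^sup>+s. ennreal (exp (- k * s)) * indicator {- t..} s \<partial>lborel)"
    by (intro nn_integral_cong) (auto simp: indicator_def)
  also have "\<dots> = ennreal (exp (k * t) / k)" by (subst nn_integral_exp_atLeast[OF assms]) simp
  finally show ?thesis .
qed

lemma integrable_exp_atMost:
  fixes k :: real assumes "0 < k"
  shows "integrable lborel (\<lambda>s. (indicator {..t} s)^2 * exp (k * s))"
proof (rule integrableI_nonneg)
  have "(\<integral>\<^sup>+s. ennreal ((indicator {..t} s)^2 * exp (k * s)) \<partial>lborel)
      = (\<integral>\<^sup>+s. ennreal (exp (k * s)) * indicator {..t} s \<partial>lborel)"
    by (intro nn_integral_cong) (auto simp: indicator_def)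
  then show "(\<integral>\<^sup>+s. ennreal ((indicator {..t} s)^2 * exp (k * s)) \<partial>lborel) < \<infinity>"
    by (simp add: nn_integral_exp_atMost[OF assms])
qed auto

lemma continuous_integral_atMost:
  fixes F :: "real \<Rightarrow> real"
  assumes F: "\<And>t. integrable lborel (\<lambda>s. indicator {..t} s * F s)"
  shows "continuous_on UNIV (\<lambda>t. LINT s|lborel. indicator {..t} s * F s)"
proof (intro continuous_at_imp_continuous_on ballI)
  fix t :: real
  show "isCont (\<lambda>t. LINT s|lborel. indicator {..t} s * F s) t"
    unfolding continuous_at_sequentially comp_def
  proof (intro allI impI)
    fix x :: "nat \<Rightarrow> real" assume x: "x \<longlonglongrightarrow> t"
    then obtain K where K: "\<And>n. \<bar>x n\<bar> \<le> K"
      using convergent_imp_Bseq[of x] by (auto simp: convergent_def Bseq_def)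
    show "(\<lambda>n. LINT s|lborel. indicator {..x n} s * F s) \<longlonglongrightarrow> (LINT s|lborel. indicator {..t} s * F s)"
    proof (rule integral_dominated_convergence)
      show "integrable lborel (\<lambda>s. \<bar>indicator {..K} s * F s\<bar>)" using F[of K] by simp
      show "AE s in lborel. norm (indicator {..x n} s * F s) \<le> \<bar>indicator {..K} s * F s\<bar>" for n
        using K[of n] by (intro always_eventually allI) (auto simp: indicator_def abs_le_iff)
      show "AE s in lborel. (\<lambda>n. indicator {..x n} s * F s) \<longlonglongrightarrow> indicator {..t} s * F s"
        using AE_lborel_singleton[of t]
      proof eventually_elim
        case (elim s)
        have "\<forall>\<^sub>F n in sequentially. (indicator {..x n} s :: real) = indicator {..t} s"
        proof (cases "s < t")
          case True
          from order_tendstoD(1)[OF x this] show ?thesis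
            by eventually_elim (use True in \<open>auto simp: indicator_def\<close>)
        next
          case False
          with elim have "t < s" by simp
          from order_tendstoD(2)[OF x this] show ?thesis
            by eventually_elim (use \<open>t < s\<close> in \<open>auto simp: indicator_def\<close>)
        qed
        then show ?case by (intro tendsto_mult tendsto_const tendsto_eventually)
      qed
    qed (use F in \<open>auto dest: borel_measurable_integrable\<close>)
  qed
qed

lemma integral_deriv_test_function_atLeast:
  assumes \<phi>: "test_function \<phi>"
  shows "(LINT t|lborel. indicator {s..} t * deriv \<phi> t) = - \<phi> s"
proof -
  obtain B where B: "\<And>t. B < \<bar>t\<bar> \<Longrightarrow> \<phi> t = 0" "\<And>t. B < \<bar>t\<bar> \<Longrightarrow> deriv \<phi> t = 0"
    using test_function_support[OF \<phi>] by metis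
  define b where "b = max s \<bar>B\<bar> + 1"
  have "(LINT t|lborel. indicator {s..} t * deriv \<phi> t) = (LINT t|lborel. deriv \<phi> t * indicator {s..b} t)"
  proof (rule Bochner_Integration.integral_cong)
    fix t
    show "indicator {s..} t * deriv \<phi> t = deriv \<phi> t * indicator {s..b} t"
      using B(2)[of t] by (cases "t \<le> b") (auto simp: indicator_def b_def)
  qed simp
  also have "\<dots> = \<phi> b - \<phi> s"
  proof (rule integral_FTC_Icc_real)
    show "isCont (deriv \<phi>) x" for x
      using test_function_continuous(2)[OF \<phi>] by (simp add: continuous_on_eq_continuous_at)
  qed (auto simp: b_def intro: test_function_has_deriv[OF \<phi>])
  also have "\<phi> b = 0" by (rule B(1)) (auto simp: b_def)
  finally show ?thesis by simp
qed

text \<open>Fubini on the region \<open>s \<le> t\<close>. The kernel is integrable over the product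
  because \<open>deriv \<phi>\<close> has compact support and the inner integral of the absolute
  value of \<open>F\<close> is continuous in \<open>t\<close>.\<close>

lemma integral_test_function_antiderivative:
  fixes F :: "real \<Rightarrow> real"
  assumes F: "\<And>t. integrable lborel (\<lambda>s. indicator {..t} s * F s)" and Fm: "F \<in> borel_measurable borel"
    and \<phi>: "test_function \<phi>"
  shows "(LINT t|lborel. deriv \<phi> t * (LINT s|lborel. indicator {..t} s * F s)) = - (LINT s|lborel. \<phi> s * F s)"
proof -
  note [measurable] = Fm
  obtain B where B: "\<And>t. B < \<bar>t\<bar> \<Longrightarrow> \<phi> t = 0" "\<And>t. B < \<bar>t\<bar> \<Longrightarrow> deriv \<phi> t = 0"
    using test_function_support[OF \<phi>] by metis
  have [measurable]: "deriv \<phi> \<in> borel_measurable borel"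
    by (rule borel_measurable_continuous_onI[OF test_function_continuous(2)[OF \<phi>]])
  define K where "K t s = deriv \<phi> t * (if s \<le> t then F s else 0)" for t s
  have K: "K t s = deriv \<phi> t * (indicator {..t} s * F s)" for t s
    by (simp add: K_def indicator_def)
  have int: "integrable (lborel \<Otimes>\<^sub>M lborel) (\<lambda>(t, s). K t s)"
  proof (rule lborel_pair.Fubini_integrable)
    show "(\<lambda>(t, s). K t s) \<in> borel_measurable (lborel \<Otimes>\<^sub>M lborel)"
      unfolding K_def by measurable
    have "(LINT s|lborel. norm (K t s)) = \<bar>deriv \<phi> t\<bar> * (LINT s|lborel. indicator {..t} s * \<bar>F s\<bar>)" for t
      unfolding K by (subst integral_mult_right_zero[symmetric])
        (auto intro!: Bochner_Integration.integral_cong simp: abs_mult)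
    moreover have "integrable lborel (\<lambda>t. \<bar>deriv \<phi> t\<bar> * (LINT s|lborel. indicator {..t} s * \<bar>F s\<bar>))"
    proof (rule integrable_continuous_compact_support[of _ B])
      have "integrable lborel (\<lambda>s. indicator {..t} s * \<bar>F s\<bar>)" for t
        using integrable_abs[OF F[of t]] by (simp add: abs_mult)
      then show "continuous_on UNIV (\<lambda>t. \<bar>deriv \<phi> t\<bar> * (LINT s|lborel. indicator {..t} s * \<bar>F s\<bar>))"
        by (intro continuous_intros continuous_integral_atMost test_function_continuous(2)[OF \<phi>])
    qed (simp add: B)
    ultimately show "integrable lborel (\<lambda>t. LINT s|lborel. norm (case (t, s) of (t, s) \<Rightarrow> K t s))"
      by simp
    show "AE t in lborel. integrable lborel (\<lambda>s. case (t, s) of (t, s) \<Rightarrow> K t s)"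
      unfolding K using F by simp
  qed
  have "(LINT t|lborel. deriv \<phi> t * (LINT s|lborel. indicator {..t} s * F s)) = (LINT t|lborel. LINT s|lborel. K t s)"
    unfolding K by simp
  also have "\<dots> = (LINT s|lborel. LINT t|lborel. K t s)"
    by (rule lborel_pair.Fubini_integral[OF int, symmetric])
  also have "\<dots> = (LINT s|lborel. - (\<phi> s * F s))"
  proof (rule Bochner_Integration.integral_cong)
    fix s
    have "K t s = F s * (indicator {s..} t * deriv \<phi> t)" for t by (simp add: K_def indicator_def)
    then show "(LINT t|lborel. K t s) = - (\<phi> s * F s)"
      using integral_deriv_test_function_atLeast[OF \<phi>] by simp
  qed simp
  also have "\<dots> = - (LINT s|lborel. \<phi> s * F s)" by simp
  finally show ?thesis .
qed

text \<open>\<open>w t\<close> is the Riesz vector of the functional that integrates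
  \<open>inner (g s) h\<close> up to \<open>t\<close>. The scalar integral \<open>N\<close> of the
  norm dominates both size and increments of \<open>w\<close>; this gives continuity, hence
  measurability, and reduces the norm bound to a scalar estimate.\<close>

lemma weak_antiderivative_exists:
  fixes g :: "real \<Rightarrow> 'a::{real_inner, complete_space}"
  assumes g: "L2w \<rho> g" and \<rho>: "0 < \<rho>"
  obtains w where "weak_deriv \<rho> w g" "wnorm \<rho> w \<le> wnorm \<rho> g / \<rho>"
proof -
  note [measurable] = L2w_measurable[OF g] L2w_inner_measurable[OF g]
  have exp2: "integrable lborel (\<lambda>s. (indicator {..t} s)^2 * exp (2 * \<rho> * s))" for t
    using integrable_exp_atMost[of "2 * \<rho>" t] \<rho> by simp
  have gi: "integrable lborel (\<lambda>s. indicator {..t} s * inner (g s) h)" for t h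
    by (rule L2w_integrable_mult_inner[OF g _ exp2]) simp
  have gn: "integrable lborel (\<lambda>s. indicator {..t} s * norm (g s))" for t
  proof -
    have "L2w \<rho> (\<lambda>t. norm (g t))" using g by (simp add: L2w_iff)
    from L2w_integrable_mult_inner[OF this _ exp2[of t], of 1] show ?thesis by simp
  qed
  define N where "N t = (LINT s|lborel. indicator {..t} s * norm (g s))" for t
  define l where "l t h = (LINT s|lborel. indicator {..t} s * inner (g s) h)" for t h
  have N0: "0 \<le> N t" for t unfolding N_def by (intro integral_nonneg_AE) auto
  have ldiff: "\<bar>l t h - l s h\<bar> \<le> norm h * (N t - N s)" if "s \<le> t" for s t h
  proof -
    have "l t h - l s h = (LINT r|lborel. indicator {..t} r * inner (g r) h - indicator {..s} r * inner (g r) h)"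
      unfolding l_def by (rule Bochner_Integration.integral_diff[symmetric]) (rule gi)+
    also have "\<bar>\<dots>\<bar> \<le> (LINT r|lborel. \<bar>indicator {..t} r * inner (g r) h - indicator {..s} r * inner (g r) h\<bar>)"
      by (rule integral_abs_bound)
    also have "\<dots> \<le> (LINT r|lborel. norm h * (indicator {..t} r * norm (g r) - indicator {..s} r * norm (g r)))"
    proof (rule integral_mono)
      show "integrable lborel (\<lambda>r. \<bar>indicator {..t} r * inner (g r) h - indicator {..s} r * inner (g r) h\<bar>)"
        by (intro integrable_abs Bochner_Integration.integrable_diff gi)
      show "integrable lborel (\<lambda>r. norm h * (indicator {..t} r * norm (g r) - indicator {..s} r * norm (g r)))"
        by (intro integrable_mult_right Bochner_Integration.integrable_diff gn)
      show "\<bar>indicator {..t} r * inner (g r) h - indicator {..s} r * inner (g r) h\<bar>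
          \<le> norm h * (indicator {..t} r * norm (g r) - indicator {..s} r * norm (g r))" for r
        using Cauchy_Schwarz_ineq2[of "g r" h] \<open>s \<le> t\<close> by (auto simp: indicator_def mult.commute)
    qed
    also have "\<dots> = norm h * (N t - N s)"
      unfolding N_def by (subst Bochner_Integration.integral_diff[OF gn gn, symmetric]) simp
    finally show ?thesis .
  qed
  have lbound: "\<bar>l t h\<bar> \<le> norm h * N t" for t h
  proof -
    have "\<bar>l t h\<bar> \<le> (LINT r|lborel. \<bar>indicator {..t} r * inner (g r) h\<bar>)"
      unfolding l_def by (rule integral_abs_bound)
    also have "\<dots> \<le> (LINT r|lborel. norm h * (indicator {..t} r * norm (g r)))"
      by (intro integral_mono integrable_abs gi integrable_mult_right gn)
         (auto simp: indicator_def mult.commute[of "norm h"] Cauchy_Schwarz_ineq2)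
    also have "\<dots> = norm h * N t" by (simp add: N_def)
    finally show ?thesis .
  qed
  have "bounded_linear (l t)" for t
  proof (rule bounded_linear_intro)
    show "l t (x + y) = l t x + l t y" for x y
      unfolding l_def by (subst Bochner_Integration.integral_add[OF gi gi, symmetric])
        (simp add: inner_add_right distrib_left)
    show "l t (r *\<^sub>R x) = r *\<^sub>R l t x" for r x
      unfolding l_def by (simp add: mult.left_commute)
    show "norm (l t x) \<le> norm x * N t" for x using lbound by simp
  qed
  then have "\<exists>z. \<forall>h. l t h = inner z h" for t
    using riesz_representation[of "l t"] by metis
  then obtain w where w: "\<And>t h. l t h = inner (w t) h" by metis
  \<comment> \<open>Applied to \<open>w t\<close> and to differences of values of \<open>w\<close>:
    the bound on a functional is tested at its own Riesz vector.\<close>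
  have bound_from_self: "norm z \<le> b" if "inner z z \<le> norm z * b" "0 \<le> b" for z :: 'a and b
  proof (cases "z = 0")
    case False
    have "norm z * norm z \<le> norm z * b" using that(1) by (metis norm_eq_sqrt_inner power2_eq_square power2_norm_eq_inner)
    then show ?thesis using False by simp
  qed (use that in simp)
  have wN: "norm (w t) \<le> N t" for t
    using lbound[of t "w t"] by (intro bound_from_self N0) (simp add: w)
  have wdiff: "norm (w t - w s) \<le> \<bar>N t - N s\<bar>" if "s \<le> t" for s t
    using ldiff[OF that, of "w t - w s"] unfolding w inner_diff_left[symmetric]
    by (intro bound_from_self) (auto intro: order_trans[OF _ mult_left_mono])
  have wdiff': "norm (w t - w s) \<le> \<bar>N t - N s\<bar>" for s t
    using wdiff[of s t] wdiff[of t s] by (cases "s \<le> t") (auto simp: norm_minus_commute abs_minus_commute)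
  have Nc: "continuous_on UNIV N" unfolding N_def by (rule continuous_integral_atMost[OF gn])
  have wc: "continuous_on UNIV w"
  proof (intro continuous_at_imp_continuous_on ballI)
    fix t
    have "isCont N t" using Nc by (simp add: continuous_on_eq_continuous_at)
    then have "((\<lambda>s. \<bar>N s - N t\<bar>) \<longlongrightarrow> 0) (at t)"
      by (intro tendsto_rabs_zero) (simp add: isCont_def LIM_zero)
    then have "((\<lambda>s. w s - w t) \<longlongrightarrow> 0) (at t)"
      by (rule Lim_null_comparison[rotated]) (simp add: wdiff')
    then show "isCont w t" by (simp add: isCont_def LIM_zero_cancel)
  qed
  have wm: "w \<in> borel_measurable borel" by (rule borel_measurable_continuous_onI[OF wc])
  have Nm [measurable]: "N \<in> borel_measurable borel" by (rule borel_measurable_continuous_onI[OF Nc])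
  \<comment> \<open>Splitting the weight at \<open>\<rho> / 2\<close> leaves convergence on both
    sides: in the Cauchy-Schwarz estimate the first factor integrates to
    \<open>exp (\<rho> * t) / \<rho>\<close>, and the remaining \<open>exp (- \<rho> * t)\<close>,
    integrated over \<open>t \<ge> s\<close>, supplies the second \<open>1 / \<rho>\<close> and
    restores the weight of \<open>g\<close>.\<close>
  have nnN: "ennreal (N t) = (\<integral>\<^sup>+s. ennreal (exp (\<rho> / 2 * s)) * indicator {..t} s * ennreal (norm (g s) * exp (- \<rho> / 2 * s) * indicator {..t} s) \<partial>lborel)" for t
  proof -
    have "ennreal (N t) = (\<integral>\<^sup>+s. ennreal (indicator {..t} s * norm (g s)) \<partial>lborel)"
      unfolding N_def by (rule nn_integral_eq_integral[OF gn, symmetric]) simp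
    also have "\<dots> = (\<integral>\<^sup>+s. ennreal (exp (\<rho> / 2 * s)) * indicator {..t} s * ennreal (norm (g s) * exp (- \<rho> / 2 * s) * indicator {..t} s) \<partial>lborel)"
      by (intro nn_integral_cong) (auto simp: indicator_def ennreal_mult[symmetric] exp_minus)
    finally show ?thesis .
  qed
  define G where "G s = (norm (g s))^2 * exp (- \<rho> * s)" for s
  have [measurable]: "G \<in> borel_measurable borel" unfolding G_def by measurable
  have G0: "0 \<le> G s" for s by (simp add: G_def)
  have CS: "ennreal ((N t)^2) \<le> ennreal (exp (\<rho> * t) / \<rho>) * (\<integral>\<^sup>+s. ennreal (G s) * indicator {..t} s \<partial>lborel)" for t
  proof -
    have "ennreal ((N t)^2) = (ennreal (N t))^2" by (simp add: ennreal_power N0)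
    also have "\<dots> \<le> (\<integral>\<^sup>+s. (ennreal (exp (\<rho> / 2 * s)) * indicator {..t} s)^2 \<partial>lborel) *
        (\<integral>\<^sup>+s. (ennreal (norm (g s) * exp (- \<rho> / 2 * s) * indicator {..t} s))^2 \<partial>lborel)"
      unfolding nnN by (rule Cauchy_Schwarz_nn_integral) measurable
    also have "(\<integral>\<^sup>+s. (ennreal (exp (\<rho> / 2 * s)) * indicator {..t} s)^2 \<partial>lborel) = (\<integral>\<^sup>+s. ennreal (exp (\<rho> * s)) * indicator {..t} s \<partial>lborel)"
      by (intro nn_integral_cong) (auto simp: indicator_def ennreal_power exp_double[symmetric])
    also have "\<dots> = ennreal (exp (\<rho> * t) / \<rho>)" by (rule nn_integral_exp_atMost[OF \<rho>])
    also have "(\<integral>\<^sup>+s. (ennreal (norm (g s) * exp (- \<rho> / 2 * s) * indicator {..t} s))^2 \<partial>lborel) = (\<integral>\<^sup>+s. ennreal (G s) * indicator {..t} s \<partial>lborel)"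
      by (intro nn_integral_cong)
         (auto simp: indicator_def ennreal_power exp_double[symmetric] G_def power_mult_distrib)
    finally show ?thesis .
  qed
  have "(\<integral>\<^sup>+t. ennreal ((norm (w t))^2 * exp (-2 * \<rho> * t)) \<partial>lborel)
      \<le> (\<integral>\<^sup>+t. (\<integral>\<^sup>+s. ennreal (exp (- \<rho> * t) / \<rho>) * (ennreal (G s) * indicator {s..} t) \<partial>lborel) \<partial>lborel)"
  proof (rule nn_integral_mono)
    fix t
    have "ennreal ((norm (w t))^2 * exp (-2 * \<rho> * t)) \<le> ennreal ((N t)^2) * ennreal (exp (-2 * \<rho> * t))"
      by (subst ennreal_mult[symmetric]) (auto intro!: ennreal_leI mult_right_mono power_mono wN)
    also have "\<dots> \<le> (ennreal (exp (\<rho> * t) / \<rho>) * (\<integral>\<^sup>+s. ennreal (G s) * indicator {..t} s \<partial>lborel)) * ennreal (exp (-2 * \<rho> * t))"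
      by (intro mult_right_mono CS) auto
    also have "\<dots> = ennreal (exp (\<rho> * t) / \<rho> * exp (-2 * \<rho> * t)) * (\<integral>\<^sup>+s. ennreal (G s) * indicator {..t} s \<partial>lborel)"
      using \<rho> by (subst ennreal_mult) (auto simp: mult_ac)
    also have "exp (\<rho> * t) / \<rho> * exp (-2 * \<rho> * t) = exp (- \<rho> * t) / \<rho>"
      by (simp add: exp_add[symmetric])
    also have "(\<integral>\<^sup>+s. ennreal (G s) * indicator {..t} s \<partial>lborel) = (\<integral>\<^sup>+s. ennreal (G s) * indicator {s..} t \<partial>lborel)"
      by (intro nn_integral_cong) (auto simp: indicator_def)
    also have "ennreal (exp (- \<rho> * t) / \<rho>) * \<dots> = (\<integral>\<^sup>+s. ennreal (exp (- \<rho> * t) / \<rho>) * (ennreal (G s) * indicator {s..} t) \<partial>lborel)"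
    proof (rule nn_integral_cmult[symmetric])
      have "(\<lambda>s. ennreal (G s) * (if s \<le> t then 1 else 0)) \<in> borel_measurable lborel" by measurable
      then show "(\<lambda>s. ennreal (G s) * indicator {s..} t) \<in> borel_measurable lborel" by (simp add: indicator_def)
    qed
    finally show "ennreal ((norm (w t))^2 * exp (-2 * \<rho> * t))
      \<le> (\<integral>\<^sup>+s. ennreal (exp (- \<rho> * t) / \<rho>) * (ennreal (G s) * indicator {s..} t) \<partial>lborel)" .
  qed
  also have "\<dots> = (\<integral>\<^sup>+s. (\<integral>\<^sup>+t. ennreal (exp (- \<rho> * t) / \<rho>) * (ennreal (G s) * indicator {s..} t) \<partial>lborel) \<partial>lborel)"
  proof (rule lborel_pair.Fubini')
    have "(\<lambda>(s, t). ennreal (exp (- \<rho> * t) / \<rho>) * (ennreal (G s) * (if s \<le> t then 1 else 0)))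
        \<in> borel_measurable (lborel \<Otimes>\<^sub>M lborel)" by measurable
    then show "(\<lambda>(s, t). ennreal (exp (- \<rho> * t) / \<rho>) * (ennreal (G s) * indicator {s..} t))
        \<in> borel_measurable (lborel \<Otimes>\<^sub>M lborel)" by (simp add: indicator_def)
  qed
  also have "\<dots> = (\<integral>\<^sup>+s. ennreal (1 / \<rho>^2) * ennreal ((norm (g s))^2 * exp (-2 * \<rho> * s)) \<partial>lborel)"
  proof (rule nn_integral_cong)
    fix s
    have "(\<integral>\<^sup>+t. ennreal (exp (- \<rho> * t) / \<rho>) * (ennreal (G s) * indicator {s..} t) \<partial>lborel)
        = (\<integral>\<^sup>+t. ennreal (G s / \<rho>) * (ennreal (exp (- \<rho> * t)) * indicator {s..} t) \<partial>lborel)"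
      using \<rho> by (intro nn_integral_cong) (auto simp: indicator_def ennreal_mult[symmetric] G0)
    also have "\<dots> = ennreal (G s / \<rho>) * (\<integral>\<^sup>+t. ennreal (exp (- \<rho> * t)) * indicator {s..} t \<partial>lborel)"
      by (rule nn_integral_cmult) measurable
    also have "\<dots> = ennreal (G s / \<rho> * (exp (- \<rho> * s) / \<rho>))"
      unfolding nn_integral_exp_atLeast[OF \<rho>] using \<rho> by (subst ennreal_mult) (auto simp: G0)
    also have "G s / \<rho> * (exp (- \<rho> * s) / \<rho>) = 1 / \<rho>^2 * ((norm (g s))^2 * exp (-2 * \<rho> * s))"
      by (simp add: G_def power2_eq_square exp_double[symmetric] exp_add[symmetric])
    also have "ennreal \<dots> = ennreal (1 / \<rho>^2) * ennreal ((norm (g s))^2 * exp (-2 * \<rho> * s))"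
      by (subst ennreal_mult) auto
    finally show "(\<integral>\<^sup>+t. ennreal (exp (- \<rho> * t) / \<rho>) * (ennreal (G s) * indicator {s..} t) \<partial>lborel)
        = ennreal (1 / \<rho>^2) * ennreal ((norm (g s))^2 * exp (-2 * \<rho> * s))" .
  qed
  also have "\<dots> = ennreal (1 / \<rho>^2) * ennreal ((wnorm \<rho> g)^2)"
    unfolding nn_integral_wnorm[OF g, symmetric] by (rule nn_integral_cmult) measurable
  also have "\<dots> = ennreal ((wnorm \<rho> g / \<rho>)^2)"
    by (subst ennreal_mult[symmetric]) (auto simp: power_divide)
  finally have bd: "(\<integral>\<^sup>+t. ennreal ((norm (w t))^2 * exp (-2 * \<rho> * t)) \<partial>lborel) \<le> ennreal ((wnorm \<rho> g / \<rho>)^2)" .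
  have nn: "0 \<le> wnorm \<rho> g / \<rho>" using \<rho> by (simp add: wnorm_nonneg)
  show thesis
  proof (rule that)
    show "wnorm \<rho> w \<le> wnorm \<rho> g / \<rho>" by (rule wnorm_nn_integral_bound[OF wm nn bd])
    show "weak_deriv \<rho> w g"
      unfolding weak_deriv_def
    proof (intro conjI allI impI)
      show "L2w \<rho> w" by (rule L2w_nn_integral_bound[OF wm nn bd])
      fix \<phi> h assume "test_function \<phi>"
      from integral_test_function_antiderivative[OF gi L2w_inner_measurable[OF g] this]
      show "(LINT t|lborel. deriv \<phi> t * inner (w t) h) = - (LINT t|lborel. \<phi> t * inner (g t) h)"
        unfolding w[symmetric] l_def .
    qed fact
  qed
qed

section \<open>Uniqueness and norm bounds for the derivative and its inverse\<close>

lemma weak_antideriv_unique_before: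
  assumes "weak_deriv \<rho> w g" "weak_deriv \<rho> w' g'" "0 < \<rho>" "AE t in lborel. t < a \<longrightarrow> g t = g' t"
  shows "AE t in lborel. t < a \<longrightarrow> w t = w' t"
  using weak_antideriv_eq_0_before[OF weak_deriv_diff[OF assms(1,2)] assms(3), of a] assms(4) by simp

lemma weak_deriv_unique_before:
  assumes "weak_deriv \<rho> w g" "weak_deriv \<rho> w' g'" "AE t in lborel. t < a \<longrightarrow> w t = w' t"
  shows "AE t in lborel. t < a \<longrightarrow> g t = g' t"
  using weak_deriv_eq_0_before[OF weak_deriv_diff[OF assms(1,2)], of a] assms(3) by simp

lemma AE_before_all:
  fixes P :: "real \<Rightarrow> bool"
  assumes "\<And>a. AE t in lborel. t < a \<longrightarrow> P t"
  shows "AE t in lborel. P t"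
proof -
  have "AE t in lborel. \<forall>n::nat. t < real n \<longrightarrow> P t"
    unfolding AE_all_countable using assms by blast
  then show ?thesis by eventually_elim (use reals_Archimedean2 in blast)
qed

lemma weak_antideriv_unique:
  assumes "weak_deriv \<rho> w g" "weak_deriv \<rho> w' g'" "0 < \<rho>" "AE t in lborel. g t = g' t"
  shows "AE t in lborel. w t = w' t"
  by (rule AE_before_all, rule weak_antideriv_unique_before[OF assms(1,2,3)]) (use assms(4) in auto)

lemma weak_deriv_unique:
  assumes "weak_deriv \<rho> w g" "weak_deriv \<rho> w' g'" "AE t in lborel. w t = w' t"
  shows "AE t in lborel. g t = g' t"
  by (rule AE_before_all, rule weak_deriv_unique_before[OF assms(1,2)]) (use assms(3) in auto)

text \<open>Two antiderivatives of \<open>g\<close> agree almost everywhere, so every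
  \<open>w\<close> inherits the bound of the constructed one. The factor \<open>1 / \<rho>\<close>
  is what makes the dependence on \<open>u\<close> small, with no strict delay in
  \<open>\<alpha>\<close>.\<close>

lemma weak_deriv_wnorm_le:
  fixes g :: "real \<Rightarrow> 'a::{real_inner, complete_space}"
  assumes "weak_deriv \<rho> w g" "0 < \<rho>"
  shows "wnorm \<rho> w \<le> wnorm \<rho> g / \<rho>"
proof -
  have L: "L2w \<rho> w" "L2w \<rho> g" using assms(1) by (auto simp: weak_deriv_def)
  obtain w' where w': "weak_deriv \<rho> w' g" "wnorm \<rho> w' \<le> wnorm \<rho> g / \<rho>"
    using weak_antiderivative_exists[OF L(2) assms(2)] by metis
  have "AE t in lborel. w t = w' t" by (rule weak_antideriv_unique[OF assms(1) w'(1) assms(2)]) simp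
  then have "wnorm \<rho> w = wnorm \<rho> w'"
    using w'(1) L by (intro wnorm_cong_AE L2w_measurable) (auto simp: weak_deriv_def)
  then show ?thesis using w'(2) by simp
qed

lemma d0_weak_deriv: "u \<in> dom_d0 \<rho> \<Longrightarrow> weak_deriv \<rho> u (d0 \<rho> u)"
  unfolding dom_d0_def d0_def using someI_ex[of "weak_deriv \<rho> u"] by blast

lemma d0_inv_weak_deriv:
  fixes g :: "real \<Rightarrow> 'a::{real_inner, complete_space}"
  assumes "L2w \<rho> g" "0 < \<rho>"
  shows "weak_deriv \<rho> (d0_inv \<rho> g) g"
  unfolding d0_inv_def using weak_antiderivative_exists[OF assms] by (metis someI_ex)

subsection \<open>Composition with inverse time transformations\<close>

text \<open>A continuous injection of the line is monotone, and a decreasing one would fall below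
  the identity for large arguments. The point \<open>z\<close> lies so far right that
  \<open>f z\<close> exceeds \<open>f x\<close>.\<close>

lemma continuous_bij_ge_strict_mono:
  fixes f :: "real \<Rightarrow> real"
  assumes c: "continuous_on UNIV f" and b: "bij f" and ge: "\<And>s. s \<le> f s"
  shows "strict_mono f"
proof (rule strict_monoI, rule ccontr)
  fix x y :: real assume xy: "x < y" and "\<not> f x < f y"
  moreover have inj: "inj f" using b by (rule bij_is_inj)
  ultimately have lt: "f y < f x" using injD[OF inj, of x y] by force
  define z where "z = max y (f x) + 1"
  have "f x < f z" using ge[of z] by (simp add: z_def)
  moreover have "y < z" by (simp add: z_def)
  from continuous_inj_imp_mono[OF xy this continuous_on_subset[OF c] inj_on_subset[OF inj]]
  have "(f x < f y \<and> f y < f z) \<or> (f y < f x \<and> f z < f y)" by auto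
  ultimately show False using lt by auto
qed

lemma inv_measurable_of_strict_mono:
  fixes f :: "real \<Rightarrow> real"
  assumes "strict_mono f" "bij f"
  shows "inv f \<in> borel_measurable borel"
proof (rule borel_measurable_mono, rule monoI)
  fix x y :: real assume "x \<le> y"
  then have "f (inv f x) \<le> f (inv f y)" using assms(2) by (simp add: bij_is_surj surj_f_inv_f)
  then show "inv f x \<le> inv f y" using assms(1) by (simp add: strict_mono_less_eq)
qed

text \<open>The image measure is the Stieltjes measure of \<open>f\<close>; adding the Stieltjes measure of the
  nondecreasing function \<open>L t - f t\<close> yields \<open>L\<close> times Lebesgue measure.\<close>
lemma distr_inv_le:
  fixes f :: "real \<Rightarrow> real"
  assumes mono: "strict_mono f" and bij: "bij f" and lip: "L-lipschitz_on UNIV f"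
  shows "distr lborel borel (inv f) \<le> density lborel (\<lambda>_. ennreal L)"
proof -
  have [measurable]: "inv f \<in> borel_measurable borel" by (rule inv_measurable_of_strict_mono[OF mono bij])
  have L: "0 \<le> L" using lip by (rule lipschitz_on_nonneg)
  have fi: "f (inv f s) = s" for s using bij by (simp add: bij_is_surj surj_f_inv_f)
  define \<nu> where "\<nu> = distr lborel borel (inv f)"
  define F where "F t = L * t - f t" for t
  have Fc: "continuous_on UNIV F"
    unfolding F_def by (intro continuous_intros lipschitz_on_continuous_on[OF lip])
  have Fr: "continuous (at_right a) F" for a
    using Fc by (simp add: continuous_on_eq_continuous_at continuous_at_imp_continuous_within)
  have Fm: "F x \<le> F y" if "x \<le> y" for x y
    using lipschitz_onD[OF lip, of x y] strict_mono_less_eq[OF mono, of x y] that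
    by (simp add: F_def dist_real_def algebra_simps)
  define \<mu> where "\<mu> = interval_measure F"
  have s [simp]: "sets \<nu> = sets borel" "sets \<mu> = sets borel" by (simp_all add: \<nu>_def \<mu>_def)
  have \<nu>I: "emeasure \<nu> {a<..b} = ennreal (f b - f a)" if "a \<le> b" for a b
  proof -
    have "inv f -` {a<..b} = {f a<..f b}"
    proof (intro set_eqI)
      fix x
      have "a < inv f x \<longleftrightarrow> f a < x" "inv f x \<le> b \<longleftrightarrow> x \<le> f b"
        using strict_mono_less[OF mono, of a "inv f x"] strict_mono_less_eq[OF mono, of "inv f x" b] by (simp_all add: fi)
      then show "x \<in> inv f -` {a<..b} \<longleftrightarrow> x \<in> {f a<..f b}" by auto
    qed
    then show ?thesis
      using strict_mono_less_eq[OF mono] that by (simp add: \<nu>_def emeasure_distr)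
  qed
  define M where "M = measure_of UNIV (sets borel) (\<lambda>A. emeasure \<nu> A + emeasure \<mu> A)"
  have [simp]: "sets M = sets (borel :: real measure)"
    unfolding M_def by (metis sets.sets_measure_of_eq space_borel)
  have M: "emeasure M A = emeasure \<nu> A + emeasure \<mu> A" if A: "A \<in> sets borel" for A
  proof (rule emeasure_measure_of[OF M_def])
    show "countably_additive (sets M) (\<lambda>A. emeasure \<nu> A + emeasure \<mu> A)"
    proof (rule countably_additiveI)
      fix A :: "nat \<Rightarrow> real set" assume A: "range A \<subseteq> sets M" "disjoint_family A"
      have "(\<Sum>i. emeasure \<nu> (A i) + emeasure \<mu> (A i)) = (\<Sum>i. emeasure \<nu> (A i)) + (\<Sum>i. emeasure \<mu> (A i))"
        by (rule suminf_add[symmetric]) auto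
      then show "(\<Sum>i. emeasure \<nu> (A i) + emeasure \<mu> (A i)) = emeasure \<nu> (\<Union>i. A i) + emeasure \<mu> (\<Union>i. A i)"
        using A by (simp add: suminf_emeasure)
    qed
  qed (use A in \<open>auto simp: positive_def\<close>)
  \<comment> \<open>Half-open intervals generate the Borel sets, and on each of them the
    contributions \<open>f b - f a\<close> and \<open>F b - F a\<close> add up to
    \<open>L * (b - a)\<close>.\<close>
  have "M = density lborel (\<lambda>_. ennreal L)"
  proof (rule measure_eqI_generator_eq)
    let ?E = "range (\<lambda>(a, b). {a<..b::real})"
    show "Int_stable ?E"
    proof (rule Int_stableI)
      fix x y assume "x \<in> ?E" "y \<in> ?E"
      then obtain a b c d where "x = {a<..b}" "y = {c<..d}" by auto
      then have "x \<inter> y = (\<lambda>(a, b). {a<..b}) (max a c, min b d)" by auto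
      then show "x \<inter> y \<in> ?E" by blast
    qed
    show "sets M = sigma_sets UNIV ?E" "sets (density lborel (\<lambda>_. ennreal L)) = sigma_sets UNIV ?E"
      by (simp_all add: borel_sigma_sets_Ioc)
    show "emeasure M X = emeasure (density lborel (\<lambda>_. ennreal L)) X" if XE: "X \<in> ?E" for X
    proof -
      obtain a b where X: "X = {a<..b}" using XE by auto
      show ?thesis
      proof (cases "a \<le> b")
        case True
        have "emeasure M X = ennreal (f b - f a) + ennreal (F b - F a)"
          unfolding X \<mu>_def[symmetric]
          using True by (simp add: M \<nu>I) (simp add: \<mu>_def emeasure_interval_measure_Ioc[OF True Fm Fr])
        also have "\<dots> = ennreal (L * (b - a))"
          using strict_mono_less_eq[OF mono] Fm[OF True] True
          by (subst ennreal_plus[symmetric]) (auto simp: F_def algebra_simps)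
        also have "\<dots> = emeasure (density lborel (\<lambda>_. ennreal L)) X"
          using True L by (simp add: X emeasure_density nn_integral_cmult_indicator ennreal_mult)
        finally show ?thesis .
      qed (simp add: X)
    qed
    show "range (\<lambda>n::nat. {- real n<..real n}) \<subseteq> ?E" by auto
    show "(\<Union>n::nat. {- real n<..real n}) = UNIV"
    proof (intro equalityI subsetI UNIV_I)
      fix x :: real
      obtain n :: nat where "\<bar>x\<bar> < real n" using reals_Archimedean2 by blast
      then have "x \<in> {- real n<..real n}" by auto
      then show "x \<in> (\<Union>n::nat. {- real n<..real n})" by blast
    qed
    show "emeasure M {- real n<..real n} \<noteq> \<infinity>" for n
      by (simp add: M \<nu>I) (simp add: \<mu>_def emeasure_interval_measure_Ioc Fm Fr)
  qed auto
  then have "emeasure \<nu> A \<le> emeasure (density lborel (\<lambda>_. ennreal L)) A" if "A \<in> sets borel" for A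
    using M[OF that] by (metis le_iff_add)
  then have "\<nu> \<le> density lborel (\<lambda>_. ennreal L)"
    by (subst le_measure) auto
  then show ?thesis by (simp add: \<nu>_def)
qed

text \<open>The substitution \<open>s = f t\<close> as an inequality, with the Lipschitz constant
  bounding the Jacobian.\<close>

lemma nn_integral_inv_le:
  fixes f :: "real \<Rightarrow> real"
  assumes mono: "strict_mono f" and bij: "bij f" and lip: "L-lipschitz_on UNIV f"
    and F [measurable]: "F \<in> borel_measurable borel"
  shows "(\<integral>\<^sup>+s. F (inv f s) \<partial>lborel) \<le> ennreal L * (\<integral>\<^sup>+t. F t \<partial>lborel)"
proof -
  have [measurable]: "inv f \<in> borel_measurable borel" by (rule inv_measurable_of_strict_mono[OF mono bij])
  have "(\<integral>\<^sup>+s. F (inv f s) \<partial>lborel) = (\<integral>\<^sup>+t. F t \<partial>distr lborel borel (inv f))"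
    by (rule nn_integral_distr[symmetric]) auto
  also have "\<dots> \<le> (\<integral>\<^sup>+t. F t \<partial>density lborel (\<lambda>_. ennreal L))"
    by (rule nn_integral_mono_measure[OF _ distr_inv_le[OF mono bij lip]]) simp
  also have "\<dots> = ennreal L * (\<integral>\<^sup>+t. F t \<partial>lborel)"
    by (simp add: nn_integral_density nn_integral_cmult)
  finally show ?thesis .
qed

text \<open>A Lipschitz \<open>f\<close> carries null sets to null sets, so composition with
  \<open>inv f\<close> respects equality almost everywhere.\<close>

lemma AE_inv:
  fixes f :: "real \<Rightarrow> real"
  assumes mono: "strict_mono f" and bij: "bij f" and lip: "L-lipschitz_on UNIV f"
    and P: "AE t in lborel. P t"
  shows "AE s in lborel. P (inv f s)"
proof -
  have [measurable]: "inv f \<in> borel_measurable borel" by (rule inv_measurable_of_strict_mono[OF mono bij])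
  obtain N where N: "{t. \<not> P t} \<subseteq> N" "N \<in> sets borel" "emeasure lborel N = 0"
    using P by (auto elim!: AE_E)
  note [measurable] = N(2)
  have "(\<integral>\<^sup>+s. indicator N (inv f s) \<partial>lborel) \<le> ennreal L * (\<integral>\<^sup>+t. indicator N t \<partial>lborel)"
    by (rule nn_integral_inv_le[OF mono bij lip]) simp
  then have "(\<integral>\<^sup>+s. indicator N (inv f s) \<partial>lborel) = 0"
    using N by simp
  then have "AE s in lborel. (indicator N (inv f s) :: ennreal) = 0"
    by (subst (asm) nn_integral_0_iff_AE) auto
  then show ?thesis
    by eventually_elim (use N(1) in \<open>auto simp: indicator_def split: if_splits\<close>)
qed

text \<open>Under \<open>s = f t\<close> the weight becomes \<open>exp (-2 * \<rho> * f t)\<close>,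
  and since \<open>f\<close> runs ahead of the identity by \<open>e\<close>, the squared norm gains
  the factor \<open>exp (-2 * \<rho> * e)\<close>. With \<open>e = 0\<close> this gives boundedness
  for \<open>\<alpha>\<close>, with positive \<open>e\<close> smallness for
  \<open>\<beta>\<close>.\<close>

lemma
  fixes f :: "real \<Rightarrow> real"
  assumes mono: "strict_mono f" and bij: "bij f" and lip: "L-lipschitz_on UNIV f"
    and ge: "\<And>s. s + e \<le> f s" and u: "L2w \<rho> u" and \<rho>: "0 \<le> \<rho>"
  shows L2w_inv: "L2w \<rho> (\<lambda>s. u (inv f s))"
    and wnorm_inv_le: "wnorm \<rho> (\<lambda>s. u (inv f s)) \<le> sqrt L * exp (- \<rho> * e) * wnorm \<rho> u"
proof -
  note [measurable] = L2w_measurable[OF u] inv_measurable_of_strict_mono[OF mono bij]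
  have L: "0 \<le> L" using lip by (rule lipschitz_on_nonneg)
  have [measurable]: "f \<in> borel_measurable borel"
    by (rule borel_measurable_continuous_onI[OF lipschitz_on_continuous_on[OF lip]])
  have fi: "f (inv f s) = s" for s using bij by (simp add: bij_is_surj surj_f_inv_f)
  have m: "(\<lambda>s. u (inv f s)) \<in> borel_measurable borel" by measurable
  have nn: "0 \<le> sqrt L * exp (- \<rho> * e) * wnorm \<rho> u" using L by (simp add: wnorm_nonneg)
  have "(\<integral>\<^sup>+s. ennreal ((norm (u (inv f s)))^2 * exp (-2 * \<rho> * s)) \<partial>lborel)
      = (\<integral>\<^sup>+s. (\<lambda>t. ennreal ((norm (u t))^2 * exp (-2 * \<rho> * f t))) (inv f s) \<partial>lborel)"
    by (simp add: fi)
  also have "\<dots> \<le> ennreal L * (\<integral>\<^sup>+t. ennreal ((norm (u t))^2 * exp (-2 * \<rho> * f t)) \<partial>lborel)"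
    by (rule nn_integral_inv_le[OF mono bij lip]) measurable
  also have "\<dots> \<le> ennreal L * (\<integral>\<^sup>+t. ennreal (exp (-2 * \<rho> * e)) * ennreal ((norm (u t))^2 * exp (-2 * \<rho> * t)) \<partial>lborel)"
  proof (intro mult_left_mono nn_integral_mono)
    fix t
    have "\<rho> * (t + e) \<le> \<rho> * f t" using ge \<rho> by (intro mult_left_mono) auto
    then have "exp (-2 * \<rho> * f t) \<le> exp (-2 * \<rho> * e) * exp (-2 * \<rho> * t)"
      unfolding exp_add[symmetric] by (simp add: algebra_simps)
    then have "(norm (u t))^2 * exp (-2 * \<rho> * f t) \<le> exp (-2 * \<rho> * e) * ((norm (u t))^2 * exp (-2 * \<rho> * t))"
      using mult_left_mono[of "exp (-2 * \<rho> * f t)" "exp (-2 * \<rho> * e) * exp (-2 * \<rho> * t)" "(norm (u t))^2"]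
      by (simp add: mult.left_commute)
    then show "ennreal ((norm (u t))^2 * exp (-2 * \<rho> * f t)) \<le> ennreal (exp (-2 * \<rho> * e)) * ennreal ((norm (u t))^2 * exp (-2 * \<rho> * t))"
      by (subst ennreal_mult[symmetric]) (auto intro: ennreal_leI)
  qed simp
  also have "\<dots> = ennreal L * (ennreal (exp (-2 * \<rho> * e)) * ennreal ((wnorm \<rho> u)^2))"
    unfolding nn_integral_wnorm[OF u, symmetric] by (subst nn_integral_cmult) auto
  also have "\<dots> = ennreal (L * (exp (-2 * \<rho> * e) * (wnorm \<rho> u)^2))"
    using L by (simp add: ennreal_mult)
  also have "L * (exp (-2 * \<rho> * e) * (wnorm \<rho> u)^2) = (sqrt L * exp (- \<rho> * e) * wnorm \<rho> u)^2"
    using L by (simp add: power_mult_distrib exp_double[symmetric])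
  finally have bd: "(\<integral>\<^sup>+s. ennreal ((norm (u (inv f s)))^2 * exp (-2 * \<rho> * s)) \<partial>lborel)
      \<le> ennreal ((sqrt L * exp (- \<rho> * e) * wnorm \<rho> u)^2)" .
  show "L2w \<rho> (\<lambda>s. u (inv f s))" by (rule L2w_nn_integral_bound[OF m nn bd])
  show "wnorm \<rho> (\<lambda>s. u (inv f s)) \<le> sqrt L * exp (- \<rho> * e) * wnorm \<rho> u"
    by (rule wnorm_nn_integral_bound[OF m nn bd])
qed

subsection \<open>Causality and the fixed point argument\<close>

text \<open>Letting the exponential weight grow turns a uniform norm estimate into a statement
  about supports.\<close>
lemma eq_0_before_of_wnorm_le:
  assumes d: "\<And>\<eta>. 0 < \<eta> \<Longrightarrow> L2w \<eta> d" and e: "\<And>\<eta>. 0 < \<eta> \<Longrightarrow> L2w \<eta> e" and "0 < \<eta>1"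
    and le: "\<And>\<eta>. \<eta>1 \<le> \<eta> \<Longrightarrow> wnorm \<eta> d \<le> C * wnorm \<eta> e"
    and e0: "AE t in lborel. t < a \<longrightarrow> e t = 0"
  shows "AE t in lborel. t < a \<longrightarrow> d t = 0"
proof -
  \<comment> \<open>A gap \<open>\<delta>\<close> in front of \<open>a\<close> makes the exponential
    factors of the two sides differ; it is removed at the end along a sequence tending to 0.\<close>
  have before: "AE t in lborel. t < a - \<delta> \<longrightarrow> d t = 0" if "0 < \<delta>" for \<delta>
  proof -
    define h where "h t = (if t < a - \<delta> then d t else 0)" for t
    have dm [measurable]: "d \<in> borel_measurable borel" using d[OF \<open>0 < \<eta>1\<close>] by (rule L2w_measurable)
    have hm: "h \<in> borel_measurable borel" unfolding h_def by measurable
    have hL: "L2w \<eta>1 h"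
      by (rule L2w_mono(1)[OF hm d[OF \<open>0 < \<eta>1\<close>]]) (auto simp: h_def)
    \<comment> \<open>Raising the weight by \<open>r\<close> scales the part of \<open>d\<close>
      before \<open>a - \<delta>\<close> by at least \<open>exp (-2 * r * (a - \<delta>))\<close> in
      the squared norm, and \<open>e\<close>, which lives from \<open>a\<close> on, by at most
      \<open>exp (-2 * r * a)\<close>. The quotient is
      \<open>exp (-2 * r * \<delta>)\<close>.\<close>
    have bd: "(wnorm \<eta>1 h)^2 \<le> C^2 * (wnorm \<eta>1 e)^2 * exp (-2 * r * \<delta>)" if "0 \<le> r" for r
    proof -
      let ?\<eta> = "\<eta>1 + r"
      have \<eta>: "0 < ?\<eta>" using \<open>0 < \<eta>1\<close> that by simp
      have "exp (-2 * r * (a - \<delta>)) * (wnorm \<eta>1 h)^2 = (LINT t|lborel. exp (-2 * r * (a - \<delta>)) * ((norm (h t))^2 * exp (-2 * \<eta>1 * t)))"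
        by (simp add: wnorm_power2)
      also have "\<dots> \<le> (LINT t|lborel. (norm (d t))^2 * exp (-2 * ?\<eta> * t))"
      proof (rule integral_mono)
        show "integrable lborel (\<lambda>t. exp (-2 * r * (a - \<delta>)) * ((norm (h t))^2 * exp (-2 * \<eta>1 * t)))"
          by (intro integrable_mult_right L2w_integrable hL)
        show "integrable lborel (\<lambda>t. (norm (d t))^2 * exp (-2 * ?\<eta> * t))"
          by (intro L2w_integrable d \<eta>)
        fix t
        show "exp (-2 * r * (a - \<delta>)) * ((norm (h t))^2 * exp (-2 * \<eta>1 * t)) \<le> (norm (d t))^2 * exp (-2 * ?\<eta> * t)"
        proof (cases "t < a - \<delta>")
          case True
          then have "r * t \<le> r * (a - \<delta>)" using that by (intro mult_left_mono) auto
          then have "exp (-2 * r * (a - \<delta>)) * exp (-2 * \<eta>1 * t) \<le> exp (-2 * ?\<eta> * t)"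
            unfolding exp_add[symmetric] by (simp add: algebra_simps)
          from mult_left_mono[OF this, of "(norm (d t))^2"] show ?thesis
            using True by (simp add: h_def mult.left_commute)
        qed (simp add: h_def)
      qed
      also have "\<dots> = (wnorm ?\<eta> d)^2" by (simp add: wnorm_power2)
      also have "\<dots> \<le> (C * wnorm ?\<eta> e)^2"
        using that by (intro power_mono le wnorm_nonneg) simp
      also have "\<dots> = C^2 * (LINT t|lborel. (norm (e t))^2 * exp (-2 * ?\<eta> * t))"
        by (simp add: power_mult_distrib wnorm_power2)
      also have "(LINT t|lborel. (norm (e t))^2 * exp (-2 * ?\<eta> * t)) \<le> (LINT t|lborel. exp (-2 * r * a) * ((norm (e t))^2 * exp (-2 * \<eta>1 * t)))"
      proof (rule integral_mono_AE)
        show "integrable lborel (\<lambda>t. (norm (e t))^2 * exp (-2 * ?\<eta> * t))"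
          by (intro L2w_integrable e \<eta>)
        show "integrable lborel (\<lambda>t. exp (-2 * r * a) * ((norm (e t))^2 * exp (-2 * \<eta>1 * t)))"
          by (intro integrable_mult_right L2w_integrable e \<open>0 < \<eta>1\<close>)
        show "AE t in lborel. (norm (e t))^2 * exp (-2 * ?\<eta> * t) \<le> exp (-2 * r * a) * ((norm (e t))^2 * exp (-2 * \<eta>1 * t))"
          using e0
        proof eventually_elim
          case (elim t)
          show ?case
          proof (cases "t < a")
            case False
            then have "r * a \<le> r * t" using that by (intro mult_left_mono) auto
            then have "exp (-2 * ?\<eta> * t) \<le> exp (-2 * r * a) * exp (-2 * \<eta>1 * t)"
              unfolding exp_add[symmetric] by (simp add: algebra_simps)
            from mult_left_mono[OF this, of "(norm (e t))^2"] show ?thesis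
              by (simp add: mult.left_commute)
          qed (use elim in simp)
        qed
      qed
      also have "(LINT t|lborel. exp (-2 * r * a) * ((norm (e t))^2 * exp (-2 * \<eta>1 * t))) = exp (-2 * r * a) * (wnorm \<eta>1 e)^2"
        by (simp add: wnorm_power2)
      finally have "exp (-2 * r * (a - \<delta>)) * (wnorm \<eta>1 h)^2 \<le> C^2 * (exp (-2 * r * a) * (wnorm \<eta>1 e)^2)"
        by (simp add: mult_left_mono)
      moreover have "exp (-2 * r * a) = exp (-2 * r * (a - \<delta>)) * exp (-2 * r * \<delta>)"
        unfolding exp_add[symmetric] by (simp add: algebra_simps)
      ultimately have "exp (-2 * r * (a - \<delta>)) * (wnorm \<eta>1 h)^2
          \<le> exp (-2 * r * (a - \<delta>)) * (C^2 * (wnorm \<eta>1 e)^2 * exp (-2 * r * \<delta>))"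
        by (simp add: mult_ac)
      then show ?thesis by (subst (asm) mult_le_cancel_left_pos) auto
    qed
    have "(\<lambda>n. C^2 * (wnorm \<eta>1 e)^2 * exp (-2 * \<delta>) ^ n) \<longlonglongrightarrow> C^2 * (wnorm \<eta>1 e)^2 * 0"
      using \<open>0 < \<delta>\<close> by (intro tendsto_intros LIMSEQ_power_zero) auto
    moreover have "(wnorm \<eta>1 h)^2 \<le> C^2 * (wnorm \<eta>1 e)^2 * exp (-2 * \<delta>) ^ n" for n
      using bd[of "real n"] by (simp add: exp_of_nat_mult[symmetric] mult_ac)
    ultimately have "(wnorm \<eta>1 h)^2 \<le> C^2 * (wnorm \<eta>1 e)^2 * 0"
      by (intro LIMSEQ_le_const[of _ _ "(wnorm \<eta>1 h)^2"]) auto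
    then have "wnorm \<eta>1 h = 0" by simp
    then have "AE t in lborel. h t = 0" using wnorm_eq_0_iff[OF hL] by simp
    then show ?thesis by eventually_elim (auto simp: h_def)
  qed
  have "AE t in lborel. \<forall>n. t < a - inverse (real (Suc n)) \<longrightarrow> d t = 0"
    unfolding AE_all_countable by (intro allI before) simp
  then show ?thesis
  proof eventually_elim
    case (elim t)
    show ?case
    proof
      assume "t < a"
      then obtain n where "inverse (real (Suc n)) < a - t" using reals_Archimedean[of "a - t"] by auto
      then have "t < a - inverse (real (Suc n))" by simp
      then show "d t = 0" using elim by blast
    qed
  qed
qed

text \<open>The gate to \<open>\<Psi>\<close>: its continuity clause is evaluated along the
  truncations, which are admissible for \<open>\<Phi>\<close> and converge to
  \<open>x\<close>.\<close>

lemma trunc_cont_ext: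
  assumes "cont_ext \<rho> \<Phi> \<Psi>" "L2w \<rho> x"
  shows "L2w \<rho> (\<Psi> x)" "(\<lambda>n. wnorm \<rho> (\<lambda>t. \<Phi> (trunc n x) t - \<Psi> x t)) \<longlonglongrightarrow> 0"
proof -
  have *: "L2w \<rho> (\<Psi> x) \<and> (\<forall>us. (\<forall>n. \<forall>\<eta>>0. L2w \<eta> (us n)) \<longrightarrow>
      (\<lambda>n. wnorm \<rho> (\<lambda>t. us n t - x t)) \<longlonglongrightarrow> 0 \<longrightarrow> (\<lambda>n. wnorm \<rho> (\<lambda>t. \<Phi> (us n) t - \<Psi> x t)) \<longlonglongrightarrow> 0)"
    using assms unfolding cont_ext_def by (elim allE impE)
  then show "L2w \<rho> (\<Psi> x)" by (rule conjunct1)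
  show "(\<lambda>n. wnorm \<rho> (\<lambda>t. \<Phi> (trunc n x) t - \<Psi> x t)) \<longlonglongrightarrow> 0"
    by (rule conjunct2[OF *, rule_format]) (rule L2w_trunc[OF assms(2)] wnorm_trunc_tendsto[OF assms(2)])+
qed

text \<open>Truncation does not increase distances, so the estimate for \<open>\<Phi>\<close> on
  truncations survives the limit with the same constant.\<close>

lemma cont_ext_lipschitz:
  assumes ext: "cont_ext \<rho> \<Phi> \<Psi>" and "0 < \<rho>" "0 \<le> C"
    and maps: "\<And>u. (\<forall>\<eta>>0. L2w \<eta> u) \<Longrightarrow> (\<forall>\<eta>>0. L2w \<eta> (\<Phi> u))"
    and lip: "\<And>u w. (\<forall>\<eta>>0. L2w \<eta> u) \<Longrightarrow> (\<forall>\<eta>>0. L2w \<eta> w) \<Longrightarrow>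
           wnorm \<rho> (\<lambda>t. \<Phi> u t - \<Phi> w t) \<le> C * wnorm \<rho> (\<lambda>t. u t - w t)"
    and x: "L2w \<rho> x" and y: "L2w \<rho> y"
  shows "wnorm \<rho> (\<lambda>t. \<Psi> x t - \<Psi> y t) \<le> C * wnorm \<rho> (\<lambda>t. x t - y t)"
proof -
  note X = trunc_cont_ext[OF ext x] and Y = trunc_cont_ext[OF ext y]
  have L: "L2w \<rho> (\<Phi> (trunc n x))" "L2w \<rho> (\<Phi> (trunc n y))" for n
    using maps L2w_trunc[OF x] L2w_trunc[OF y] \<open>0 < \<rho>\<close> by blast+
  have "wnorm \<rho> (\<lambda>t. \<Psi> x t - \<Psi> y t) \<le> wnorm \<rho> (\<lambda>t. \<Phi> (trunc n x) t - \<Psi> x t)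
      + wnorm \<rho> (\<lambda>t. \<Phi> (trunc n y) t - \<Psi> y t) + C * wnorm \<rho> (\<lambda>t. x t - y t)" for n
  proof -
    have "wnorm \<rho> (\<lambda>t. \<Psi> x t - \<Psi> y t) \<le> wnorm \<rho> (\<lambda>t. \<Psi> x t - \<Phi> (trunc n x) t)
        + wnorm \<rho> (\<lambda>t. \<Phi> (trunc n x) t - \<Psi> y t)"
      by (rule wnorm_triangle[OF X(1) L(1) Y(1)])
    moreover have "wnorm \<rho> (\<lambda>t. \<Phi> (trunc n x) t - \<Psi> y t) \<le> wnorm \<rho> (\<lambda>t. \<Phi> (trunc n x) t - \<Phi> (trunc n y) t)
        + wnorm \<rho> (\<lambda>t. \<Phi> (trunc n y) t - \<Psi> y t)"
      by (rule wnorm_triangle[OF L(1) L(2) Y(1)])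
    moreover have "wnorm \<rho> (\<lambda>t. \<Phi> (trunc n x) t - \<Phi> (trunc n y) t) \<le> C * wnorm \<rho> (\<lambda>t. trunc n x t - trunc n y t)"
      using L2w_trunc[OF x] L2w_trunc[OF y] by (intro lip) auto
    moreover have "C * wnorm \<rho> (\<lambda>t. trunc n x t - trunc n y t) \<le> C * wnorm \<rho> (\<lambda>t. x t - y t)"
      using \<open>0 \<le> C\<close> by (intro mult_left_mono wnorm_trunc_diff_le x y)
    ultimately show ?thesis using wnorm_minus_commute[of \<rho> "\<Psi> x" "\<Phi> (trunc n x)"] by linarith
  qed
  moreover have "(\<lambda>n. wnorm \<rho> (\<lambda>t. \<Phi> (trunc n x) t - \<Psi> x t)
      + wnorm \<rho> (\<lambda>t. \<Phi> (trunc n y) t - \<Psi> y t) + C * wnorm \<rho> (\<lambda>t. x t - y t)) \<longlonglongrightarrow> 0 + 0 + C * wnorm \<rho> (\<lambda>t. x t - y t)"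
    by (intro tendsto_add X(2) Y(2) tendsto_const)
  ultimately have "wnorm \<rho> (\<lambda>t. \<Psi> x t - \<Psi> y t) \<le> 0 + 0 + C * wnorm \<rho> (\<lambda>t. x t - y t)"
    by (intro LIMSEQ_le_const) auto
  then show ?thesis by simp
qed

text \<open>For fixed \<open>n\<close> the truncated inputs agree before \<open>a\<close> and lie in
  all weighted spaces, so the Lipschitz bound for \<open>\<Phi>\<close> is available at every large
  weight. Only afterwards is the limit in \<open>n\<close> taken, at the weight
  \<open>\<rho>\<close>.\<close>

lemma cont_ext_causal:
  assumes ext: "cont_ext \<rho> \<Phi> \<Psi>" and "0 < \<rho>" "0 < \<rho>0"
    and maps: "\<And>u. (\<forall>\<eta>>0. L2w \<eta> u) \<Longrightarrow> (\<forall>\<eta>>0. L2w \<eta> (\<Phi> u))"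
    and lip: "\<And>\<eta> u w. \<rho>0 < \<eta> \<Longrightarrow> (\<forall>\<eta>>0. L2w \<eta> u) \<Longrightarrow> (\<forall>\<eta>>0. L2w \<eta> w) \<Longrightarrow>
           wnorm \<eta> (\<lambda>t. \<Phi> u t - \<Phi> w t) \<le> C * wnorm \<eta> (\<lambda>t. u t - w t)"
    and x: "L2w \<rho> x" and y: "L2w \<rho> y" and eq: "AE t in lborel. t < a \<longrightarrow> x t = y t"
  shows "AE t in lborel. t < a \<longrightarrow> \<Psi> x t = \<Psi> y t"
proof -
  note X = trunc_cont_ext[OF ext x] and Y = trunc_cont_ext[OF ext y]
  have tx: "\<forall>\<eta>>0. L2w \<eta> (trunc n x)" and ty: "\<forall>\<eta>>0. L2w \<eta> (trunc n y)" for n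
    using L2w_trunc[OF x] L2w_trunc[OF y] by blast+
  have L: "L2w \<eta> (\<Phi> (trunc n x))" "L2w \<eta> (\<Phi> (trunc n y))" if "0 < \<eta>" for n \<eta>
    using maps[OF tx] maps[OF ty] that by blast+
  have "AE t in lborel. t < a \<longrightarrow> \<Phi> (trunc n x) t - \<Phi> (trunc n y) t = 0" for n
  proof (rule eq_0_before_of_wnorm_le)
    show "L2w \<eta> (\<lambda>t. \<Phi> (trunc n x) t - \<Phi> (trunc n y) t)" if "0 < \<eta>" for \<eta>
      by (intro L2w_diff L that)
    show "L2w \<eta> (\<lambda>t. trunc n x t - trunc n y t)" for \<eta>
      by (rule L2w_diff[OF L2w_trunc[OF x] L2w_trunc[OF y]])
    \<comment> \<open>Starting at \<open>\<rho>0 + 1\<close> turns the strict condition on the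
      weights in \<open>lip\<close> into a closed threshold.\<close>
    show "wnorm \<eta> (\<lambda>t. \<Phi> (trunc n x) t - \<Phi> (trunc n y) t) \<le> C * wnorm \<eta> (\<lambda>t. trunc n x t - trunc n y t)"
      if "\<rho>0 + 1 \<le> \<eta>" for \<eta>
      using that by (intro lip tx ty) simp
    show "AE t in lborel. t < a \<longrightarrow> trunc n x t - trunc n y t = 0"
      using eq by eventually_elim (auto simp: trunc_def)
  qed (use \<open>0 < \<rho>0\<close> in simp)
  then have "AE t in lborel. t < a \<longrightarrow> \<Phi> (trunc n x) t = \<Phi> (trunc n y) t" for n by simp
  then show ?thesis
    by (intro limits_agree_before[OF L(1)[OF \<open>0 < \<rho>\<close>] X L(2)[OF \<open>0 < \<rho>\<close>] Y])
qed

theorem theorem5p16: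
  fixes C \<rho>0 :: real
    and \<Phi> :: "(real \<Rightarrow> 'h::{real_inner,complete_space} \<times> 'h) \<Rightarrow> (real \<Rightarrow> 'h)"
    and \<alpha> \<beta> :: "real \<Rightarrow> real"
  assumes C_pos: "C > 0" and rho0_pos: "\<rho>0 > 0"
    and Phi_maps: "\<And>u. (\<forall>\<eta>>0. L2w \<eta> u) \<Longrightarrow> (\<forall>\<eta>>0. L2w \<eta> (\<Phi> u))"
    and Phi_lip: "\<And>\<rho>. \<rho> > \<rho>0 \<Longrightarrow> \<exists>K>0. wnorm \<rho> (\<Phi> (\<lambda>t. 0)) \<le> K \<and>
        (\<forall>u w. (\<forall>\<eta>>0. L2w \<eta> u) \<longrightarrow> (\<forall>\<eta>>0. L2w \<eta> w) \<longrightarrow>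
           wnorm \<rho> (\<lambda>t. \<Phi> u t - \<Phi> w t) \<le> C * wnorm \<rho> (\<lambda>t. u t - w t))"
    and alpha_bij: "bij \<alpha>" and beta_bij: "bij \<beta>"
    and alpha_lip: "\<exists>L. L-lipschitz_on UNIV \<alpha>"
    and beta_lip: "\<exists>L. L-lipschitz_on UNIV \<beta>"
    and alpha_deriv: "\<exists>\<alpha>'. \<alpha>' \<in> borel_measurable lborel \<and> bounded (range \<alpha>') \<and>
        (AE t in lborel. (\<alpha> has_real_derivative \<alpha>' t) (at t))"
    and beta_deriv: "\<exists>\<beta>'. \<beta>' \<in> borel_measurable lborel \<and> bounded (range \<beta>') \<and>
        (AE t in lborel. (\<beta> has_real_derivative \<beta>' t) (at t))"
    and alpha_ge: "\<And>s. \<alpha> s \<ge> s"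
    and beta_ge: "\<exists>\<epsilon>0>0. \<forall>s. \<beta> s \<ge> s + \<epsilon>0"
  shows "\<exists>\<rho>1>\<rho>0. \<forall>\<rho>\<ge>\<rho>1. \<forall>\<Psi>. cont_ext \<rho> \<Phi> \<Psi> \<longrightarrow>
     ((\<exists>u. u \<in> dom_d0 \<rho> \<and>
          (AE t in lborel. d0 \<rho> u t = \<Psi> (\<lambda>s. (u (inv \<alpha> s), d0 \<rho> u (inv \<beta> s))) t))
      \<and> (\<forall>u1 u2. u1 \<in> dom_d0 \<rho> \<longrightarrow> u2 \<in> dom_d0 \<rho> \<longrightarrow>
          (AE t in lborel. d0 \<rho> u1 t = \<Psi> (\<lambda>s. (u1 (inv \<alpha> s), d0 \<rho> u1 (inv \<beta> s))) t) \<longrightarrow>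
          (AE t in lborel. d0 \<rho> u2 t = \<Psi> (\<lambda>s. (u2 (inv \<alpha> s), d0 \<rho> u2 (inv \<beta> s))) t) \<longrightarrow>
          (AE t in lborel. u1 t = u2 t))
      \<and> causal (dom_d0 \<rho>)
          (\<lambda>u. d0_inv \<rho> (\<Psi> (\<lambda>s. (u (inv \<alpha> s), d0 \<rho> u (inv \<beta> s))))))"
proof -
  obtain A where A: "A-lipschitz_on UNIV \<alpha>" using alpha_lip by blast
  obtain B where B: "B-lipschitz_on UNIV \<beta>" using beta_lip by blast
  obtain \<epsilon> where \<epsilon>: "0 < \<epsilon>" "\<And>s. s + \<epsilon> \<le> \<beta> s" using beta_ge by blast
  have beta_ge': "s \<le> \<beta> s" for s using \<epsilon>(2)[of s] \<epsilon>(1) by linarith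
  have \<alpha>: "strict_mono \<alpha>"
    by (rule continuous_bij_ge_strict_mono[OF lipschitz_on_continuous_on[OF A] alpha_bij alpha_ge])
  have \<beta>: "strict_mono \<beta>"
    by (rule continuous_bij_ge_strict_mono[OF lipschitz_on_continuous_on[OF B] beta_bij beta_ge'])
  have inv_le: "inv f s \<le> s" if "bij f" "\<And>s. s \<le> f s" for f :: "real \<Rightarrow> real" and s
    using that(2)[of "inv f s"] that(1) by (simp add: bij_is_surj surj_f_inv_f)
  have lip: "wnorm \<rho> (\<lambda>t. \<Phi> u t - \<Phi> w t) \<le> C * wnorm \<rho> (\<lambda>t. u t - w t)"
    if "\<rho>0 < \<rho>" "\<forall>\<eta>>0. L2w \<eta> u" "\<forall>\<eta>>0. L2w \<eta> w" for \<rho> u w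
    using Phi_lip[OF that(1)] that(2,3) by blast
  \<comment> \<open>The Lipschitz constant of the right-hand side as a function of the derivative:
    the first summand stems from integration followed by composition with
    \<open>inv \<alpha>\<close>, the second from the delay in \<open>\<beta>\<close>.\<close>
  define q where "q \<rho> = C * (sqrt A / \<rho> + sqrt B * exp (- \<rho> * \<epsilon>))" for \<rho>
  have "(q \<longlongrightarrow> C * (0 + sqrt B * 0)) at_top"
    unfolding q_def
  proof (intro tendsto_intros)
    show "((\<lambda>\<rho>. sqrt A / \<rho>) \<longlongrightarrow> 0) at_top"
      by (rule real_tendsto_divide_at_top[OF tendsto_const filterlim_ident])
    show "((\<lambda>\<rho>. exp (- \<rho> * \<epsilon>)) \<longlongrightarrow> 0) at_top"
    proof (rule filterlim_compose[OF exp_at_bot])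
      show "LIM \<rho> at_top. - \<rho> * \<epsilon> :> at_bot"
        using filterlim_tendsto_pos_mult_at_top[OF tendsto_const \<epsilon>(1) filterlim_ident]
        by (simp add: filterlim_uminus_at_top mult.commute)
    qed
  qed
  then have "\<forall>\<^sub>F \<rho> in at_top. q \<rho> < 1 / 2" by (rule order_tendstoD(2)) simp
  then obtain R where R: "\<And>\<rho>. R \<le> \<rho> \<Longrightarrow> q \<rho> < 1 / 2" by (auto simp: eventually_at_top_linorder)
  show ?thesis
  \<comment> \<open>\<open>R\<close> secures the contraction, \<open>\<rho>0 + 1\<close> the strict
    inequality.\<close>
  proof (intro exI[of _ "max R (\<rho>0 + 1)"] conjI allI impI)
    show "\<rho>0 < max R (\<rho>0 + 1)" by simp
    fix \<rho> \<Psi> assume "max R (\<rho>0 + 1) \<le> \<rho>" and ext: "cont_ext \<rho> \<Phi> \<Psi>"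
    then have \<rho>0: "\<rho>0 < \<rho>" and \<rho>: "0 < \<rho>" and q: "q \<rho> < 1 / 2" using rho0_pos R by auto
    \<comment> \<open>\<open>u\<close> and its derivative stay separate arguments, so that the
      estimates apply to every representative of the derivative and not only to
      \<open>d0 \<rho> u\<close>.\<close>
    define T where "T u v = \<Psi> (\<lambda>s. (u (inv \<alpha> s), v (inv \<beta> s)))" for u v
    have arg: "L2w \<rho> (\<lambda>s. (u (inv \<alpha> s), v (inv \<beta> s)))" if "L2w \<rho> u" "L2w \<rho> v" for u v :: "real \<Rightarrow> 'h"
      using L2w_inv[OF \<alpha> alpha_bij A, of 0 \<rho> u] L2w_inv[OF \<beta> beta_bij B \<epsilon>(2), of \<rho> v] that alpha_ge \<rho>
      by (intro L2w_Pair) auto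
    have TL: "L2w \<rho> (T u v)" if "L2w \<rho> u" "L2w \<rho> v" for u v
      unfolding T_def by (rule trunc_cont_ext(1)[OF ext arg[OF that]])
    \<comment> \<open>Distances are measured in the derivatives alone, as \<open>v - v'\<close>
      controls \<open>u - u'\<close> through integration.\<close>
    have contr: "wnorm \<rho> (\<lambda>t. T u v t - T u' v' t) \<le> 1 / 2 * wnorm \<rho> (\<lambda>t. v t - v' t)"
      if wd: "weak_deriv \<rho> u v" "weak_deriv \<rho> u' v'" for u v u' v'
    proof -
      let ?u = "\<lambda>t. u t - u' t" and ?v = "\<lambda>t. v t - v' t"
      have L: "L2w \<rho> u" "L2w \<rho> v" "L2w \<rho> u'" "L2w \<rho> v'" using wd by (auto simp: weak_deriv_def)
      note Ld = L2w_diff[OF L(1,3)] L2w_diff[OF L(2,4)]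
      have "wnorm \<rho> (\<lambda>t. T u v t - T u' v' t)
          \<le> C * wnorm \<rho> (\<lambda>s. (u (inv \<alpha> s), v (inv \<beta> s)) - (u' (inv \<alpha> s), v' (inv \<beta> s)))"
        unfolding T_def
        by (rule cont_ext_lipschitz[OF ext \<rho> _ Phi_maps lip[OF \<rho>0] arg[OF L(1,2)] arg[OF L(3,4)]])
           (use C_pos in auto)
      also have "\<dots> = C * wnorm \<rho> (\<lambda>s. (?u (inv \<alpha> s), ?v (inv \<beta> s)))" by simp
      also have "\<dots> \<le> C * (wnorm \<rho> (\<lambda>s. ?u (inv \<alpha> s)) + wnorm \<rho> (\<lambda>s. ?v (inv \<beta> s)))"
        using C_pos L2w_inv[OF \<alpha> alpha_bij A, of 0 \<rho> ?u] L2w_inv[OF \<beta> beta_bij B \<epsilon>(2), of \<rho> ?v] Ld alpha_ge \<rho>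
        by (intro mult_left_mono wnorm_Pair_le) auto
      also have "\<dots> \<le> C * (sqrt A * (wnorm \<rho> ?v / \<rho>) + sqrt B * exp (- \<rho> * \<epsilon>) * wnorm \<rho> ?v)"
      proof (intro mult_left_mono add_mono)
        have "wnorm \<rho> (\<lambda>s. ?u (inv \<alpha> s)) \<le> sqrt A * exp (- \<rho> * 0) * wnorm \<rho> ?u"
          by (rule wnorm_inv_le[OF \<alpha> alpha_bij A _ Ld(1)]) (use alpha_ge \<rho> in auto)
        also have "\<dots> \<le> sqrt A * (wnorm \<rho> ?v / \<rho>)"
          using mult_left_mono[OF weak_deriv_wnorm_le[OF weak_deriv_diff[OF wd] \<rho>], of "sqrt A"]
            lipschitz_on_nonneg[OF A] by simp
        finally show "wnorm \<rho> (\<lambda>s. ?u (inv \<alpha> s)) \<le> sqrt A * (wnorm \<rho> ?v / \<rho>)" .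
        show "wnorm \<rho> (\<lambda>s. ?v (inv \<beta> s)) \<le> sqrt B * exp (- \<rho> * \<epsilon>) * wnorm \<rho> ?v"
          by (rule wnorm_inv_le[OF \<beta> beta_bij B \<epsilon>(2) Ld(2)]) (use \<rho> in simp)
      qed (use C_pos in simp)
      also have "\<dots> = q \<rho> * wnorm \<rho> ?v" by (simp add: q_def algebra_simps)
      also have "\<dots> \<le> 1 / 2 * wnorm \<rho> ?v" using q by (intro mult_right_mono wnorm_nonneg) simp
      finally show ?thesis .
    qed
    define I :: "(real \<Rightarrow> 'h) \<Rightarrow> real \<Rightarrow> 'h" where "I = d0_inv \<rho>"
    have I: "weak_deriv \<rho> (I v) v" if "L2w \<rho> v" for v
      unfolding I_def by (rule d0_inv_weak_deriv[OF that \<rho>])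
    have IL: "L2w \<rho> (I v)" if "L2w \<rho> v" for v using I[OF that] by (simp add: weak_deriv_def)
    show "\<exists>u. u \<in> dom_d0 \<rho> \<and>
        (AE t in lborel. d0 \<rho> u t = \<Psi> (\<lambda>s. (u (inv \<alpha> s), d0 \<rho> u (inv \<beta> s))) t)"
    proof -
      \<comment> \<open>Picard iteration for the derivative, with increments halved at each
        step.\<close>
      define v where "v n = ((\<lambda>v. T (I v) v) ^^ n) (\<lambda>_. 0)" for n
      have vS: "v (Suc n) = T (I (v n)) (v n)" for n by (simp add: v_def)
      have vL: "L2w \<rho> (v n)" for n
      proof (induction n)
        case 0
        then show ?case by (simp add: v_def L2w_iff)
      qed (simp add: vS TL IL)
      define c where "c = wnorm \<rho> (\<lambda>t. v 1 t - v 0 t)"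
      have "wnorm \<rho> (\<lambda>t. v (Suc n) t - v n t) \<le> c * (1 / 2) ^ n" for n
      proof (induction n)
        case (Suc n)
        have "wnorm \<rho> (\<lambda>t. v (Suc (Suc n)) t - v (Suc n) t) \<le> 1 / 2 * wnorm \<rho> (\<lambda>t. v (Suc n) t - v n t)"
          unfolding vS[of "Suc n"] vS[of n] by (rule contr) (intro I vL TL IL)+
        also have "\<dots> \<le> c * (1 / 2) ^ Suc n" using Suc by simp
        finally show ?case .
      qed (simp add: c_def)
      then obtain w where w: "L2w \<rho> w" "(\<lambda>n. wnorm \<rho> (\<lambda>t. v n t - w t)) \<longlonglongrightarrow> 0"
        by (rule L2w_geometric_limit[OF vL, rotated 3]) (auto simp: c_def wnorm_nonneg)
      define u where "u = I w"
      have uw: "weak_deriv \<rho> u w" unfolding u_def by (rule I[OF w(1)])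
      have uL: "L2w \<rho> u" using uw by (simp add: weak_deriv_def)
      \<comment> \<open>Both terms tend to 0: the iterates approach \<open>w\<close>, and their
        images under \<open>T\<close>, being the next iterates, approach
        \<open>T u w\<close>.\<close>
      have le: "wnorm \<rho> (\<lambda>t. T u w t - w t) \<le> 1 / 2 * wnorm \<rho> (\<lambda>t. v n t - w t) + wnorm \<rho> (\<lambda>t. v (Suc n) t - w t)" for n
      proof -
        have "wnorm \<rho> (\<lambda>t. T u w t - w t) \<le> wnorm \<rho> (\<lambda>t. T u w t - v (Suc n) t) + wnorm \<rho> (\<lambda>t. v (Suc n) t - w t)"
          by (rule wnorm_triangle[OF TL[OF uL w(1)] vL w(1)])
        moreover have "wnorm \<rho> (\<lambda>t. T u w t - v (Suc n) t) \<le> 1 / 2 * wnorm \<rho> (\<lambda>t. w t - v n t)"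
          unfolding vS by (rule contr[OF uw I[OF vL]])
        ultimately show ?thesis by (simp add: wnorm_minus_commute[of \<rho> w])
      qed
      have "(\<lambda>n. 1 / 2 * wnorm \<rho> (\<lambda>t. v n t - w t) + wnorm \<rho> (\<lambda>t. v (Suc n) t - w t)) \<longlonglongrightarrow> 1 / 2 * 0 + 0"
        by (intro tendsto_add tendsto_mult tendsto_const w(2) LIMSEQ_Suc[OF w(2)])
      then have "wnorm \<rho> (\<lambda>t. T u w t - w t) \<le> 1 / 2 * 0 + 0"
        by (rule LIMSEQ_le_const) (use le in auto)
      then have "wnorm \<rho> (\<lambda>t. T u w t - w t) = 0"
        using wnorm_nonneg[of \<rho> "\<lambda>t. T u w t - w t"] by simp
      then have fixpoint: "AE t in lborel. T u w t = w t"
        using wnorm_diff_eq_0_iff[OF TL[OF uL w(1)] w(1)] by simp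
      have dom: "u \<in> dom_d0 \<rho>" using uw by (auto simp: dom_d0_def)
      note ud = d0_weak_deriv[OF dom]
      have dL: "L2w \<rho> (d0 \<rho> u)" using ud by (simp add: weak_deriv_def)
      \<comment> \<open>\<open>d0\<close> may pick a derivative other than \<open>w\<close>. The two
        agree almost everywhere, and the contraction estimate shows that \<open>\<Psi>\<close> does
        not distinguish them, so the fixed point carries over to \<open>d0 \<rho> u\<close>.\<close>
      have dw: "AE t in lborel. d0 \<rho> u t = w t" by (rule weak_deriv_unique[OF ud uw]) simp
      then have "wnorm \<rho> (\<lambda>t. d0 \<rho> u t - w t) = 0" using wnorm_diff_eq_0_iff[OF dL w(1)] by simp
      then have "wnorm \<rho> (\<lambda>t. T u (d0 \<rho> u) t - T u w t) = 0"
        using contr[OF ud uw] wnorm_nonneg[of \<rho> "\<lambda>t. T u (d0 \<rho> u) t - T u w t"] by simp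
      then have "AE t in lborel. T u (d0 \<rho> u) t = T u w t"
        using wnorm_diff_eq_0_iff[OF TL[OF uL dL] TL[OF uL w(1)]] by simp
      with fixpoint dw have "AE t in lborel. d0 \<rho> u t = T u (d0 \<rho> u) t"
        by eventually_elim simp
      then show ?thesis using dom unfolding T_def by blast
    qed
    show "AE t in lborel. u1 t = u2 t"
      if dom: "u1 \<in> dom_d0 \<rho>" "u2 \<in> dom_d0 \<rho>"
        and eq: "AE t in lborel. d0 \<rho> u1 t = \<Psi> (\<lambda>s. (u1 (inv \<alpha> s), d0 \<rho> u1 (inv \<beta> s))) t"
          "AE t in lborel. d0 \<rho> u2 t = \<Psi> (\<lambda>s. (u2 (inv \<alpha> s), d0 \<rho> u2 (inv \<beta> s))) t" for u1 u2
    proof -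
      note wd = d0_weak_deriv[OF dom(1)] d0_weak_deriv[OF dom(2)]
      have L: "L2w \<rho> u1" "L2w \<rho> (d0 \<rho> u1)" "L2w \<rho> u2" "L2w \<rho> (d0 \<rho> u2)"
        using wd by (auto simp: weak_deriv_def)
      have "wnorm \<rho> (\<lambda>t. d0 \<rho> u1 t - d0 \<rho> u2 t) = wnorm \<rho> (\<lambda>t. T u1 (d0 \<rho> u1) t - T u2 (d0 \<rho> u2) t)"
      proof (rule wnorm_cong_AE)
        show "AE t in lborel. norm (d0 \<rho> u1 t - d0 \<rho> u2 t) = norm (T u1 (d0 \<rho> u1) t - T u2 (d0 \<rho> u2) t)"
          using eq by eventually_elim (simp add: T_def)
      qed (intro L2w_measurable[OF L2w_diff[OF L(2,4)]] L2w_measurable[OF L2w_diff[OF TL[OF L(1,2)] TL[OF L(3,4)]]])+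
      then have "wnorm \<rho> (\<lambda>t. d0 \<rho> u1 t - d0 \<rho> u2 t) = 0"
        using contr[OF wd] wnorm_nonneg[of \<rho> "\<lambda>t. d0 \<rho> u1 t - d0 \<rho> u2 t"] by simp
      then have "AE t in lborel. d0 \<rho> u1 t = d0 \<rho> u2 t" using wnorm_diff_eq_0_iff[OF L(2,4)] by simp
      \<comment> \<open>Equal derivatives force equal functions because the weight excludes nonzero
        constants.\<close>
      then show ?thesis by (rule weak_antideriv_unique[OF wd \<rho>])
    qed
    show "causal (dom_d0 \<rho>) (\<lambda>u. d0_inv \<rho> (\<Psi> (\<lambda>s. (u (inv \<alpha> s), d0 \<rho> u (inv \<beta> s)))))"
      unfolding causal_def
    proof (intro allI impI)
      fix a :: real and x y :: "real \<Rightarrow> 'h"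
      assume dom: "x \<in> dom_d0 \<rho>" "y \<in> dom_d0 \<rho>" and eq: "AE t in lborel. t < a \<longrightarrow> x t = y t"
      note wd = d0_weak_deriv[OF dom(1)] d0_weak_deriv[OF dom(2)]
      have L: "L2w \<rho> x" "L2w \<rho> (d0 \<rho> x)" "L2w \<rho> y" "L2w \<rho> (d0 \<rho> y)"
        using wd by (auto simp: weak_deriv_def)
      have deq: "AE t in lborel. t < a \<longrightarrow> d0 \<rho> x t = d0 \<rho> y t"
        by (rule weak_deriv_unique_before[OF wd eq])
      \<comment> \<open>\<open>\<alpha>\<close> and \<open>\<beta>\<close> lie above the identity,
        so their inverses send times before \<open>a\<close> to times before \<open>a\<close>; the
        exceptional null sets are transported along the inverses as well.\<close>
      have argeq: "AE s in lborel. s < a \<longrightarrow> (x (inv \<alpha> s), d0 \<rho> x (inv \<beta> s)) = (y (inv \<alpha> s), d0 \<rho> y (inv \<beta> s))"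
        using AE_inv[OF \<alpha> alpha_bij A eq] AE_inv[OF \<beta> beta_bij B deq]
      proof eventually_elim
        case (elim s)
        then show ?case
          using inv_le[OF alpha_bij alpha_ge, of s] inv_le[OF beta_bij beta_ge', of s] by auto
      qed
      have "AE t in lborel. t < a \<longrightarrow> T x (d0 \<rho> x) t = T y (d0 \<rho> y) t"
        unfolding T_def
        by (rule cont_ext_causal[OF ext \<rho> rho0_pos Phi_maps lip arg[OF L(1,2)] arg[OF L(3,4)] argeq])
      from weak_antideriv_unique_before[OF I[OF TL[OF L(1,2)]] I[OF TL[OF L(3,4)]] \<rho> this]
      show "AE t in lborel. t < a \<longrightarrow> d0_inv \<rho> (\<Psi> (\<lambda>s. (x (inv \<alpha> s), d0 \<rho> x (inv \<beta> s)))) t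
          = d0_inv \<rho> (\<Psi> (\<lambda>s. (y (inv \<alpha> s), d0 \<rho> y (inv \<beta> s)))) t"
        by (simp add: T_def I_def)
    qed
  qed
qed


end
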